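(* Let $\Sigma$ be a smooth curve in $\mathbb{C}P^2$, with $K$ the sectional curvature of its projectively induced metric (that is, the metric induced by the metric of $\mathbb{C}P^2$). Then $$\mathcal{T}(\Sigma)=\frac{1}{\pi}\int_{\Sigma}\frac{(K-4)^2+4}{6-K}\,dA_{\Sigma}.$$
   Context: $\mathbb{C}P^N$ carries its canonical (Fubini–Study) metric, normalized to have holomorphic sectional curvature $4$. A smooth curve in $\mathbb{C}P^2$ is a smooth complex projective algebraic curve, i.e. a compact complex submanifold of complex dimension $1$; its Gauss curvature satisfies $K\le 4$. For a normal vector $\vec v$ to a complex manifold $M$ immersed in $\mathbb{C}P^N$, at $p$, $A_{\vec v}:T_pM\to T_pM$ denotes the second fundamental form (shape operator), $A_{\vec v}(x)=-(\nabla_x V)^{\top}$ for any normal field $V$ extending $\vec v$. The total absolute curvature of a complex manifold $M$ of complex dimension $m$ holomorphically immersed in $\mathbb{C}P^N$ is $$\mathcal{T}(M)=\frac{2}{\mathrm{Vol}(\mathbb{C}P^N)}\int_{\nu^{<\pi/2}M}\left|\det\left(\cos(r)\,\mathrm{Id}_{T_pM}-\left(\tfrac{\sin r}{r}\right)A_{\vec v}\right)\right|\cos(r)\left(\tfrac{\sin r}{r}\right)^{2N-2m-1}dVol_{\nu^{<\pi/2}M}(\vec v),$$ where $\nu^{<\pi/2}M$ is the bundle of normal vectors of length less than $\pi/2$ (with its natural volume form, $dVol_M$ times Lebesgue measure on the fibres), $p$ is the base point of $\vec v$, $r=\|\vec v\|$, and $\frac{\sin r}{r}=1$ at $r=0$.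 Here $m=1$, $N=2$. *)

theory Defs
  imports "HOL-Analysis.Analysis" "HOL-Probability.Sinc_Integral"
begin

section \<open>Riemannian geometry in local coordinates\<close>

text \<open>A Riemannian metric on an open subset of a Euclidean space is a function \<open>g\<close>, where
  \<open>g x u v\<close> is the inner product of the tangent vectors \<open>u\<close>, \<open>v\<close> at \<open>x\<close>.\<close>

abbreviation D :: "('a::real_normed_vector \<Rightarrow> 'b::real_normed_vector) \<Rightarrow> 'a \<Rightarrow> 'a \<Rightarrow> 'b" where
  "D f x \<equiv> frechet_derivative f (at x)"

text \<open>The covariant derivative of the constant field \<open>v\<close> in direction \<open>u\<close>, for the Levi-Civita
  connection: the Koszul formula for constant (hence commuting) vector fields.\<close>

definition christoffel ::
    "('a::euclidean_space \<Rightarrow> 'a \<Rightarrow> 'a \<Rightarrow> real) \<Rightarrow> 'a \<Rightarrow> 'a \<Rightarrow> 'a \<Rightarrow> 'a" where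
  "christoffel g x u v =
     (THE w. \<forall>y. 2 * g x w y =
        D (\<lambda>q. g q v y) x u + D (\<lambda>q. g q u y) x v - D (\<lambda>q. g q u v) x y)"

definition cov_deriv ::
    "('a::euclidean_space \<Rightarrow> 'a \<Rightarrow> 'a \<Rightarrow> real) \<Rightarrow> ('a \<Rightarrow> 'a) \<Rightarrow> 'a \<Rightarrow> 'a \<Rightarrow> 'a" where
  "cov_deriv g V x u = D V x u + christoffel g x u (V x)"

text \<open>\<open>R(u,v)w = \<nabla>\<^sub>u \<nabla>\<^sub>v w - \<nabla>\<^sub>v \<nabla>\<^sub>u w\<close>, with \<open>u\<close>, \<open>v\<close>, \<open>w\<close> extended to constant fields,
  so that the bracket term vanishes.\<close>

definition riemann_tensor ::
    "('a::euclidean_space \<Rightarrow> 'a \<Rightarrow> 'a \<Rightarrow> real) \<Rightarrow> 'a \<Rightarrow> 'a \<Rightarrow> 'a \<Rightarrow> 'a \<Rightarrow> 'a" where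
  "riemann_tensor g x u v w =
     cov_deriv g (\<lambda>q. cov_deriv g (\<lambda>_. w) q v) x u
   - cov_deriv g (\<lambda>q. cov_deriv g (\<lambda>_. w) q u) x v"

definition sectional_curvature ::
    "('a::euclidean_space \<Rightarrow> 'a \<Rightarrow> 'a \<Rightarrow> real) \<Rightarrow> 'a \<Rightarrow> 'a \<Rightarrow> 'a \<Rightarrow> real" where
  "sectional_curvature g x u v =
     g x (riemann_tensor g x u v v) u / (g x u u * g x v v - (g x u v)\<^sup>2)"

text \<open>The determinant of a square matrix with rows and columns indexed by the finite set \<open>B\<close>.\<close>

definition leibniz_det :: "'b set \<Rightarrow> ('b \<Rightarrow> 'b \<Rightarrow> real) \<Rightarrow> real" where
  "leibniz_det B m = (\<Sum>\<pi> | \<pi> permutes B. of_int (sign \<pi>) * (\<Prod>b\<in>B. m b (\<pi> b)))"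

definition volume_density :: "('a::euclidean_space \<Rightarrow> 'a \<Rightarrow> 'a \<Rightarrow> real) \<Rightarrow> 'a \<Rightarrow> real" where
  "volume_density g x = sqrt (leibniz_det Basis (g x))"


section \<open>The complex projective plane with the Fubini-Study metric\<close>

text \<open>A point of the complex projective plane, i.e. a complex line in \<open>\<complex>\<^sup>3\<close>, is represented by
  the Hermitian matrix of the orthogonal projection onto it. This makes the projective plane a
  compact submanifold of the space of complex 3x3 matrices, and its tangent vectors are matrices.\<close>

type_synonym cmat = "complex ^ 3 ^ 3"

definition line_of :: "complex ^ 3 \<Rightarrow> cmat" where
  "line_of z = (\<chi> i j. z $ i * cnj (z $ j) / of_real ((norm z)\<^sup>2))"

definition CP2 :: "cmat set" where
  "CP2 = line_of ` (- {0})"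

definition affine_charts :: "(complex ^ 2 \<Rightarrow> cmat) set" where
  "affine_charts =
     {\<lambda>a. line_of (vector [1, a $ 1, a $ 2]),
      \<lambda>a. line_of (vector [a $ 1, 1, a $ 2]),
      \<lambda>a. line_of (vector [a $ 1, a $ 2, 1])}"

text \<open>The Fubini-Study metric, on tangent vectors viewed as matrices, is
  \<open>Re (tr (X Y\<^sup>*)) / 2\<close>. The factor is the one for which the Hopf map from the unit
  sphere is a Riemannian submersion (\<open>hopf_submersion\<close> below), i.e. for which the holomorphic
  sectional curvature is 4.\<close>

definition fs :: "cmat \<Rightarrow> cmat \<Rightarrow> real" where
  "fs X Y = X \<bullet> Y / 2"

definition fs_norm :: "cmat \<Rightarrow> real" where
  "fs_norm X = sqrt (fs X X)"

text \<open>The metric induced on the parameter domain of a map into the projective plane.\<close>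

definition pullback ::
    "('a::euclidean_space \<Rightarrow> cmat) \<Rightarrow> 'a \<Rightarrow> 'a \<Rightarrow> 'a \<Rightarrow> real" where
  "pullback \<gamma> x u v = fs (D \<gamma> x u) (D \<gamma> x v)"

text \<open>Velocities at \<open>p\<close> of curves in \<open>M\<close>; used for submanifolds \<open>M\<close> only.\<close>

definition tangent_space :: "cmat set \<Rightarrow> cmat \<Rightarrow> cmat set" where
  "tangent_space M p =
     {v. \<exists>c :: real \<Rightarrow> cmat. c 0 = p \<and> (\<forall>t. c t \<in> M) \<and> (c has_vector_derivative v) (at 0)}"

text \<open>The Riemannian volume measure of a submanifold \<open>M\<close> covered by the images of the
  parametrizations in \<open>\<Phi>\<close> (pairs of an open domain and a map). For each parametrization, the
  measure with density \<open>\<surd>(det g)\<close> is pushed forward to \<open>M\<close>. By the change of variables formula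
  these measures agree on overlaps, so that their supremum in the complete lattice of measures
  (not a pointwise supremum) is the measure glued from them.\<close>

definition riemannian_measure ::
    "cmat set \<Rightarrow> ('a::euclidean_space set \<times> ('a \<Rightarrow> cmat)) set \<Rightarrow> cmat measure" where
  "riemannian_measure M \<Phi> =
     (SUP (U, \<gamma>) \<in> \<Phi>.
        distr (density (restrict_space lborel U) (\<lambda>x. ennreal (volume_density (pullback \<gamma>) x)))
              (restrict_space borel M) \<gamma>)"

definition vol_CP2 :: real where
  "vol_CP2 = measure (riemannian_measure CP2 ((\<lambda>\<psi>. (UNIV, \<psi>)) ` affine_charts)) CP2"


section \<open>Smooth curves\<close>

text \<open>A holomorphic parametrization of an open piece of \<open>S\<close>. A map to the projective plane is
  holomorphic if it lifts locally to a holomorphic map into \<open>\<complex>\<^sup>3 - {0}\<close>; the lift is required on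
  the whole of \<open>U\<close>, which can be achieved by shrinking \<open>U\<close>.\<close>

definition holo_param :: "cmat set \<Rightarrow> complex set \<Rightarrow> (complex \<Rightarrow> cmat) \<Rightarrow> bool" where
  "holo_param S U \<gamma> \<longleftrightarrow>
     open U \<and>
     (\<exists>f :: complex \<Rightarrow> complex ^ 3.
        (\<forall>i. (\<lambda>z. f z $ i) holomorphic_on U) \<and> (\<forall>z\<in>U. f z \<noteq> 0 \<and> \<gamma> z = line_of (f z))) \<and>
     (\<forall>z\<in>U. inj (D \<gamma> z)) \<and>
     openin (top_of_set S) (\<gamma> ` U) \<and>
     (\<exists>\<delta>. homeomorphism U (\<gamma> ` U) \<gamma> \<delta>)"

definition smooth_curve :: "cmat set \<Rightarrow> bool" where
  "smooth_curve S \<longleftrightarrow>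
     S \<noteq> {} \<and> S \<subseteq> CP2 \<and> compact S \<and> (\<forall>p\<in>S. \<exists>U \<gamma>. holo_param S U \<gamma> \<and> p \<in> \<gamma> ` U)"

definition area_measure :: "cmat set \<Rightarrow> cmat measure" where
  "area_measure S = riemannian_measure S {(U, \<gamma>). holo_param S U \<gamma>}"

text \<open>The sectional curvature of the tangent plane at \<open>p\<close>, for the induced metric.\<close>

definition gauss_curvature :: "cmat set \<Rightarrow> cmat \<Rightarrow> real" where
  "gauss_curvature S p =
     (THE K. \<exists>U \<gamma> z. holo_param S U \<gamma> \<and> z \<in> U \<and> \<gamma> z = p \<and>
                    K = sectional_curvature (pullback \<gamma>) z 1 \<i>)"


section \<open>Normal bundle and shape operator\<close>

definition normal_space :: "cmat set \<Rightarrow> cmat \<Rightarrow> cmat set" where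
  "normal_space S p = {v \<in> tangent_space CP2 p. \<forall>x\<in>tangent_space S p. fs v x = 0}"

definition tangential_part :: "cmat set \<Rightarrow> cmat \<Rightarrow> cmat \<Rightarrow> cmat" where
  "tangential_part S p w =
     (THE y. y \<in> tangent_space S p \<and> (\<forall>x\<in>tangent_space S p. fs (w - y) x = 0))"

text \<open>\<open>A\<^sub>v(x) = - (\<nabla>\<^sub>x V)\<^sup>T\<close>, computed in an affine chart \<open>\<psi>\<close> around \<open>p = \<psi> a\<close>, for any
  vector field extending \<open>v\<close> that is normal along \<open>S\<close>. The field is \<open>d\<psi> W\<close>, where \<open>W\<close> is its
  coordinate representation, and \<open>\<xi>\<close> is that of \<open>x\<close>. The result depends neither on the field
  nor on the chart.\<close>

definition shape_operator :: "cmat set \<Rightarrow> cmat \<Rightarrow> cmat \<Rightarrow> cmat \<Rightarrow> cmat" where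
  "shape_operator S p v x =
     (THE y. \<exists>\<psi>\<in>affine_charts. \<exists>N a W \<xi>.
        open N \<and> a \<in> N \<and> \<psi> a = p \<and>
        W differentiable_on N \<and>
        (\<forall>b\<in>N. \<psi> b \<in> S \<longrightarrow> D \<psi> b (W b) \<in> normal_space S (\<psi> b)) \<and>
        D \<psi> a (W a) = v \<and> D \<psi> a \<xi> = x \<and>
        y = - tangential_part S p (D \<psi> a (cov_deriv (pullback \<psi>) W a \<xi>)))"

definition orthonormal_basis :: "cmat set \<Rightarrow> cmat set" where
  "orthonormal_basis T =
     (SOME B. span B = T \<and> (\<forall>b\<in>B. \<forall>c\<in>B. fs b c = (if b = c then 1 else 0)))"

text \<open>The determinant of an endomorphism of a subspace, and the Lebesgue measure of a subspace
  with respect to the Fubini-Study inner product; both are independent of the basis.\<close>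

definition det_on :: "cmat set \<Rightarrow> (cmat \<Rightarrow> cmat) \<Rightarrow> real" where
  "det_on T L = leibniz_det (orthonormal_basis T) (\<lambda>b c. fs (L b) c)"

definition lebesgue_of_subspace :: "cmat set \<Rightarrow> cmat measure" where
  "lebesgue_of_subspace T =
     distr (PiM (orthonormal_basis T) (\<lambda>_. lborel)) borel
           (\<lambda>f. \<Sum>b\<in>orthonormal_basis T. f b *\<^sub>R b)"

definition normal_bundle :: "cmat set \<Rightarrow> (cmat \<times> cmat) set" where
  "normal_bundle S = {(p, v). p \<in> S \<and> v \<in> normal_space S p}"

definition normal_bundle_measure :: "cmat set \<Rightarrow> (cmat \<times> cmat) measure" where
  "normal_bundle_measure S =
     measure_of (normal_bundle S) (sets (restrict_space borel (normal_bundle S)))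
       (\<lambda>A. \<integral>\<^sup>+ p. emeasure (lebesgue_of_subspace (normal_space S p)) {v. (p, v) \<in> A}
              \<partial>area_measure S)"

text \<open>The total absolute curvature of a complex submanifold of dimension \<open>m = 1\<close> of the
  projective space of dimension \<open>N = 2\<close>; the last exponent is \<open>2 N - 2 m - 1\<close>. The library
  function \<open>sinc\<close> is \<open>sin r / r\<close>, with value 1 at 0.\<close>

definition total_absolute_curvature :: "cmat set \<Rightarrow> real" where
  "total_absolute_curvature S =
     2 / vol_CP2 *
     (LINT q : {(p, v) \<in> normal_bundle S. fs_norm v < pi / 2} | normal_bundle_measure S.
        (case q of (p, v) \<Rightarrow>
           (let r = fs_norm v in
              \<bar>det_on (tangent_space S p)
                 (\<lambda>x. cos r *\<^sub>R x - sinc r *\<^sub>R shape_operator S p v x)\<bar>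
              * cos r * sinc r ^ (2 * 2 - 2 * 1 - 1))))"


section \<open>Normalization of the metric\<close>

text \<open>At a point \<open>z\<close> of the unit sphere, the differential of the Hopf map is isometric on the
  Hermitian orthogonal complement of \<open>z\<close>.\<close>


lemma has_derivative_vec_nth:
  fixes f :: "'a::real_normed_vector \<Rightarrow> 'b::euclidean_space ^ 'n"
  assumes "\<And>i. ((\<lambda>x. f x $ i) has_derivative (\<lambda>h. f' h $ i)) (at x)"
  shows "(f has_derivative f') (at x)"
proof (subst has_derivative_componentwise_within, rule ballI)
  fix b :: "'b ^ 'n" assume "b \<in> Basis"
  then obtain i u where b: "b = axis i u" by (auto simp: Basis_vec_def)
  show "((\<lambda>x. f x \<bullet> b) has_derivative (\<lambda>x. f' x \<bullet> b)) (at x)"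
    unfolding b inner_axis by (rule has_derivative_inner_left[OF assms])
qed

lemma line_of_has_derivative:
  fixes z :: "complex ^ 3"
  assumes "z \<noteq> 0"
  shows "(line_of has_derivative
     (\<lambda>w. (\<chi> i j. (w $ i * cnj (z $ j) + z $ i * cnj (w $ j)) / of_real ((norm z)\<^sup>2)
             - z $ i * cnj (z $ j) * of_real (2 * (z \<bullet> w)) / of_real ((norm z)\<^sup>2) ^ 2))) (at z)"
proof -
  have n: "complex_of_real ((norm z)\<^sup>2) \<noteq> 0" using assms by simp
  have n': "z \<bullet> z \<noteq> 0" using assms by simp
  show ?thesis
    unfolding line_of_def
    apply (intro has_derivative_vec_nth)
    unfolding power2_norm_eq_inner vec_lambda_beta
    apply (rule has_derivative_eq_rhs)
     apply (rule has_derivative_divide)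
       apply (rule has_derivative_mult)
        apply (rule bounded_linear.has_derivative[OF bounded_linear_vec_nth], rule has_derivative_ident)
       apply (rule has_derivative_cnj)
       apply (rule bounded_linear.has_derivative[OF bounded_linear_vec_nth], rule has_derivative_ident)
      apply (rule has_derivative_of_real)
      apply (rule has_derivative_inner[OF has_derivative_ident has_derivative_ident])
    using n' apply simp
    using n' by (auto simp: fun_eq_iff field_simps inner_commute power2_eq_square)
qed

lemma hopf_submersion:
  fixes z w w' :: "complex ^ 3"
  assumes z: "norm z = 1"
    and w: "(\<Sum>i\<in>UNIV. w $ i * cnj (z $ i)) = 0" and w': "(\<Sum>i\<in>UNIV. w' $ i * cnj (z $ i)) = 0"
  shows "pullback line_of z w w' = w \<bullet> w'"
proof -
  have ci: "a \<bullet> b = Re (\<Sum>i\<in>UNIV. b $ i * cnj (a $ i))" for a b :: "complex^3"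
    by (simp add: inner_vec_def inner_complex_def algebra_simps)
  have o: "z \<bullet> w = 0" "z \<bullet> w' = 0" using w w' by (simp_all add: ci)
  have z0: "z \<noteq> 0" using z by auto
  have D: "D line_of z u = (\<chi> i j. u $ i * cnj (z $ j) + z $ i * cnj (u $ j))" if "z \<bullet> u = 0" for u
    unfolding frechet_derivative_at[OF line_of_has_derivative[OF z0], symmetric]
    using z that by simp
  have zz: "(\<Sum>i\<in>UNIV. z $ i * cnj (z $ i)) = 1"
  proof -
    have "(\<Sum>i\<in>UNIV. z $ i * cnj (z $ i)) = of_real (z \<bullet> z)"
      by (simp add: inner_vec_def complex_norm_square flip: power2_norm_eq_inner of_real_power)
    then show ?thesis using z by (simp add: dot_square_norm)
  qed
  have wz: "(\<Sum>i\<in>UNIV. z $ i * cnj (w $ i)) = 0" "(\<Sum>i\<in>UNIV. z $ i * cnj (w' $ i)) = 0"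
    using arg_cong[OF w, of cnj] arg_cong[OF w', of cnj] by (simp_all add: mult.commute)
  let ?s = "\<lambda>a b :: complex^3. \<Sum>i\<in>UNIV. b $ i * cnj (a $ i)"
  have "(\<chi> i j. w $ i * cnj (z $ j) + z $ i * cnj (w $ j)) \<bullet>
        (\<chi> i j. w' $ i * cnj (z $ j) + z $ i * cnj (w' $ j)) =
        Re (\<Sum>i\<in>UNIV. \<Sum>j\<in>UNIV. (w' $ i * cnj (z $ j) + z $ i * cnj (w' $ j)) *
                cnj (w $ i * cnj (z $ j) + z $ i * cnj (w $ j)))"
    by (simp add: inner_vec_def inner_complex_def algebra_simps)
  also have "(\<Sum>i\<in>UNIV. \<Sum>j\<in>UNIV. (w' $ i * cnj (z $ j) + z $ i * cnj (w' $ j)) *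
                cnj (w $ i * cnj (z $ j) + z $ i * cnj (w $ j))) =
      ?s w w' * ?s z z + ?s z w' * ?s z w + ?s w z * ?s w' z + ?s z z * ?s w' w"
    unfolding sum_product sum.distrib[symmetric] by (intro sum.cong refl) (simp add: algebra_simps)
  also have "\<dots> = ?s w w' + ?s w' w"
    using zz wz w w' by simp
  also have "Re \<dots> = 2 * (w \<bullet> w')"
    using ci[of w w'] ci[of w' w] by (simp only: plus_complex.sel inner_commute[of w' w])
  finally show ?thesis
    by (simp add: pullback_def fs_def D o)
qed

end

theory Submission
  imports Defs "HOL-Complex_Analysis.Conformal_Mappings"
begin

text \<open>Let \<open>f\<close> be a local holomorphic lift of the curve to \<open>\<complex>\<^sup>3\<close>, \<open>F = f \<times> f'\<close> and
  \<open>d = det (f, f', f'')\<close>. The induced metric is \<open>|F|\<^sup>2 / |f|\<^sup>4\<close> times the Euclidean one, whence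
  \<open>K = 4 - 2 \<kappa>\<close> with \<open>\<kappa> = |f|\<^sup>6 |d|\<^sup>2 / |F|\<^sup>6\<close>. The normal space consists of the images of the
  multiples of the conjugate of \<open>F\<close>, and \<open>\<langle>A\<^sub>v x, y\<rangle>\<close> is the inner product of \<open>v\<close> with the
  image of a multiple of \<open>f''\<close>, so that \<open>A\<^sub>v\<close> has eigenvalues \<open>\<plusminus> |v| \<surd>\<kappa>\<close>. Hence the
  determinant is \<open>cos\<^sup>2 r - \<kappa> sin\<^sup>2 r\<close>, depending on \<open>v\<close> through \<open>r = |v|\<close> only, and the
  substitution \<open>u = sin\<^sup>2 r\<close> evaluates the integral over a normal space to
  \<open>\<pi> (1 + \<kappa>\<^sup>2) / (2 (1 + \<kappa>))\<close>.\<close>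

section \<open>Hermitian geometry of lifts\<close>

text \<open>Many objects of the statement are given by \<open>THE\<close>, \<open>SOME\<close>,
  \<open>SUP\<close> or \<open>measure_of\<close>, so each must first be shown to be what it should
  be. This is done without computing a transition between two parametrizations of the curve: the
  shape operator is defined from the curve alone, so \<kappa>, read off its determinant, is the same
  for all parametrizations, and with it the Gauss curvature. The area measure is never evaluated:
  both sides integrate against it, and only its sigma-algebra enters. The normal bundle measure is
  the image of area times Lebesgue measure under a Borel trivialization, glued from finitely many
  local frames, and Tonelli then reduces the left side to fibre integrals. Both integrands are
  nonnegative and measurable, so both sides are \<open>enn2real\<close> of nonnegative integrals,
  whether finite or not. The constant arises as follows: a fibre contributes pi/4 times the
  integrand on the right, and the projective plane has volume pi^2/2, so the factor is 2 / (pi^2/2)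
  * pi/4 = 1/pi.\<close>

definition hprod :: "complex ^ 'n \<Rightarrow> complex ^ 'n \<Rightarrow> complex" where
  "hprod x y = (\<Sum>i\<in>UNIV. x $ i * cnj (y $ i))"

lemma hprod_add_left: "hprod (x + x') y = hprod x y + hprod x' y"
  and hprod_add_right: "hprod x (y + y') = hprod x y + hprod x y'"
  and hprod_diff_left: "hprod (x - x') y = hprod x y - hprod x' y"
  and hprod_diff_right: "hprod x (y - y') = hprod x y - hprod x y'"
  and hprod_minus_left: "hprod (- x) y = - hprod x y"
  and hprod_minus_right: "hprod x (- y) = - hprod x y"
  and hprod_smult_left: "hprod (c *s x) y = c * hprod x y"
  and hprod_smult_right: "hprod x (c *s y) = cnj c * hprod x y"
  and hprod_zero_left: "hprod 0 y = 0"
  and hprod_zero_right: "hprod x 0 = 0"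
  by (simp_all add: hprod_def sum.distrib sum_subtractf sum_negf sum_distrib_left algebra_simps)

lemmas hprod_simps = hprod_add_left hprod_add_right hprod_diff_left hprod_diff_right
  hprod_minus_left hprod_minus_right hprod_smult_left hprod_smult_right
  hprod_zero_left hprod_zero_right

lemma cnj_hprod: "cnj (hprod x y) = hprod y x"
  by (simp add: hprod_def mult.commute)

lemma Re_hprod: "Re (hprod x y) = x \<bullet> y"
  by (simp add: hprod_def inner_vec_def inner_complex_def)

lemma Re_hprod_commute: "Re (hprod x y) = Re (hprod y x)"
  by (simp add: Re_hprod inner_commute)

lemma hprod_self: "hprod x x = of_real ((norm x)\<^sup>2)"
  by (rule complex_eqI)
    (use cnj_hprod[of x x] in \<open>auto simp: Re_hprod dot_square_norm complex_eq_iff\<close>)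

lemma hprod_self_eq_0: "hprod x x = 0 \<longleftrightarrow> x = 0"
  by (simp add: hprod_self)

lemma hprod_has_derivative [derivative_intros]:
  assumes "(f has_derivative f') (at x within s)" "(g has_derivative g') (at x within s)"
  shows "((\<lambda>x. hprod (f x) (g x)) has_derivative (\<lambda>h. hprod (f x) (g' h) + hprod (f' h) (g x))) (at x within s)"
  unfolding hprod_def sum.distrib[symmetric]
  by (intro has_derivative_sum has_derivative_mult has_derivative_cnj
      bounded_linear.has_derivative[OF bounded_linear_vec_nth] assms)

section \<open>Cross product and determinant in complex 3-space\<close>

definition vcnj :: "complex ^ 'n \<Rightarrow> complex ^ 'n" where
  "vcnj x = (\<chi> i. cnj (x $ i))"

definition ccross :: "complex ^ 3 \<Rightarrow> complex ^ 3 \<Rightarrow> complex ^ 3" where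
  "ccross x y = vector [x $ 2 * y $ 3 - x $ 3 * y $ 2, x $ 3 * y $ 1 - x $ 1 * y $ 3,
                        x $ 1 * y $ 2 - x $ 2 * y $ 1]"

lemma ccross_nth [simp]:
  "ccross x y $ 1 = x $ 2 * y $ 3 - x $ 3 * y $ 2"
  "ccross x y $ 2 = x $ 3 * y $ 1 - x $ 1 * y $ 3"
  "ccross x y $ 3 = x $ 1 * y $ 2 - x $ 2 * y $ 1"
  by (simp_all add: ccross_def)

text \<open>The \<open>vcnj\<close> cancels the conjugation inside \<open>hprod\<close>, so this is
  the complex trilinear determinant; it is holomorphic along a holomorphic lift.\<close>

definition cdet :: "complex ^ 3 \<Rightarrow> complex ^ 3 \<Rightarrow> complex ^ 3 \<Rightarrow> complex" where
  "cdet x y z = hprod (ccross x y) (vcnj z)"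

lemma vec3_eqI: "x $ 1 = y $ 1 \<Longrightarrow> x $ 2 = y $ 2 \<Longrightarrow> x $ 3 = y $ 3 \<Longrightarrow> x = y" for x y :: "'a ^ 3"
  by (simp add: vec_eq_iff forall_3)

text \<open>Lagrange's identity over the complex numbers.\<close>

lemma hprod_ccross_self:
  "hprod (ccross x y) (ccross x y) = hprod x x * hprod y y - hprod x y * hprod y x"
  by (simp add: hprod_def sum_3 algebra_simps)

text \<open>The vector triple product. For \<open>F = ccross f f'\<close>, whose derivative is
  \<open>ccross f f''\<close>, it gives \<open>ccross F F' = d *s f\<close>, which is how d enters
  the curvature.\<close>

lemma ccross_ccross: "ccross (ccross x y) (ccross x z) = cdet x y z *s x"
  by (rule vec3_eqI) (simp_all add: hprod_def cdet_def vcnj_def sum_3 algebra_simps)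

text \<open>The cross product is orthogonal to its factors for the bilinear product; conjugating it
  makes it orthogonal for the Hermitian one.\<close>

lemma hprod_vcnj_ccross:
  "hprod (vcnj (ccross x y)) x = 0" "hprod (vcnj (ccross x y)) y = 0"
  "hprod (vcnj (ccross x y)) z = cnj (cdet x y z)"
  "hprod (vcnj (ccross x y)) (vcnj (ccross x y)) = hprod (ccross x y) (ccross x y)"
  by (simp_all add: hprod_def cdet_def vcnj_def sum_3 algebra_simps)

lemma orthogonal_to_two:
  assumes "hprod w x = 0" "hprod w y = 0"
  shows "hprod (ccross x y) (ccross x y) *s w = hprod w (vcnj (ccross x y)) *s vcnj (ccross x y)"
proof -
  \<comment> \<open>Cramer's rule for the Gram matrix of x and y: both sides are the Gram
    determinant times the projection of w to the span of x and y.\<close>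
  have "hprod (ccross x y) (ccross x y) *s w - hprod w (vcnj (ccross x y)) *s vcnj (ccross x y)
     = hprod w x *s (hprod y y *s x - hprod x y *s y) +
       hprod w y *s (hprod x x *s y - hprod y x *s x)"
    by (rule vec3_eqI) (simp_all add: hprod_def vcnj_def sum_3 algebra_simps)
  then show ?thesis using assms by simp
qed

text \<open>The Hermitian Fubini-Study form on lifts of tangent vectors at the line of \<open>z\<close>.\<close>

definition fsh :: "complex ^ 3 \<Rightarrow> complex ^ 3 \<Rightarrow> complex ^ 3 \<Rightarrow> complex" where
  "fsh z w w' = hprod w w' / hprod z z - hprod w z * hprod z w' / (hprod z z)\<^sup>2"

lemma fsh_simps:
  "fsh z (x + x') y = fsh z x y + fsh z x' y"
  "fsh z x (y + y') = fsh z x y + fsh z x y'"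
  "fsh z (x - x') y = fsh z x y - fsh z x' y"
  "fsh z x (y - y') = fsh z x y - fsh z x y'"
  "fsh z (- x) y = - fsh z x y"
  "fsh z x (- y) = - fsh z x y"
  "fsh z (c *s x) y = c * fsh z x y"
  "fsh z x (c *s y) = cnj c * fsh z x y"
  by (simp_all add: fsh_def hprod_simps algebra_simps add_divide_distrib diff_divide_distrib)

lemma cnj_fsh: "cnj (fsh z w w') = fsh z w' w"
  by (simp add: fsh_def cnj_hprod mult.commute)

lemma fsh_self: "fsh z w w = hprod (ccross z w) (ccross z w) / (hprod z z)\<^sup>2"
  by (cases "z = 0")
    (simp_all add: fsh_def hprod_ccross_self hprod_self_eq_0 field_simps power2_eq_square hprod_zero_left)

lemma fsh_self_real: "fsh z w w = of_real ((norm (ccross z w))\<^sup>2 / (norm z) ^ 4)"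
  by (simp add: fsh_self hprod_self flip: power_mult)

section \<open>The differential of the projection to the projective plane\<close>

definition herm :: "complex ^ 3 \<Rightarrow> complex ^ 3 \<Rightarrow> cmat" where
  "herm w z = (\<chi> i j. w $ i * cnj (z $ j) + z $ i * cnj (w $ j))"

text \<open>The expanded product has four terms. The two mixed ones contain \<open>hprod w z\<close>
  or its conjugate and vanish; the other two have equal real parts.\<close>

lemma herm_inner:
  assumes "hprod w z = 0" "hprod w' z = 0"
  shows "herm w z \<bullet> herm w' z = 2 * Re (hprod w w' * hprod z z)"
proof -
  have wz: "hprod z w = 0" "hprod z w' = 0"
    using assms cnj_hprod[of w z] cnj_hprod[of w' z] by auto
  have "herm w z \<bullet> herm w' z =
        Re (\<Sum>i\<in>UNIV. \<Sum>j\<in>UNIV. (w $ i * cnj (z $ j) + z $ i * cnj (w $ j)) *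
                cnj (w' $ i * cnj (z $ j) + z $ i * cnj (w' $ j)))"
    by (simp add: herm_def inner_vec_def inner_complex_def algebra_simps)
  also have "(\<Sum>i\<in>UNIV. \<Sum>j\<in>UNIV. (w $ i * cnj (z $ j) + z $ i * cnj (w $ j)) *
                cnj (w' $ i * cnj (z $ j) + z $ i * cnj (w' $ j))) =
      hprod w w' * hprod z z + hprod w z * hprod w' z + hprod z w' * hprod z w + hprod z z * hprod w' w"
    unfolding hprod_def sum_product sum.distrib[symmetric] by (intro sum.cong refl) (simp add: algebra_simps)
  also have "Re \<dots> = 2 * Re (hprod w w' * hprod z z)"
    using assms wz Re_hprod_commute[of w w'] by (simp add: hprod_self)
  finally show ?thesis .
qed

text \<open>Differentiating the normalizing factor removes precisely the component of w along z, so
  the quotient rule regroups into \<open>herm\<close> of the horizontal part of w.\<close>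

lemma D_line_of:
  assumes "z \<noteq> 0"
  shows "D line_of z w = herm ((1 / hprod z z) *s (w - (hprod w z / hprod z z) *s z)) z"
proof -
  have h: "hprod z z \<noteq> 0" using assms by (simp add: hprod_self_eq_0)
  have r: "complex_of_real (2 * (z \<bullet> w)) = hprod w z + hprod z w"
    using cnj_hprod[of w z] Re_hprod[of w z] by (simp add: complex_eq_iff inner_commute)
  have c: "cnj (hprod z z) = hprod z z" by (rule cnj_hprod)
  show ?thesis
    unfolding frechet_derivative_at[OF line_of_has_derivative[OF assms], symmetric] herm_def
    unfolding r hprod_self[symmetric]
    using h by (simp add: vec_eq_iff field_simps cnj_hprod c power2_eq_square)
qed

lemma line_of_differentiable: "z \<noteq> 0 \<Longrightarrow> (line_of has_derivative D line_of z) (at z)"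
  using frechet_derivative_works line_of_has_derivative differentiableI by blast

lemma linear_D_line_of: "z \<noteq> 0 \<Longrightarrow> linear (D line_of z)"
  using has_derivative_linear line_of_differentiable by blast

lemma D_line_of_add: "z \<noteq> 0 \<Longrightarrow> D line_of z (w + w') = D line_of z w + D line_of z w'"
  by (simp add: linear_D_line_of linear_add)

lemma D_line_of_diff: "z \<noteq> 0 \<Longrightarrow> D line_of z (w - w') = D line_of z w - D line_of z w'"
  by (simp add: linear_D_line_of linear_diff)

lemma D_line_of_scaleR: "z \<noteq> 0 \<Longrightarrow> D line_of z (r *\<^sub>R w) = r *\<^sub>R D line_of z w"
  by (simp add: linear_D_line_of linear_scale)

lemma line_of_smult: "c \<noteq> 0 \<Longrightarrow> line_of (c *s z) = line_of z"
proof -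
  assume c: "c \<noteq> 0"
  have "complex_of_real ((norm (c *s z))\<^sup>2) = c * cnj c * complex_of_real ((norm z)\<^sup>2)"
    unfolding hprod_self[symmetric] by (simp add: hprod_simps)
  then show ?thesis using c
    by (simp add: line_of_def vec_eq_iff)
qed

text \<open>This allows a lift to be rescaled pointwise, in particular to one with a coordinate
  equal to 1.\<close>

lemma D_line_of_smult:
  assumes "c \<noteq> 0" "z \<noteq> 0"
  shows "D line_of (c *s z) (c *s w) = D line_of z w"
proof -
  have "c *s z \<noteq> 0" using assms by (simp add: vec_eq_iff)
  then show ?thesis using assms
    by (simp add: D_line_of hprod_simps herm_def vec_eq_iff field_simps hprod_self_eq_0 cnj_hprod)
qed

lemma D_line_of_point: 
  assumes "z \<noteq> 0" shows "D line_of z (c *s z) = 0"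
  using assms by (simp add: D_line_of hprod_simps herm_def vec_eq_iff hprod_self_eq_0)

lemma fs_D_line_of:
  assumes "z \<noteq> 0"
  shows "fs (D line_of z w) (D line_of z w') = Re (fsh z w w')"
proof -
  have h: "hprod z z \<noteq> 0" using assms by (simp add: hprod_self_eq_0)
  let ?p = "\<lambda>w. (1 / hprod z z) *s (w - (hprod w z / hprod z z) *s z)"
  have "hprod (?p w) z = 0" for w using h by (simp add: hprod_simps)
  then have "fs (D line_of z w) (D line_of z w') = Re (hprod (?p w) (?p w') * hprod z z)"
    by (simp add: fs_def D_line_of[OF assms] herm_inner)
  also have "hprod (?p w) (?p w') * hprod z z = fsh z w w'"
    using h by (simp add: hprod_simps fsh_def cnj_hprod field_simps power2_eq_square)
  finally show ?thesis .
qed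

text \<open>By Lagrange's identity the squared length of the image is a positive multiple of the
  squared norm of the cross product.\<close>

lemma D_line_of_eq_0_iff:
  assumes "z \<noteq> 0"
  shows "D line_of z w = 0 \<longleftrightarrow> ccross z w = 0"
proof -
  have "D line_of z w = 0 \<longleftrightarrow> fs (D line_of z w) (D line_of z w) = 0"
    by (simp add: fs_def)
  also have "\<dots> \<longleftrightarrow> ccross z w = 0"
    using assms by (simp add: fs_D_line_of fsh_self_real)
  finally show ?thesis .
qed

section \<open>Conformal metrics and the curvature of a holomorphic curve\<close>

text \<open>Compatibility and symmetry collapse the Koszul expression to
  \<open>2 * g x (\<Gamma> u v) y\<close>, and nondegeneracy makes the solution unique. A guessed
  connection thus only has to be checked, and no metric has to be inverted.\<close>

lemma christoffel_eqI:
  assumes diff: "\<And>w w' y. g x (w - w') y = g x w y - g x w' y"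
    and nondeg: "\<And>w. (\<And>y. g x w y = 0) \<Longrightarrow> w = 0"
    and sym: "\<And>v w. g x v w = g x w v"
    and compat: "\<And>u v y. D (\<lambda>q. g q v y) x u = g x (\<Gamma> u v) y + g x v (\<Gamma> u y)"
    and \<Gamma>_sym: "\<And>u v. \<Gamma> u v = \<Gamma> v u"
  shows "christoffel g x u v = \<Gamma> u v"
proof -
  have K: "D (\<lambda>q. g q v y) x u + D (\<lambda>q. g q u y) x v - D (\<lambda>q. g q u v) x y = 2 * g x (\<Gamma> u v) y" for y
    unfolding compat using \<Gamma>_sym[of u v] \<Gamma>_sym[of y] sym[of _ "\<Gamma> _ _"] by simp
  have "w = \<Gamma> u v" if "\<forall>y. 2 * g x w y = 2 * g x (\<Gamma> u v) y" for w
  proof -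
    have "w - \<Gamma> u v = 0"
      by (rule nondeg) (use that in \<open>simp add: diff\<close>)
    then show ?thesis by simp
  qed
  then show ?thesis
    unfolding christoffel_def K by (intro the_equality) auto
qed

lemma frechet_derivative_eqI: "(f has_derivative f') (at x) \<Longrightarrow> D f x = f'"
  using frechet_derivative_at by metis

lemma frechet_derivative_cong_open:
  assumes "open U" "x \<in> U" "\<And>y. y \<in> U \<Longrightarrow> f y = f' y" "(f' has_derivative d) (at x)"
  shows "D f x = d"
  using has_derivative_transform_within_open[OF assms(4,1,2)] assms(3) frechet_derivative_eqI by metis

text \<open>Here m is the holomorphic derivative of log \<rho>; in complex notation the whole
  connection is multiplication by it.\<close>

lemma christoffel_conformal:
  fixes g :: "complex \<Rightarrow> complex \<Rightarrow> complex \<Rightarrow> real" and m :: complex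
  assumes U: "open U" "x \<in> U" and g: "\<And>z u v. z \<in> U \<Longrightarrow> g z u v = \<rho> z * Re (u * cnj v)"
    and pos: "\<rho> x > 0" and \<rho>: "(\<rho> has_derivative (\<lambda>u. 2 * \<rho> x * Re (u * m))) (at x)"
  shows "christoffel g x u v = m * u * v"
proof (rule christoffel_eqI[where \<Gamma> = "\<lambda>u v. m * u * v"])
  fix u v y
  have "D (\<lambda>q. g q v y) x = (\<lambda>u. 2 * \<rho> x * Re (u * m) * Re (v * cnj y))"
    by (rule frechet_derivative_cong_open[OF U]) (use g \<rho> in \<open>auto intro!: derivative_eq_intros\<close>)
  then show "D (\<lambda>q. g q v y) x u = g x (m * u * v) y + g x v (m * u * y)"
    by (simp add: g[OF U(2)] algebra_simps)
next
  fix w assume "\<And>y. g x w y = 0"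
  from this[of w] show "w = 0"
    using pos by (simp add: g[OF U(2)] complex_eq_iff flip: power2_eq_square)
qed (simp_all add: g[OF U(2)] algebra_simps)

text \<open>Liouville's formula: Y is the mixed second derivative of log \<rho>, a quarter of its
  Laplacian.\<close>

lemma sectional_curvature_conformal:
  fixes g :: "complex \<Rightarrow> complex \<Rightarrow> complex \<Rightarrow> real" and m :: "complex \<Rightarrow> complex"
  assumes U: "open U" "x \<in> U" and g: "\<And>z u v. z \<in> U \<Longrightarrow> g z u v = \<rho> z * Re (u * cnj v)"
    and pos: "\<And>z. z \<in> U \<Longrightarrow> \<rho> z > 0"
    and \<rho>: "\<And>z. z \<in> U \<Longrightarrow> (\<rho> has_derivative (\<lambda>u. 2 * \<rho> z * Re (u * m z))) (at z)"
    and m: "(m has_derivative (\<lambda>u. u * X + cnj u * Y)) (at x)"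
  shows "sectional_curvature g x 1 \<i> = - 2 * Re Y / \<rho> x"
proof -
  have ch: "christoffel g z u v = m z * u * v" if "z \<in> U" for z u v
    using christoffel_conformal[OF U(1) that g pos \<rho>] that by blast
  have cc: "cov_deriv g (\<lambda>_. w) z v = m z * v * w" if "z \<in> U" for z v w
    using ch[OF that] frechet_derivative_const[of w] by (simp add: cov_deriv_def)
  have D: "D (\<lambda>q. cov_deriv g (\<lambda>_. w) q v) x u = (u * X + cnj u * Y) * v * w" for u v w
  proof -
    have "D (\<lambda>q. cov_deriv g (\<lambda>_. w) q v) x = (\<lambda>u. (u * X + cnj u * Y) * v * w)"
      by (rule frechet_derivative_cong_open[OF U, where f' = "\<lambda>q. m q * v * w"])
        (use cc m in \<open>auto intro!: derivative_eq_intros\<close>)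
    then show ?thesis by simp
  qed
  \<comment> \<open>The terms with X and the products of two Christoffel terms are symmetric in the
    two directions and cancel; only the antilinear part Y survives.\<close>
  have "riemann_tensor g x 1 \<i> \<i> = - 2 * Y"
    unfolding riemann_tensor_def cov_deriv_def[of g "\<lambda>q. cov_deriv g (\<lambda>_. \<i>) q _"] D ch[OF U(2)] cc[OF U(2)]
    by (simp add: algebra_simps)
  then show ?thesis
    using pos[OF U(2)] by (simp add: sectional_curvature_def g[OF U(2)] power2_eq_square)
qed

section \<open>Holomorphic lifts, their conformal factor and curvature\<close>

definition vderiv :: "(complex \<Rightarrow> complex ^ 'n) \<Rightarrow> complex \<Rightarrow> complex ^ 'n" where
  "vderiv f z = (\<chi> i. deriv (\<lambda>w. f w $ i) z)"

lemma vderiv_holomorphic: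
  assumes "\<And>i. (\<lambda>z. f z $ i) holomorphic_on U" "open U"
  shows "(\<lambda>z. vderiv f z $ i) holomorphic_on U"
  unfolding vderiv_def using assms by (auto intro: holomorphic_deriv)

lemma vderiv_nth:
  assumes "\<And>i. (\<lambda>z. f z $ i) holomorphic_on U" "open U" "z \<in> U"
  shows "((\<lambda>w. f w $ i) has_field_derivative vderiv f z $ i) (at z)"
  unfolding vderiv_def using holomorphic_derivI[OF assms(1-3)] by simp

lemma vderiv_has_derivative:
  assumes "\<And>i. (\<lambda>z. f z $ i) holomorphic_on U" "open U" "z \<in> U"
  shows "(f has_derivative (\<lambda>u. u *s vderiv f z)) (at z)"
  by (rule has_derivative_vec_nth, rule has_derivative_eq_rhs,
      rule vderiv_nth[OF assms, unfolded has_field_derivative_def])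
    (simp add: fun_eq_iff mult.commute)

lemma vderiv_eqI:
  assumes "\<And>i. ((\<lambda>w. f w $ i) has_field_derivative f' $ i) (at z)"
  shows "vderiv f z = f'"
  using assms by (simp add: vderiv_def vec_eq_iff DERIV_imp_deriv)

lemma norm_sq_has_derivative:
  fixes F :: "complex \<Rightarrow> complex ^ 'n"
  assumes "(F has_derivative (\<lambda>u. u *s F')) (at z)"
  shows "((\<lambda>z. (norm (F z))\<^sup>2) has_derivative (\<lambda>u. 2 * Re (u * hprod F' (F z)))) (at z)"
proof -
  have "((\<lambda>z. Re (hprod (F z) (F z))) has_derivative
      (\<lambda>u. Re (hprod (F z) (u *s F') + hprod (u *s F') (F z)))) (at z)"
    by (intro has_derivative_Re hprod_has_derivative assms)
  moreover have "Re (hprod (F z) (u *s F')) = Re (u * hprod F' (F z))" for u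
    by (subst Re_hprod_commute) (simp add: hprod_smult_left)
  ultimately show ?thesis
    by (simp add: hprod_self hprod_smult_left)
qed

text \<open>The quotient is the holomorphic derivative of the logarithm of the squared norm of F,
  and Lagrange's identity identifies its antilinear part. The coefficient X of the linear part can
  stay unnamed, since it does not enter the curvature. The lemma serves both for the lift f and for
  \<open>ccross f f'\<close>.\<close>

lemma log_norm_second_derivative:
  fixes F :: "complex \<Rightarrow> complex ^ 3"
  assumes F: "(F has_derivative (\<lambda>u. u *s F' z)) (at z)"
    and F': "(F' has_derivative (\<lambda>u. u *s F'')) (at z)" and nz: "F z \<noteq> 0"
  shows "\<exists>X. ((\<lambda>z. hprod (F' z) (F z) / hprod (F z) (F z)) has_derivative
     (\<lambda>u. u * X + cnj u * of_real ((norm (ccross (F z) (F' z)))\<^sup>2 / norm (F z) ^ 4))) (at z)"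
proof -
  let ?h = "hprod (F z) (F z)"
  have h: "?h \<noteq> 0" using nz by (simp add: hprod_self_eq_0)
  let ?X = "hprod F'' (F z) / ?h - hprod (F' z) (F z) * hprod (F' z) (F z) / ?h\<^sup>2"
  have Y: "complex_of_real ((norm (ccross (F z) (F' z)))\<^sup>2 / norm (F z) ^ 4)
     = hprod (F' z) (F' z) / ?h - hprod (F' z) (F z) * hprod (F z) (F' z) / ?h\<^sup>2"
    using fsh_self_real[of "F z" "F' z"] by (simp add: fsh_def)
  \<comment> \<open>The quotient rule with v standing for \<open>cnj u\<close> and h for the squared
    norm.\<close>
  have alg: "((v * p + u * b) * h - c * (v * e + u * c)) / (h * h)
      = u * (b / h - c * c / h\<^sup>2) + v * (p / h - c * e / h\<^sup>2)" if "h \<noteq> 0" for u v p b c e h :: complex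
    using that by (simp add: divide_simps power2_eq_square) (simp add: algebra_simps)
  show ?thesis
    unfolding Y
    by (rule exI[of _ ?X], rule has_derivative_eq_rhs,
       rule has_derivative_divide'[OF hprod_has_derivative[OF F' F] hprod_has_derivative[OF F F] h])
     (simp only: hprod_smult_left hprod_smult_right alg[OF h])
qed

text \<open>A logarithmic derivative, made for the conformal factor: A and B become the squared
  norms of F and f.\<close>

lemma quotient_square_has_derivative:
  fixes A B :: "'a::real_normed_vector \<Rightarrow> real"
  assumes A: "(A has_derivative (\<lambda>u. 2 * P u)) (at z)" and B: "(B has_derivative (\<lambda>u. 2 * Q u)) (at z)"
    and nz: "A z \<noteq> 0" "B z \<noteq> 0"
  shows "((\<lambda>z. A z / (B z)\<^sup>2) has_derivative
    (\<lambda>u. 2 * (A z / (B z)\<^sup>2) * (P u / A z - 2 * (Q u / B z)))) (at z)"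
proof -
  have "(B z)\<^sup>2 \<noteq> 0" using nz by simp
  note d = has_derivative_divide'[OF A has_derivative_power[OF B, of 2] this]
  have alg: "(2 * p * b\<^sup>2 - a * (of_nat 2 * (2 * q) * b ^ (2 - 1))) / (b\<^sup>2 * b\<^sup>2) = 2 * (a / b\<^sup>2) * (p / a - 2 * (q / b))"
    if "a \<noteq> 0" "b \<noteq> 0" for a b p q :: real
    using that by (simp add: divide_simps power2_eq_square) (simp add: algebra_simps)
  show ?thesis
    by (rule has_derivative_eq_rhs[OF d]) (simp only: alg[OF nz])
qed

text \<open>The conditions relating the piece to the whole curve are kept out of this locale, so
  that a rescaled lift of the same \<gamma> on a smaller domain is again an instance.\<close>

locale lifted_curve =
  fixes U :: "complex set" and f :: "complex \<Rightarrow> complex ^ 3" and \<gamma> :: "complex \<Rightarrow> cmat"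
  assumes open_U: "open U"
    and holo: "\<And>i. (\<lambda>z. f z $ i) holomorphic_on U"
    and nonzero: "\<And>z. z \<in> U \<Longrightarrow> f z \<noteq> 0"
    and lift: "\<And>z. z \<in> U \<Longrightarrow> \<gamma> z = line_of (f z)"
    and inj_D: "\<And>z. z \<in> U \<Longrightarrow> inj (D \<gamma> z)"
begin

abbreviation "f' \<equiv> vderiv f"
abbreviation "f'' \<equiv> vderiv (vderiv f)"
abbreviation "F z \<equiv> ccross (f z) (f' z)"
abbreviation "d z \<equiv> cdet (f z) (f' z) (f'' z)"
abbreviation "\<rho> z \<equiv> (norm (F z))\<^sup>2 / norm (f z) ^ 4"

lemma f_deriv: "z \<in> U \<Longrightarrow> (f has_derivative (\<lambda>u. u *s f' z)) (at z)"
  by (rule vderiv_has_derivative[OF holo open_U])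

lemma f'_deriv: "z \<in> U \<Longrightarrow> (f' has_derivative (\<lambda>u. u *s f'' z)) (at z)"
  by (rule vderiv_has_derivative[OF vderiv_holomorphic[OF holo open_U] open_U])

lemma \<gamma>_has_derivative:
  assumes "z \<in> U"
  shows "(\<gamma> has_derivative (\<lambda>u. D line_of (f z) (u *s f' z))) (at z)"
proof -
  have "(line_of \<circ> f has_derivative (\<lambda>u. D line_of (f z) (u *s f' z))) (at z)"
    using diff_chain_at[OF f_deriv[OF assms] line_of_differentiable[OF nonzero[OF assms]]]
    unfolding o_def .
  then show ?thesis
    by (rule has_derivative_transform_within_open[OF _ open_U assms]) (simp add: lift)
qed

lemma D_\<gamma>: "z \<in> U \<Longrightarrow> D \<gamma> z u = D line_of (f z) (u *s f' z)"
  by (subst frechet_derivative_eqI[OF \<gamma>_has_derivative]) auto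

text \<open>If f' were parallel to f, the differential of \<gamma> would vanish, against its
  injectivity.\<close>

lemma F_nonzero:
  assumes "z \<in> U"
  shows "F z \<noteq> 0"
proof
  assume "F z = 0"
  then have "D line_of (f z) (1 *s f' z) = 0"
    using D_line_of_eq_0_iff[OF nonzero[OF assms], of "f' z"] by simp
  moreover have "D line_of (f z) (0 *s f' z) = 0"
    using linear_0[OF linear_D_line_of[OF nonzero[OF assms]]] by simp
  ultimately have "D \<gamma> z 1 = 0" "D \<gamma> z 0 = 0"
    unfolding D_\<gamma>[OF assms] by auto
  then show False using injD[OF inj_D[OF assms], of 1 0] by simp
qed

lemma \<rho>_pos: "z \<in> U \<Longrightarrow> \<rho> z > 0"
  using F_nonzero nonzero by simp

text \<open>The differential is \<open>u *s f'\<close> followed by the projection, so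
  sesquilinearity of \<open>fsh\<close> makes the metric conformal.\<close>

lemma pullback_\<gamma>: "z \<in> U \<Longrightarrow> pullback \<gamma> z u v = \<rho> z * Re (u * cnj v)"
  by (simp add: pullback_def D_\<gamma> fs_D_line_of nonzero fsh_simps fsh_self_real algebra_simps)

text \<open>The other product rule term is the cross product of f' with itself.\<close>

lemma F_deriv_nth:
  assumes "z \<in> U"
  shows "((\<lambda>w. F w $ i) has_field_derivative ccross (f z) (f'' z) $ i) (at z)"
proof -
  note d = vderiv_nth[OF holo open_U assms] vderiv_nth[OF vderiv_holomorphic[OF holo open_U] open_U assms]
  have "\<forall>i. ((\<lambda>w. F w $ i) has_field_derivative ccross (f z) (f'' z) $ i) (at z)"
    unfolding forall_3 ccross_nth by (auto intro!: derivative_eq_intros d)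
  then show ?thesis by blast
qed

lemma F_holo: "(\<lambda>z. F z $ i) holomorphic_on U"
  using F_deriv_nth open_U by (auto simp: holomorphic_on_open)

lemma vderiv_F: "z \<in> U \<Longrightarrow> vderiv F z = ccross (f z) (f'' z)"
  by (intro vderiv_eqI F_deriv_nth)

text \<open>log \<rho> is the logarithm of the squared norm of F minus twice that of f. The f part
  contributes the constant 4, since its mixed derivative is \<rho> itself; the F part contributes
  the term with d.\<close>

lemma curvature:
  assumes z: "z \<in> U"
  shows "sectional_curvature (pullback \<gamma>) z 1 \<i> =
     4 - 2 * (norm (f z) ^ 6 * (cmod (d z))\<^sup>2 / norm (F z) ^ 6)"
proof -
  let ?mf = "\<lambda>z. hprod (f' z) (f z) / hprod (f z) (f z)"
  let ?mF = "\<lambda>z. hprod (vderiv F z) (F z) / hprod (F z) (F z)"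
  note F_deriv = vderiv_has_derivative[OF F_holo open_U]
  obtain X where X: "(?mf has_derivative (\<lambda>u. u * X + cnj u * of_real (\<rho> z))) (at z)"
    using log_norm_second_derivative[OF f_deriv[OF z] f'_deriv[OF z] nonzero[OF z]] by blast
  obtain X' where X': "(?mF has_derivative (\<lambda>u. u * X' +
      cnj u * of_real ((norm (ccross (F z) (vderiv F z)))\<^sup>2 / norm (F z) ^ 4))) (at z)"
    using log_norm_second_derivative[OF F_deriv[OF z]
       vderiv_has_derivative[OF vderiv_holomorphic[OF F_holo open_U] open_U z] F_nonzero[OF z]] by blast
  let ?Y = "(norm (ccross (F z) (vderiv F z)))\<^sup>2 / norm (F z) ^ 4 - 2 * \<rho> z"
  have m: "((\<lambda>z. ?mF z - 2 * ?mf z) has_derivative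
     (\<lambda>u. u * (X' - 2 * X) + cnj u * of_real ?Y)) (at z)"
    by (rule has_derivative_eq_rhs, rule has_derivative_diff[OF X' has_derivative_mult_right[OF X]])
      (simp add: fun_eq_iff algebra_simps)
  have \<rho>: "(\<rho> has_derivative (\<lambda>u. 2 * \<rho> w * Re (u * (?mF w - 2 * ?mf w)))) (at w)" if w: "w \<in> U" for w
  proof -
    have n: "norm (F w) \<noteq> 0" "norm (f w) \<noteq> 0" using F_nonzero[OF w] nonzero[OF w] by auto
    have n4: "norm (f w) ^ 4 = ((norm (f w))\<^sup>2)\<^sup>2" for w by (simp flip: power_mult)
    have Re: "Re (u * (hprod a b / hprod c c)) = Re (u * hprod a b) / (norm c)\<^sup>2" for u and a b c :: "complex ^ 3"
      unfolding hprod_self times_divide_eq_right by (rule Re_divide_of_real)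
    have e: "Re (u * (?mF w - 2 * ?mf w)) =
        Re (u * hprod (vderiv F w) (F w)) / (norm (F w))\<^sup>2 - 2 * (Re (u * hprod (f' w) (f w)) / (norm (f w))\<^sup>2)" for u
    proof -
      have "Re (u * (a - 2 * b)) = Re (u * a) - 2 * Re (u * b)" for a b :: complex
        by (simp add: algebra_simps)
      then show ?thesis unfolding Re[symmetric] .
    qed
    show ?thesis
      unfolding n4 e
      by (rule quotient_square_has_derivative[OF norm_sq_has_derivative[OF F_deriv[OF w]]
            norm_sq_has_derivative[OF f_deriv[OF w]]]) (use n in auto)
  qed
  have n: "norm (F z) \<noteq> 0" "norm (f z) \<noteq> 0" using F_nonzero[OF z] nonzero[OF z] by auto
  have FF: "(norm (ccross (F z) (vderiv F z)))\<^sup>2 = (cmod (d z))\<^sup>2 * (norm (f z))\<^sup>2"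
  proof -
    have "complex_of_real ((norm (d z *s f z))\<^sup>2) = complex_of_real ((cmod (d z))\<^sup>2 * (norm (f z))\<^sup>2)"
      unfolding of_real_mult hprod_self[symmetric] hprod_simps complex_norm_square
      by (simp only: mult.assoc mult.left_commute)
    then show ?thesis unfolding vderiv_F[OF z] ccross_ccross of_real_eq_iff by simp
  qed
  have "sectional_curvature (pullback \<gamma>) z 1 \<i> = - 2 * Re (of_real ?Y) / \<rho> z"
    by (rule sectional_curvature_conformal[OF open_U z pullback_\<gamma> \<rho>_pos \<rho> m])
  also have "\<dots> = 4 - 2 * (norm (f z) ^ 6 * (cmod (d z))\<^sup>2 / norm (F z) ^ 6)"
  proof -
    have "- 2 * (c\<^sup>2 * y\<^sup>2 / x ^ 4 - 2 * (x\<^sup>2 / y ^ 4)) / (x\<^sup>2 / y ^ 4) = 4 - 2 * (y ^ 6 * c\<^sup>2 / x ^ 6)"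
      if "x \<noteq> 0" "y \<noteq> 0" for x y c :: real
      using that by (simp add: divide_simps)
    from this[OF n, of "cmod (d z)"] show ?thesis unfolding FF by simp
  qed
  finally show ?thesis .
qed

end

section \<open>Tangent and normal spaces\<close>

text \<open>Each column of the projection matrix is a multiple of z, so where the diagonal entry is
  nonzero this linear map is a local section of the projection to the projective plane.\<close>

definition column_of :: "3 \<Rightarrow> cmat \<Rightarrow> complex ^ 3" where
  "column_of k P = (\<chi> i. P $ i $ k)"

lemma bounded_linear_column_of: "bounded_linear (column_of k)"
  unfolding linear_conv_bounded_linear[symmetric]
  by (rule linearI) (simp_all add: column_of_def vec_eq_iff)

lemma line_of_nth: "line_of z $ i $ j = z $ i * cnj (z $ j) / hprod z z"
  by (simp add: line_of_def hprod_self)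

lemma column_of_line_of: "column_of k (line_of z) = (cnj (z $ k) / hprod z z) *s z"
  by (simp add: column_of_def vec_eq_iff line_of_nth)

lemma line_of_nth_eq_0_iff: "z \<noteq> 0 \<Longrightarrow> line_of z $ k $ k = 0 \<longleftrightarrow> z $ k = 0"
  by (simp add: line_of_nth hprod_self_eq_0)

lemma CP2_eq_line_of_column:
  assumes "P \<in> CP2" "P $ k $ k \<noteq> 0"
  shows "line_of (column_of k P) = P"
proof -
  obtain z where z: "z \<noteq> 0" "P = line_of z" using assms by (auto simp: CP2_def)
  then have "z $ k \<noteq> 0" using assms line_of_nth_eq_0_iff by blast
  then show ?thesis using z by (simp add: column_of_line_of line_of_smult hprod_self_eq_0)
qed

text \<open>Near its starting point a curve in the projective plane is the projection of one of its
  own columns, which is differentiable; the chain rule gives one inclusion. For the other, a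
  straight line in complex 3-space is projected.\<close>

lemma tangent_space_CP2:
  assumes f: "f \<noteq> 0"
  shows "tangent_space CP2 (line_of f) = range (D line_of f)"
proof (intro set_eqI iffI)
  fix v assume "v \<in> tangent_space CP2 (line_of f)"
  then obtain c where c: "c 0 = line_of f" "\<And>t. c t \<in> CP2" "(c has_derivative (\<lambda>t. t *\<^sub>R v)) (at 0)"
    by (auto simp: tangent_space_def has_vector_derivative_def)
  obtain k where k: "f $ k \<noteq> 0" using f by (auto simp: vec_eq_iff)
  define q where "q = cnj (f $ k) / hprod f f"
  have q: "q \<noteq> 0" using k f by (simp add: q_def hprod_self_eq_0)
  have col0: "column_of k (c 0) = q *s f" by (simp add: c column_of_line_of q_def)
  have "column_of k (c 0) \<noteq> 0" using q f by (simp add: col0 vec_eq_iff)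
  have colder: "((\<lambda>t. column_of k (c t)) has_derivative (\<lambda>t. column_of k (t *\<^sub>R v))) (at 0)"
    by (rule bounded_linear.has_derivative[OF bounded_linear_column_of c(3)])
  have "((\<lambda>t. line_of (column_of k (c t))) has_derivative (\<lambda>t. D line_of (q *s f) (column_of k (t *\<^sub>R v)))) (at 0)"
    using diff_chain_at[OF colder line_of_differentiable[OF \<open>column_of k (c 0) \<noteq> 0\<close>]]
    unfolding o_def col0 .
  moreover have "\<forall>\<^sub>F t in at 0. line_of (column_of k (c t)) = c t"
  proof -
    have "isCont (\<lambda>t. c t $ k $ k) 0"
      using has_derivative_continuous[OF c(3)] by (intro continuous_intros)
    moreover have "c 0 $ k $ k \<noteq> 0" using c(1) f k line_of_nth_eq_0_iff by simp
    ultimately have "\<forall>\<^sub>F t in at 0. c t $ k $ k \<noteq> 0"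
      unfolding continuous_at by (rule tendsto_imp_eventually_ne)
    then show ?thesis by eventually_elim (use c CP2_eq_line_of_column in blast)
  qed
  moreover have "line_of (column_of k (c 0)) = c 0"
    by (simp only: col0 line_of_smult[OF q] c(1)[symmetric])
  ultimately have "(c has_derivative (\<lambda>t. D line_of (q *s f) (column_of k (t *\<^sub>R v)))) (at 0)"
    by (rule has_derivative_transform_eventually) simp
  from fun_cong[OF has_derivative_unique[OF this c(3)], of 1]
  have "v = D line_of (q *s f) (column_of k v)"
    by simp
  also have "column_of k v = q *s ((1 / q) *s column_of k v)" using q by (simp add: vec_eq_iff)
  also have "D line_of (q *s f) \<dots> = D line_of f ((1 / q) *s column_of k v)"
    by (rule D_line_of_smult[OF q f])
  finally show "v \<in> range (D line_of f)" by blast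
next
  fix v assume "v \<in> range (D line_of f)"
  then obtain w where w: "v = D line_of f w" by blast
  \<comment> \<open>\<open>tangent_space\<close> asks for a curve inside the set at all times, so
    the line is replaced by a constant where it meets 0; near time 0 this changes nothing.\<close>
  define c where "c t = (if f + t *\<^sub>R w = 0 then line_of f else line_of (f + t *\<^sub>R w))" for t
  have "c t \<in> CP2" for t using f by (auto simp: c_def CP2_def)
  moreover have "(c has_vector_derivative v) (at 0)"
  proof -
    have i: "((\<lambda>t. f + t *\<^sub>R w) has_derivative (\<lambda>t. t *\<^sub>R w)) (at 0)"
      by (auto intro!: derivative_eq_intros)
    have "((\<lambda>t. line_of (f + t *\<^sub>R w)) has_derivative (\<lambda>t. t *\<^sub>R v)) (at 0)"
      using diff_chain_at[OF i, of line_of "D line_of f"] line_of_differentiable[OF f]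
      by (simp add: o_def D_line_of_scaleR[OF f] w)
    moreover have "open {t. f + t *\<^sub>R w \<noteq> 0}"
      by (intro open_Collect_neq continuous_intros)
    ultimately show ?thesis unfolding has_vector_derivative_def
      by (rule has_derivative_transform_within_open[of _ _ _ _ "{t. f + t *\<^sub>R w \<noteq> 0}"])
        (use f in \<open>auto simp: c_def\<close>)
  qed
  moreover have "c 0 = line_of f" by (simp add: c_def)
  ultimately show "v \<in> tangent_space CP2 (line_of f)" by (auto simp: tangent_space_def)
qed

text \<open>Adds what ties the piece to S: its image is relatively open and carries the topology of
  the parameter domain.\<close>

locale curve_piece = lifted_curve +
  fixes S :: "cmat set"
  assumes image_open: "openin (top_of_set S) (\<gamma> ` U)"
    and homeo: "\<exists>\<delta>. homeomorphism U (\<gamma> ` U) \<gamma> \<delta>"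

lemma holo_param_imp_curve_piece:
  assumes "holo_param S U \<gamma>"
  shows "\<exists>f. curve_piece U f \<gamma> S"
  using assms unfolding holo_param_def curve_piece_def lifted_curve_def curve_piece_axioms_def by blast

context curve_piece
begin

lemma image_in_S: "z \<in> U \<Longrightarrow> \<gamma> z \<in> S"
  using openin_subset[OF image_open] by auto

text \<open>The homeomorphism gives only a continuous inverse of \<gamma>. A differentiable one
  comes from the inhomogeneous coordinate f_j / f_k, which depends on the point alone: if its
  derivative vanished for all j, then f' would be parallel to f and F would be zero.\<close>

lemma local_inverse:
  assumes z0: "z0 \<in> U"
  obtains k j B \<tau> where "open B" "z0 \<in> B" "B \<subseteq> U" "\<And>z. z \<in> B \<Longrightarrow> f z $ k \<noteq> 0"
    "open ((\<lambda>z. f z $ j / f z $ k) ` B)" "\<tau> holomorphic_on (\<lambda>z. f z $ j / f z $ k) ` B"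
    "\<And>z. z \<in> B \<Longrightarrow> \<tau> (f z $ j / f z $ k) = z" "openin (top_of_set S) (\<gamma> ` B)" "j \<noteq> k"
proof -
  obtain k where k: "f z0 $ k \<noteq> 0" using nonzero[OF z0] by (auto simp: vec_eq_iff)
  define U' where "U' = {z \<in> U. f z $ k \<noteq> 0}"
  have "U' = U \<inter> (\<lambda>z. f z $ k) -` (- {0})" by (auto simp: U'_def)
  then have U': "open U'"
    using continuous_open_preimage[OF holomorphic_on_imp_continuous_on[OF holo[of k]] open_U, of "- {0}"]
    by (simp add: open_Compl)
  have z0': "z0 \<in> U'" using z0 k by (simp add: U'_def)
  have \<phi>: "(\<lambda>z. f z $ j / f z $ k) holomorphic_on U'" for j
    by (intro holomorphic_intros holomorphic_on_subset[OF holo]) (auto simp: U'_def)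
  have \<phi>': "deriv (\<lambda>z. f z $ j / f z $ k) z0 = (f' z0 $ j * f z0 $ k - f z0 $ j * f' z0 $ k) / (f z0 $ k)\<^sup>2" for j
    by (rule DERIV_imp_deriv, rule derivative_eq_intros)
       (use vderiv_nth[OF holo open_U z0] k in \<open>auto simp: power2_eq_square\<close>)
  obtain j where j: "deriv (\<lambda>z. f z $ j / f z $ k) z0 \<noteq> 0"
  proof (rule ccontr)
    assume "\<not> thesis"
    then have *: "f' z0 $ j * f z0 $ k = f z0 $ j * f' z0 $ k" for j using that k \<phi>'[of j] by force
    have "f' z0 = (f' z0 $ k / f z0 $ k) *s f z0"
      using * k by (simp add: vec_eq_iff field_simps)
    then have "F z0 = ccross (f z0) ((f' z0 $ k / f z0 $ k) *s f z0)" by simp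
    also have "\<dots> = 0" by (rule vec3_eqI) simp_all
    finally show False using F_nonzero[OF z0] by simp
  qed
  let ?\<phi> = "\<lambda>z. f z $ j / f z $ k"
  obtain r where r: "0 < r" "ball z0 r \<subseteq> U'" "open (?\<phi> ` ball z0 r)" "inj_on ?\<phi> (ball z0 r)"
    using has_complex_derivative_locally_invertible[OF \<phi> z0' U' j] by blast
  obtain \<tau> where \<tau>: "\<tau> holomorphic_on (?\<phi> ` ball z0 r)" "\<And>z. z \<in> ball z0 r \<Longrightarrow> \<tau> (?\<phi> z) = z"
    by (rule holomorphic_has_inverse[OF holomorphic_on_subset[OF \<phi> r(2)] open_ball r(4)])
      (rule that; assumption)
  have BU: "ball z0 r \<subseteq> U" using r(2) by (auto simp: U'_def)
  obtain \<delta> where "homeomorphism U (\<gamma> ` U) \<gamma> \<delta>" using homeo by blast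
  then have "openin (top_of_set (\<gamma> ` U)) (\<gamma> ` ball z0 r)"
    by (rule homeomorphism_imp_open_map) (use BU in \<open>auto simp: openin_open_eq open_U\<close>)
  then have "openin (top_of_set S) (\<gamma> ` ball z0 r)"
    using image_open openin_trans by blast
  moreover have "j \<noteq> k" using j \<phi>'[of j] by auto
  ultimately show thesis
    by (intro that[of "ball z0 r" k j \<tau>] r(3) \<tau> BU) (use r(1,2) in \<open>auto simp: U'_def\<close>)
qed

text \<open>Reads the coordinate used in \<open>local_inverse\<close> off the matrix entries of the
  point.\<close>

lemma ratio_eq:
  assumes "z \<in> U" "f z $ k \<noteq> 0"
  shows "\<gamma> z $ j $ k / \<gamma> z $ k $ k = f z $ j / f z $ k"
  using assms nonzero[OF assms(1)] by (simp add: lift line_of_nth hprod_self_eq_0)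

lemma eventually_in_piece:
  assumes "openin (top_of_set S) (\<gamma> ` B)" "isCont c (0::real)" "\<And>t. c t \<in> S" "c 0 \<in> \<gamma> ` B"
  shows "\<forall>\<^sub>F t in at 0. c t \<in> \<gamma> ` B"
proof -
  obtain T where T: "open T" "\<gamma> ` B = S \<inter> T" using assms(1) by (auto simp: openin_open)
  have "\<forall>\<^sub>F t in at 0. c t \<in> T"
    using assms(2,4) T by (auto simp: continuous_at intro: topological_tendstoD)
  then show ?thesis by eventually_elim (use T assms in auto)
qed

lemma tangent_space_curve:
  assumes z0: "z0 \<in> U"
  shows "tangent_space S (\<gamma> z0) = range (D \<gamma> z0)"
proof (intro set_eqI iffI)
  fix v assume "v \<in> tangent_space S (\<gamma> z0)"
  then obtain c where c: "c 0 = \<gamma> z0" "\<And>t. c t \<in> S" "(c has_derivative (\<lambda>t. t *\<^sub>R v)) (at 0)"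
    by (auto simp: tangent_space_def has_vector_derivative_def)
  obtain k j B \<tau> where B: "open B" "z0 \<in> B" "B \<subseteq> U" "\<And>z. z \<in> B \<Longrightarrow> f z $ k \<noteq> 0"
    "open ((\<lambda>z. f z $ j / f z $ k) ` B)" "\<tau> holomorphic_on (\<lambda>z. f z $ j / f z $ k) ` B"
    "\<And>z. z \<in> B \<Longrightarrow> \<tau> (f z $ j / f z $ k) = z" "openin (top_of_set S) (\<gamma> ` B)" "j \<noteq> k"
    by (rule local_inverse[OF z0]) (rule that; assumption)
  \<comment> \<open>On the piece q is the inhomogeneous coordinate of \<open>c t\<close>, so
    \<open>\<tau> (q t)\<close> is a differentiable parameter for the curve, with
    \<open>\<gamma> (\<tau> (q t)) = c t\<close> near 0.\<close>
  define q where "q t = c t $ j $ k / c t $ k $ k" for t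
  have nth: "((\<lambda>t. c t $ i $ k) has_derivative (\<lambda>t. (t *\<^sub>R v) $ i $ k)) (at 0)" for i
    by (intro bounded_linear.has_derivative[OF bounded_linear_vec_nth] c)
  have ne: "c 0 $ k $ k \<noteq> 0"
    using B(4)[OF B(2)] nonzero[OF z0] by (simp add: c lift[OF z0] line_of_nth_eq_0_iff)
  obtain q' where q': "(q has_derivative q') (at 0)"
    using has_derivative_divide[OF nth nth ne] unfolding q_def[abs_def] by blast
  have q0: "q 0 = f z0 $ j / f z0 $ k"
    unfolding q_def c(1) by (rule ratio_eq[OF z0 B(4)[OF B(2)]])
  have "\<tau> field_differentiable (at (q 0))"
    using holomorphic_on_imp_differentiable_at[OF B(6,5)] B(2) q0 by auto
  then obtain \<tau>' where "(\<tau> has_derivative \<tau>') (at (q 0))"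
    by (auto simp: field_differentiable_def has_field_derivative_def)
  from diff_chain_at[OF q' this] obtain z' where z': "((\<lambda>t. \<tau> (q t)) has_derivative z') (at 0)"
    unfolding o_def by blast
  have \<tau>0: "\<tau> (q 0) = z0" using B(2,7) by (simp add: q0)
  have "((\<lambda>t. \<gamma> (\<tau> (q t))) has_derivative (\<lambda>t. D \<gamma> z0 (z' t))) (at 0)"
    using diff_chain_at[OF z', of \<gamma> "D \<gamma> z0"] \<gamma>_has_derivative[OF z0]
    unfolding \<tau>0 o_def frechet_derivative_eqI[OF \<gamma>_has_derivative[OF z0]] by blast
  moreover have "\<forall>\<^sub>F t in at 0. \<gamma> (\<tau> (q t)) = c t"
  proof -
    have "\<forall>\<^sub>F t in at 0. c t \<in> \<gamma> ` B"
      using eventually_in_piece[OF B(8) has_derivative_continuous[OF c(3)] c(2)] c(1) B(2) by auto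
    then show ?thesis
    proof eventually_elim
      case (elim t)
      then obtain z where z: "z \<in> B" "c t = \<gamma> z" by blast
      then have "q t = f z $ j / f z $ k" using B(3,4) by (auto simp: q_def intro!: ratio_eq)
      then show ?case using z B(7) by simp
    qed
  qed
  moreover have "\<gamma> (\<tau> (q 0)) = c 0" by (simp add: \<tau>0 c)
  ultimately have "(c has_derivative (\<lambda>t. D \<gamma> z0 (z' t))) (at 0)"
    by (rule has_derivative_transform_eventually) simp
  from fun_cong[OF has_derivative_unique[OF this c(3)], of 1] have "v = D \<gamma> z0 (z' 1)"
    by simp
  then show "v \<in> range (D \<gamma> z0)" by blast
next
  fix v assume "v \<in> range (D \<gamma> z0)"
  then obtain u where u: "v = D \<gamma> z0 u" by blast
  \<comment> \<open>Again patched by a constant outside U, so that the curve stays in S at all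
    times.\<close>
  define c where "c t = (if z0 + t *\<^sub>R u \<in> U then \<gamma> (z0 + t *\<^sub>R u) else \<gamma> z0)" for t
  have "c t \<in> S" for t using z0 image_in_S by (auto simp: c_def)
  moreover have "(c has_vector_derivative v) (at 0)"
  proof -
    have D: "(\<gamma> has_derivative D \<gamma> z0) (at z0)"
      using \<gamma>_has_derivative[OF z0] frechet_derivative_eqI by metis
    have i: "((\<lambda>t. z0 + t *\<^sub>R u) has_derivative (\<lambda>t. t *\<^sub>R u)) (at 0)"
      by (auto intro!: derivative_eq_intros)
    have "((\<lambda>t. \<gamma> (z0 + t *\<^sub>R u)) has_derivative (\<lambda>t. t *\<^sub>R v)) (at 0)"
      using diff_chain_at[OF i, of \<gamma> "D \<gamma> z0"] D
      by (simp add: o_def linear_scale[OF has_derivative_linear[OF D]] u)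
    moreover have "open ((\<lambda>t. z0 + t *\<^sub>R u) -` U)"
      by (intro open_vimage open_U continuous_intros)
    ultimately show ?thesis unfolding has_vector_derivative_def
      by (rule has_derivative_transform_within_open[of _ _ _ _ "(\<lambda>t. z0 + t *\<^sub>R u) -` U"])
        (use z0 in \<open>auto simp: c_def\<close>)
  qed
  moreover have "c 0 = \<gamma> z0" by (simp add: c_def)
  ultimately show "v \<in> tangent_space S (\<gamma> z0)" by (auto simp: tangent_space_def)
qed

abbreviation "n z \<equiv> vcnj (F z)"
abbreviation "normal z c \<equiv> D line_of (f z) (c *s n z)"

text \<open>Since n is Hermitian orthogonal to f, the correction term of \<open>fsh\<close>
  vanishes, and pairing with n is the conjugated determinant. With a multiple of f'' for w this will
  produce d.\<close>

lemma fs_normal: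
  assumes "z \<in> U"
  shows "fs (normal z c) (D line_of (f z) w) = Re (c * cnj (cdet (f z) (f' z) w)) / (norm (f z))\<^sup>2"
proof -
  have "fs (normal z c) (D line_of (f z) w) = Re (c * cnj (cdet (f z) (f' z) w) / of_real ((norm (f z))\<^sup>2))"
    by (simp add: fs_D_line_of nonzero[OF assms] fsh_def hprod_smult_left hprod_vcnj_ccross hprod_self)
  then show ?thesis by (simp only: Re_divide_of_real)
qed

lemma cdet_n: "cdet x y (c *s vcnj (ccross x y)) = c * of_real ((norm (ccross x y))\<^sup>2)"
proof -
  have "vcnj (c *s vcnj (ccross x y)) = cnj c *s ccross x y"
    by (simp add: vcnj_def vec_eq_iff)
  then show ?thesis by (simp add: cdet_def hprod_smult_right hprod_self)
qed

lemma fs_normal_normal: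
  assumes "z \<in> U"
  shows "fs (normal z c) (normal z c') = Re (c * cnj c') * ((norm (F z))\<^sup>2 / (norm (f z))\<^sup>2)"
proof -
  have "Re (c * cnj (c' * of_real r)) = Re (c * cnj c') * r" for r
    by (simp add: algebra_simps)
  then show ?thesis unfolding fs_normal[OF assms] cdet_n by simp
qed

text \<open>After removing its f component, a lift of a normal vector is Hermitian orthogonal to f
  and to f', and in dimension 3 this leaves only multiples of n.\<close>

lemma normal_space_curve:
  assumes z: "z \<in> U"
  shows "normal_space S (\<gamma> z) = range (normal z)"
proof (intro set_eqI iffI)
  note nz = nonzero[OF z]
  fix v assume v: "v \<in> normal_space S (\<gamma> z)"
  then obtain w where w: "v = D line_of (f z) w"
    unfolding normal_space_def lift[OF z] tangent_space_CP2[OF nz] by auto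
  have *: "fs v (D \<gamma> z u) = 0" for u
    using v unfolding normal_space_def tangent_space_curve[OF z] by auto
  have G: "Re (cnj u * fsh (f z) w (f' z)) = 0" for u
    using *[of u] by (simp add: w D_\<gamma>[OF z] fs_D_line_of[OF nz] fsh_simps)
  \<comment> \<open>The tangent space is a complex line, so testing with 1 and \<i> turns real into
    Hermitian orthogonality.\<close>
  have G0: "fsh (f z) w (f' z) = 0"
    using G[of 1] G[of \<i>] by (simp add: complex_eq_iff)
  have h: "hprod (f z) (f z) \<noteq> 0" using nz by (simp add: hprod_self_eq_0)
  define w' where "w' = w - (hprod w (f z) / hprod (f z) (f z)) *s f z"
  have "hprod w' (f z) = 0" using h by (simp add: w'_def hprod_simps)
  moreover have "hprod w' (f' z) = 0" using h G0
    by (simp add: w'_def hprod_simps fsh_def field_simps power2_eq_square)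
  ultimately have e: "hprod (F z) (F z) *s w' = hprod w' (n z) *s n z" by (rule orthogonal_to_two)
  have FF: "hprod (F z) (F z) \<noteq> 0" using F_nonzero[OF z] by (simp add: hprod_self_eq_0)
  have "w' = (1 / hprod (F z) (F z)) *s (hprod (F z) (F z) *s w')"
    using FF by (simp add: vec_eq_iff)
  then have "w' = (hprod w' (n z) / hprod (F z) (F z)) *s n z"
    unfolding e by (simp add: vec_eq_iff)
  moreover have "D line_of (f z) w' = v"
    by (simp add: w'_def D_line_of_diff[OF nz] D_line_of_point[OF nz] w)
  ultimately show "v \<in> range (normal z)" by (metis rangeI)
next
  fix v assume "v \<in> range (normal z)"
  then obtain c where c: "v = normal z c" by blast
  have "cdet (f z) (f' z) (u *s f' z) = 0" for u
    by (simp add: cdet_def vcnj_def hprod_def sum_3 algebra_simps)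
  then show "v \<in> normal_space S (\<gamma> z)"
    unfolding normal_space_def lift[OF z] tangent_space_CP2[OF nonzero[OF z]]
    unfolding lift[OF z, symmetric] tangent_space_curve[OF z]
    by (auto simp: c D_\<gamma>[OF z] fs_normal[OF z])
qed

end

section \<open>Affine charts\<close>

text \<open>The Levi-Civita connection of the Fubini-Study metric on lifts of tangent vectors.\<close>

definition conn :: "complex ^ 3 \<Rightarrow> complex ^ 3 \<Rightarrow> complex ^ 3 \<Rightarrow> complex ^ 3" where
  "conn z x w = (- 1 / hprod z z) *s (hprod x z *s w + hprod w z *s x)"

text \<open>Metric compatibility of \<open>conn\<close> along an arbitrary moving base point a. It
  yields the Christoffel symbols of the charts and, along a curve, the Weingarten relation.\<close>

lemma fsh_has_derivative:
  assumes a: "(a has_derivative a') (at t)" and b: "(b has_derivative b') (at t)"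
    and c: "(c has_derivative c') (at t)" and nz: "a t \<noteq> 0"
  shows "((\<lambda>t. fsh (a t) (b t) (c t)) has_derivative
     (\<lambda>u. fsh (a t) (b' u + conn (a t) (a' u) (b t)) (c t)
        + fsh (a t) (b t) (c' u + conn (a t) (a' u) (c t)))) (at t)"
proof -
  have h: "hprod (a t) (a t) \<noteq> 0" using nz by (simp add: hprod_self_eq_0)
  have hc: "cnj (hprod (a t) (a t)) = hprod (a t) (a t)" by (rule cnj_hprod)
  have conn: "fsh (a t) (conn (a t) x w) y = - (hprod x (a t) * fsh (a t) w y + hprod w (a t) * fsh (a t) x y) / hprod (a t) (a t)"
     "fsh (a t) y (conn (a t) x w) = - (hprod (a t) x * fsh (a t) y w + hprod (a t) w * fsh (a t) y x) / hprod (a t) (a t)" for x w y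
    unfolding conn_def fsh_simps by (simp_all add: cnj_hprod divide_inverse algebra_simps)
  \<comment> \<open>The quotient rule on one side and the expanded \<open>conn\<close> terms on the
    other; each variable is named after the factors of its product, as \<open>bc'\<close> for
    \<open>hprod b c'\<close>, and h is the squared norm of a.\<close>
  have alg: "((bc' + b'c) * h - bc * (aa' + a'a)) / (h * h) -
      ((ba * (ac' + a'c) + (ba' + b'a) * ac) * h\<^sup>2 - ba * ac * (of_nat 2 * (aa' + a'a) * h ^ (2 - 1))) / (h\<^sup>2 * h\<^sup>2)
     = (b'c / h - b'a * ac / h\<^sup>2) + - (a'a * (bc / h - ba * ac / h\<^sup>2) + ba * (a'c / h - a'a * ac / h\<^sup>2)) / h
     + ((bc' / h - ba * ac' / h\<^sup>2) + - (aa' * (bc / h - ba * ac / h\<^sup>2) + ac * (ba' / h - ba * aa' / h\<^sup>2)) / h)"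
    if "h \<noteq> 0" for h bc bc' b'c aa' a'a ba ba' b'a ac ac' a'c :: complex
    using that by (simp add: divide_simps power2_eq_square) (simp add: algebra_simps)
  note d = has_derivative_diff[OF has_derivative_divide'[OF hprod_has_derivative[OF b c] hprod_has_derivative[OF a a] h]
      has_derivative_divide'[OF has_derivative_mult[OF hprod_has_derivative[OF b a] hprod_has_derivative[OF a c]]
        has_derivative_power[OF hprod_has_derivative[OF a a], of 2]]]
  show ?thesis
    unfolding fsh_simps conn
    unfolding fsh_def
    by (rule has_derivative_eq_rhs, rule d) (use h in \<open>simp_all only: alg power_eq_0_iff simp_thms\<close>)
qed

text \<open>Indexing by the homogeneous coordinate that is set to 1 lets the three charts be treated
  at once; \<open>embed k\<close> is the differential of the affine lift
  \<open>hpoint k\<close>.\<close>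

definition embed :: "3 \<Rightarrow> complex ^ 2 \<Rightarrow> complex ^ 3" where
  "embed k a = (if k = 1 then vector [0, a $ 1, a $ 2]
     else if k = 2 then vector [a $ 1, 0, a $ 2] else vector [a $ 1, a $ 2, 0])"

definition omit :: "3 \<Rightarrow> complex ^ 3 \<Rightarrow> complex ^ 2" where
  "omit k w = (if k = 1 then vector [w $ 2, w $ 3]
     else if k = 2 then vector [w $ 1, w $ 3] else vector [w $ 1, w $ 2])"

definition hpoint :: "3 \<Rightarrow> complex ^ 2 \<Rightarrow> complex ^ 3" where
  "hpoint k a = axis k 1 + embed k a"

definition chart :: "3 \<Rightarrow> complex ^ 2 \<Rightarrow> cmat" where
  "chart k a = line_of (hpoint k a)"

lemma vec2_eqI: "x $ 1 = y $ 1 \<Longrightarrow> x $ 2 = y $ 2 \<Longrightarrow> x = y" for x y :: "'a ^ 2"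
  by (simp add: vec_eq_iff forall_2)

lemma three_cases: "k = 1 \<or> k = 2 \<or> k = (3::3)"
  by (rule exhaust_3)

lemma embed_simps:
  "embed k (a + b) = embed k a + embed k b"
  "embed k (a - b) = embed k a - embed k b"
  "embed k (c *s a) = c *s embed k a"
  "embed k (r *\<^sub>R a) = r *\<^sub>R embed k a"
  "embed k a $ k = 0"
  using three_cases[of k] by (auto simp: embed_def intro!: vec3_eqI)

lemma omit_simps:
  "omit k (a + b) = omit k a + omit k b"
  "omit k (c *s a) = c *s omit k a"
  "omit k (r *\<^sub>R a) = r *\<^sub>R omit k a"
  "omit k (embed k c') = c'"
  "omit k (axis k x) = 0"
  using three_cases[of k] by (auto simp: omit_def embed_def axis_def intro!: vec2_eqI)

lemma embed_omit: "w $ k = 0 \<Longrightarrow> embed k (omit k w) = w"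
  using three_cases[of k] by (auto simp: omit_def embed_def intro!: vec3_eqI)

lemma hprod_embed: "hprod (embed k a) (embed k b) = hprod a b"
  using three_cases[of k] by (auto simp: embed_def hprod_def sum_3 sum_2)

lemma bounded_linear_embed: "bounded_linear (embed k)"
  and bounded_linear_omit: "bounded_linear (omit k)"
  unfolding linear_conv_bounded_linear[symmetric]
  by (auto intro!: linearI simp: embed_simps omit_simps)

lemma hpoint_nth: "hpoint k a $ k = 1"
  by (simp add: hpoint_def embed_simps)

lemma hpoint_nonzero: "hpoint k a \<noteq> 0"
  using hpoint_nth[of k a] by (metis zero_index zero_neq_one)

lemma hpoint_omit: "w $ k = 1 \<Longrightarrow> hpoint k (omit k w) = w"
  using three_cases[of k] by (auto simp: hpoint_def omit_def embed_def axis_def intro!: vec3_eqI)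

lemma affine_charts_eq: "affine_charts = range chart"
proof -
  have "chart 1 = (\<lambda>a. line_of (vector [1, a $ 1, a $ 2]))"
    "chart 2 = (\<lambda>a. line_of (vector [a $ 1, 1, a $ 2]))"
    "chart 3 = (\<lambda>a. line_of (vector [a $ 1, a $ 2, 1]))"
    unfolding fun_eq_iff chart_def hpoint_def
    by (auto simp: embed_def axis_def intro!: arg_cong[of _ _ line_of] vec3_eqI)
  then show ?thesis unfolding affine_charts_def UNIV_3 by simp
qed

lemma hpoint_has_derivative: "(hpoint k has_derivative embed k) (at a)"
  unfolding hpoint_def[abs_def]
  by (rule has_derivative_eq_rhs, rule has_derivative_add[OF has_derivative_const
      bounded_linear.has_derivative[OF bounded_linear_embed has_derivative_ident]]) simp

lemma chart_has_derivative:
  "(chart k has_derivative (\<lambda>w. D line_of (hpoint k a) (embed k w))) (at a)"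
  using diff_chain_at[OF hpoint_has_derivative line_of_differentiable[OF hpoint_nonzero]]
  unfolding o_def chart_def[abs_def] .

lemma D_chart: "D (chart k) a w = D line_of (hpoint k a) (embed k w)"
  unfolding frechet_derivative_eqI[OF chart_has_derivative] ..

lemma pullback_chart: "pullback (chart k) a u v = Re (fsh (hpoint k a) (embed k u) (embed k v))"
  by (simp add: pullback_def D_chart fs_D_line_of hpoint_nonzero)

lemma ccross_hpoint_embed:
  assumes "ccross (hpoint k a) (embed k w) = 0"
  shows "w = 0"
proof -
  have "ccross (hpoint k a) (embed k w) $ i = 0" for i using assms by simp
  from this[of 1] this[of 2] this[of 3] show ?thesis
    using three_cases[of k] by (auto simp: hpoint_def embed_def axis_def intro!: vec2_eqI)
qed

lemma D_chart_inj: "D (chart k) a w = D (chart k) a w' \<Longrightarrow> w = w'"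
proof -
  assume "D (chart k) a w = D (chart k) a w'"
  then have "D line_of (hpoint k a) (embed k (w - w')) = 0"
    by (simp add: D_chart embed_simps D_line_of_diff hpoint_nonzero)
  then have "w - w' = 0"
    using ccross_hpoint_embed D_line_of_eq_0_iff hpoint_nonzero by blast
  then show ?thesis by simp
qed

text \<open>\<open>conn\<close> is symmetric, and it is metric by \<open>fsh_has_derivative\<close>,
  since the differential of \<open>hpoint k\<close> is the constant map
  \<open>embed k\<close>.\<close>

lemma christoffel_chart:
  "embed k (christoffel (pullback (chart k)) a u v) = conn (hpoint k a) (embed k u) (embed k v)"
proof -
  let ?z = "hpoint k a"
  define \<Gamma> where "\<Gamma> u v = omit k (conn ?z (embed k u) (embed k v))" for u v
  \<comment> \<open>\<open>conn\<close> is a combination of its two arguments, so its coordinate k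
    stays 0 and the result is the lift of a chart vector.\<close>
  have e: "embed k (\<Gamma> u v) = conn ?z (embed k u) (embed k v)" for u v
    unfolding \<Gamma>_def by (intro embed_omit) (simp add: conn_def embed_simps)
  have "christoffel (pullback (chart k)) a u v = \<Gamma> u v"
  proof (rule christoffel_eqI)
    fix w assume "\<And>y. pullback (chart k) a w y = 0"
    from this[of w] have "D line_of ?z (embed k w) = 0"
      by (simp add: pullback_def D_chart fs_def)
    then show "w = 0" using ccross_hpoint_embed D_line_of_eq_0_iff hpoint_nonzero by blast
  next
    fix v w show "pullback (chart k) a v w = pullback (chart k) a w v"
      using arg_cong[OF cnj_fsh[of ?z "embed k v" "embed k w"], of Re] by (simp add: pullback_chart)
  next
    fix u v y
    have "((\<lambda>b. pullback (chart k) b v y) has_derivative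
       (\<lambda>u. Re (fsh ?z (0 + conn ?z (embed k u) (embed k v)) (embed k y)
          + fsh ?z (embed k v) (0 + conn ?z (embed k u) (embed k y))))) (at a)"
      unfolding pullback_chart
      by (intro has_derivative_Re fsh_has_derivative hpoint_has_derivative has_derivative_const hpoint_nonzero)
    from frechet_derivative_eqI[OF this]
    show "D (\<lambda>q. pullback (chart k) q v y) a u =
        pullback (chart k) a (\<Gamma> u v) y + pullback (chart k) a v (\<Gamma> u y)"
      by (simp add: pullback_chart e)
  next
    fix u v show "\<Gamma> u v = \<Gamma> v u" by (simp add: \<Gamma>_def conn_def add.commute)
  qed (simp add: pullback_chart embed_simps fsh_simps)
  then show ?thesis by (simp add: e)
qed

text \<open>Column k of the projection is x divided by its squared norm, and its entry k gives that
  norm.\<close>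

lemma line_of_inj_normalized:
  assumes eq: "line_of x = line_of y" and "x $ k = 1" "y $ k = 1"
  shows "x = y"
proof -
  have nz: "hprod x x \<noteq> 0" "hprod y y \<noteq> 0" using assms by (auto simp: hprod_self_eq_0)
  have "(1 / hprod x x) *s x = (1 / hprod y y) *s y"
    using arg_cong[OF eq, of "column_of k"] unfolding column_of_line_of assms(2,3) by simp
  then have *: "x $ i / hprod x x = y $ i / hprod y y" for i by (simp add: vec_eq_iff)
  from *[of k] have "hprod x x = hprod y y" using assms nz by simp
  then show ?thesis using * nz by (simp add: vec_eq_iff)
qed

section \<open>The shape operator\<close>

lemma smult_has_derivative:
  fixes g :: "'a::real_normed_vector \<Rightarrow> complex ^ 'n"
  assumes "(f has_derivative f') (at x)" "(g has_derivative g') (at x)"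
  shows "((\<lambda>x. f x *s g x) has_derivative (\<lambda>h. f x *s g' h + f' h *s g x)) (at x)"
  by (rule has_derivative_vec_nth, simp,
      intro has_derivative_mult bounded_linear.has_derivative[OF bounded_linear_vec_nth] assms)

lemma smult_differentiable:
  fixes g :: "'a::real_normed_vector \<Rightarrow> complex ^ 'n"
  shows "f differentiable at x \<Longrightarrow> g differentiable at x \<Longrightarrow> (\<lambda>x. f x *s g x) differentiable at x"
  unfolding differentiable_def by (elim exE, rule exI, rule smult_has_derivative)

lemma bounded_linear_differentiable:
  "bounded_linear h \<Longrightarrow> g differentiable at x \<Longrightarrow> (\<lambda>x. h (g x)) differentiable at x"
  unfolding differentiable_def by (elim exE, rule exI, rule bounded_linear.has_derivative)

lemma bounded_linear_vcnj: "bounded_linear vcnj"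
  unfolding linear_conv_bounded_linear[symmetric]
  by (rule linearI) (simp_all add: vcnj_def vec_eq_iff)

lemma vderiv_smult:
  assumes "(p has_field_derivative p') (at z)" "\<And>i. ((\<lambda>w. f w $ i) has_field_derivative f' $ i) (at z)"
  shows "vderiv (\<lambda>z. p z *s f z) z = p' *s f z + p z *s f'"
  by (rule vderiv_eqI, simp, rule DERIV_cong[OF DERIV_mult[OF assms]]) (simp add: mult.commute)

lemma fs_simps:
  "fs (x + x') y = fs x y + fs x' y" "fs (x - x') y = fs x y - fs x' y" "fs (- x) y = - fs x y"
  "fs x (y + y') = fs x y + fs x y'" "fs (r *\<^sub>R x) y = r * fs x y" "fs x (r *\<^sub>R y) = r * fs x y"
  "fs 0 y = 0" "fs x 0 = 0"
  by (simp_all add: fs_def inner_simps add_divide_distrib diff_divide_distrib)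

context lifted_curve
begin

lemma linear_D: "z \<in> U \<Longrightarrow> linear (D \<gamma> z)"
  using has_derivative_linear[OF \<gamma>_has_derivative] frechet_derivative_eqI[OF \<gamma>_has_derivative] by simp

lemma fs_D: "z \<in> U \<Longrightarrow> fs (D \<gamma> z u) (D \<gamma> z v) = \<rho> z * Re (u * cnj v)"
  using pullback_\<gamma> by (simp add: pullback_def)

lemma tangent_eqI:
  assumes z: "z \<in> U" and y: "y \<in> range (D \<gamma> z)" "y' \<in> range (D \<gamma> z)"
    and eq: "\<And>u. fs y (D \<gamma> z u) = fs y' (D \<gamma> z u)"
  shows "y = y'"
proof -
  obtain a b where ab: "y = D \<gamma> z a" "y' = D \<gamma> z b" using y by blast
  define s where "s = a - b"
  have s: "y - y' = D \<gamma> z s"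
    by (simp add: ab s_def linear_diff[OF linear_D[OF z]])
  have "fs (y - y') (y - y') = 0"
    unfolding s using eq[of s] by (simp add: fs_simps flip: s)
  then show ?thesis by (simp add: fs_def)
qed

lemma tangent_representer:
  assumes z: "z \<in> U" and l: "linear l"
  obtains y where "y \<in> range (D \<gamma> z)" "\<And>u. fs y (D \<gamma> z u) = l (u::complex)"
proof
  \<comment> \<open>The gradient of l for the standard metric of the plane, divided by the conformal
    factor.\<close>
  let ?s = "of_real (1 / \<rho> z) * Complex (l 1) (l \<i>)"
  show "D \<gamma> z ?s \<in> range (D \<gamma> z)" by blast
  fix u
  have "u = Re u *\<^sub>R 1 + Im u *\<^sub>R \<i>" by (simp add: complex_eq_iff)
  then have "l u = Re u * l 1 + Im u * l \<i>"
    using linear_add[OF l, of "Re u *\<^sub>R 1" "Im u *\<^sub>R \<i>"] linear_scale[OF l, of "Re u" 1] linear_scale[OF l, of "Im u" \<i>]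
    by simp
  moreover have "r * (1 / r * a) = a" if "r > 0" for r a :: real using that by simp
  note this[OF \<rho>_pos[OF z]]
  moreover have "Re (of_real r * a * b) = r * Re (a * b)" for r a b by (simp add: algebra_simps)
  ultimately show "fs (D \<gamma> z ?s) (D \<gamma> z u) = l u"
    unfolding fs_D[OF z] by (simp only: complex_cnj mult.assoc) simp
qed

text \<open>A lift with coordinate k equal to 1 is the curve seen in chart k. For g = p f the second
  derivative is p f'' + 2 p' f' + p'' f: the last term projects to 0 and the middle one is tangent,
  so pairings with normal vectors see only f''.\<close>

lemma normalized_lift:
  fixes k
  defines "U' \<equiv> {\<zeta> \<in> U. f \<zeta> $ k \<noteq> 0}" and "g \<equiv> \<lambda>\<zeta>. (1 / f \<zeta> $ k) *s f \<zeta>"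
  shows "lifted_curve U' g \<gamma>"
    and "\<And>\<zeta>. \<zeta> \<in> U' \<Longrightarrow> g \<zeta> $ k = 1"
    and "\<And>\<zeta>. \<zeta> \<in> U' \<Longrightarrow> vderiv g \<zeta> $ k = 0"
    and "\<And>\<zeta> c v. \<zeta> \<in> U' \<Longrightarrow> (\<And>u. fs v (D \<gamma> \<zeta> u) = 0) \<Longrightarrow>
       fs v (D line_of (g \<zeta>) (c *s vderiv (vderiv g) \<zeta>)) = fs v (D line_of (f \<zeta>) (c *s f'' \<zeta>))"
proof -
  have "U' = U \<inter> (\<lambda>z. f z $ k) -` (- {0})" by (auto simp: U'_def)
  then have U': "open U'"
    using continuous_open_preimage[OF holomorphic_on_imp_continuous_on[OF holo[of k]] open_U, of "- {0}"]
    by (simp add: open_Compl)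
  have sub: "U' \<subseteq> U" and ne: "\<And>\<zeta>. \<zeta> \<in> U' \<Longrightarrow> f \<zeta> $ k \<noteq> 0" by (auto simp: U'_def)
  define p where "p \<zeta> = 1 / f \<zeta> $ k" for \<zeta>
  have p: "p holomorphic_on U'" unfolding p_def[abs_def]
    by (intro holomorphic_intros holomorphic_on_subset[OF holo sub] ne)
  have p': "(deriv p) holomorphic_on U'" by (rule holomorphic_deriv[OF p U'])
  have g_def': "g = (\<lambda>\<zeta>. p \<zeta> *s f \<zeta>)" by (simp add: g_def p_def)
  show 1: "lifted_curve U' g \<gamma>"
  proof
    show "open U'" by (rule U')
    show "(\<lambda>z. g z $ i) holomorphic_on U'" for i unfolding g_def'
      by (simp, intro holomorphic_intros p holomorphic_on_subset[OF holo sub])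
    show "g z \<noteq> 0" if "z \<in> U'" for z
      using ne[OF that] by (auto simp: g_def vec_eq_iff)
    show "\<gamma> z = line_of (g z)" if "z \<in> U'" for z
      using ne[OF that] sub that by (auto simp: g_def line_of_smult lift)
    show "inj (D \<gamma> z)" if "z \<in> U'" for z using inj_D that sub by auto
  qed
  show 2: "g \<zeta> $ k = 1" if "\<zeta> \<in> U'" for \<zeta> using ne[OF that] by (simp add: g_def)
  show "vderiv g \<zeta> $ k = 0" if "\<zeta> \<in> U'" for \<zeta>
  proof -
    have "((\<lambda>w. g w $ k) has_field_derivative 0) (at \<zeta>)"
      by (rule has_field_derivative_transform_within_open[OF DERIV_const U' that]) (simp add: 2)
    then show ?thesis by (simp add: vderiv_def DERIV_imp_deriv)
  qed
  fix \<zeta> c v assume \<zeta>: "\<zeta> \<in> U'" and v: "\<And>u. fs v (D \<gamma> \<zeta> u) = 0"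
  have \<zeta>U: "\<zeta> \<in> U" using \<zeta> sub by auto
  have g': "vderiv g w = deriv p w *s f w + p w *s f' w" if "w \<in> U'" for w
    unfolding g_def' using that sub
    by (intro vderiv_smult holomorphic_derivI[OF p U'] vderiv_nth[OF holo open_U]) auto
  have d: "((\<lambda>w. (deriv p w *s f w + p w *s f' w) $ i) has_field_derivative
      (deriv (deriv p) \<zeta> *s f \<zeta> + (2 * deriv p \<zeta>) *s f' \<zeta> + p \<zeta> *s f'' \<zeta>) $ i) (at \<zeta>)" for i
    using holomorphic_derivI[OF p U' \<zeta>] holomorphic_derivI[OF p' U' \<zeta>] vderiv_nth[OF holo open_U \<zeta>U]
      vderiv_nth[OF vderiv_holomorphic[OF holo open_U] open_U \<zeta>U]
    by (auto intro!: derivative_eq_intros simp: algebra_simps)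
  have g'': "vderiv (vderiv g) \<zeta> = deriv (deriv p) \<zeta> *s f \<zeta> + (2 * deriv p \<zeta>) *s f' \<zeta> + p \<zeta> *s f'' \<zeta>"
    by (rule vderiv_eqI, rule has_field_derivative_transform_within_open[OF d U' \<zeta>]) (simp add: g')
  have pz: "p \<zeta> \<noteq> 0" using ne[OF \<zeta>] by (simp add: p_def)
  have "c *s vderiv (vderiv g) \<zeta> = p \<zeta> *s (c *s f'' \<zeta> + ((2 * c * deriv p \<zeta> / p \<zeta>) *s f' \<zeta>
      + (c * deriv (deriv p) \<zeta> / p \<zeta>) *s f \<zeta>))"
    using pz by (simp add: g'' vec_eq_iff field_simps)
  then have "D line_of (g \<zeta>) (c *s vderiv (vderiv g) \<zeta>) =
      D line_of (f \<zeta>) (c *s f'' \<zeta>) + D \<gamma> \<zeta> (2 * c * deriv p \<zeta> / p \<zeta>)"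
    unfolding g_def' D_\<gamma>[OF \<zeta>U]
    by (simp only: D_line_of_smult[OF pz nonzero[OF \<zeta>U]] D_line_of_add[OF nonzero[OF \<zeta>U]]
        D_line_of_point[OF nonzero[OF \<zeta>U]] add_0_right)
  then show "fs v (D line_of (g \<zeta>) (c *s vderiv (vderiv g) \<zeta>)) = fs v (D line_of (f \<zeta>) (c *s f'' \<zeta>))"
    by (simp add: fs_simps v)
qed

end

context curve_piece
begin

lemma tangential_part:
  assumes z: "z \<in> U"
  shows "tangential_part S (\<gamma> z) w \<in> range (D \<gamma> z)"
    and "fs (tangential_part S (\<gamma> z) w) (D \<gamma> z u) = fs w (D \<gamma> z u)"
proof -
  have "linear (\<lambda>u. fs w (D \<gamma> z u))"
    by (rule linearI) (simp_all add: linear_add[OF linear_D[OF z]] linear_scale[OF linear_D[OF z]] fs_simps)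
  then obtain y where y: "y \<in> range (D \<gamma> z)" "\<And>u. fs y (D \<gamma> z u) = fs w (D \<gamma> z u)"
    using tangent_representer[OF z] by blast
  have "tangential_part S (\<gamma> z) w = y"
    unfolding tangential_part_def tangent_space_curve[OF z]
  proof (rule the_equality)
    fix y' assume "y' \<in> range (D \<gamma> z) \<and> (\<forall>x\<in>range (D \<gamma> z). fs (w - y') x = 0)"
    then show "y' = y" using y by (intro tangent_eqI[OF z]) (auto simp: fs_simps)
  qed (use y in \<open>auto simp: fs_simps\<close>)
  then show "tangential_part S (\<gamma> z) w \<in> range (D \<gamma> z)"
    "fs (tangential_part S (\<gamma> z) w) (D \<gamma> z u) = fs w (D \<gamma> z u)" using y by auto
qed

lemma normal_orthogonal:
  assumes "z \<in> U" "v \<in> normal_space S (\<gamma> z)"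
  shows "fs v (D \<gamma> z u) = 0"
  using assms unfolding normal_space_def tangent_space_curve[OF assms(1)] by auto

text \<open>The Weingarten relation: the Hermitian product of a normal field with the velocity
  vanishes along the curve, and differentiating moves the derivative from the field to the velocity.
  The result depends on W only through its value at a, so every admissible field and chart gives the
  same operator.\<close>

lemma shape_witness:
  assumes z: "z \<in> U" and N: "open N" "a \<in> N" and a: "chart k a = \<gamma> z" and W: "W differentiable_on N"
    and normal: "\<forall>b\<in>N. chart k b \<in> S \<longrightarrow> D (chart k) b (W b) \<in> normal_space S (chart k b)"
    and \<xi>: "D (chart k) a \<xi> = D \<gamma> z u'"
  shows "fs (D (chart k) a (cov_deriv (pullback (chart k)) W a \<xi>)) (D \<gamma> z u) =
     - fs (D (chart k) a (W a)) (D line_of (f z) ((u' * u) *s f'' z))"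
proof -
  define U' where "U' = {\<zeta> \<in> U. f \<zeta> $ k \<noteq> 0}"
  define g where "g = (\<lambda>\<zeta>. (1 / f \<zeta> $ k) *s f \<zeta>)"
  interpret g: lifted_curve U' g \<gamma> unfolding U'_def g_def by (rule normalized_lift)
  have nl2: "g \<zeta> $ k = 1" if "\<zeta> \<in> U'" for \<zeta>
    using normalized_lift(2)[of \<zeta> k] that unfolding U'_def g_def by blast
  have nl3: "g.f' \<zeta> $ k = 0" if "\<zeta> \<in> U'" for \<zeta>
    using normalized_lift(3)[of \<zeta> k] that unfolding U'_def g_def by blast
  have nl4: "fs v (D line_of (g \<zeta>) (c *s g.f'' \<zeta>)) = fs v (D line_of (f \<zeta>) (c *s f'' \<zeta>))"
    if "\<zeta> \<in> U'" "\<And>u. fs v (D \<gamma> \<zeta> u) = 0" for \<zeta> c v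
    using normalized_lift(4)[of \<zeta> k v c] that unfolding U'_def g_def by blast
  have "\<gamma> z $ k $ k \<noteq> 0"
    unfolding a[symmetric] chart_def by (simp add: line_of_nth_eq_0_iff hpoint_nonzero hpoint_nth)
  then have zU': "z \<in> U'"
    using z nonzero[OF z] by (simp add: U'_def lift line_of_nth_eq_0_iff)
  define \<alpha> where "\<alpha> \<zeta> = omit k (g \<zeta>)" for \<zeta>
  have hp: "hpoint k (\<alpha> \<zeta>) = g \<zeta>" if "\<zeta> \<in> U'" for \<zeta>
    unfolding \<alpha>_def by (rule hpoint_omit[OF nl2[OF that]])
  have "hpoint k a = g z"
    using a[symmetric] by (intro line_of_inj_normalized[of _ _ k])
      (simp_all add: chart_def g.lift[OF zU'] hpoint_nth nl2[OF zU'])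
  then have a\<alpha>: "a = \<alpha> z" by (simp add: \<alpha>_def hpoint_def omit_simps flip: \<open>hpoint k a = g z\<close>)
  have \<alpha>': "(\<alpha> has_derivative (\<lambda>u. omit k (u *s g.f' \<zeta>))) (at \<zeta>)" if "\<zeta> \<in> U'" for \<zeta>
    unfolding \<alpha>_def[abs_def] by (rule bounded_linear.has_derivative[OF bounded_linear_omit g.f_deriv[OF that]])
  have emb: "embed k (omit k (u *s g.f' z)) = u *s g.f' z" for u
    by (rule embed_omit) (simp add: nl3[OF zU'])
  have "D (chart k) a \<xi> = D (chart k) a (omit k (u' *s g.f' z))"
    unfolding \<xi> unfolding D_chart emb g.D_\<gamma>[OF zU'] a\<alpha> hp[OF zU'] ..
  then have \<xi>': "\<xi> = omit k (u' *s g.f' z)" by (rule D_chart_inj)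
  have W': "(W has_derivative D W a) (at a)"
    using W N by (simp add: differentiable_on_eq_differentiable_at frechet_derivative_works)
  define B where "B = U' \<inter> \<alpha> -` N"
  have "continuous_on U' \<alpha>"
    by (intro continuous_at_imp_continuous_on ballI has_derivative_continuous[OF \<alpha>'])
  then have B: "open B" "z \<in> B"
    using N a\<alpha> zU' g.open_U by (auto simp: B_def continuous_open_preimage)
  \<comment> \<open>As a complex identity, again by testing with 1 and \<i>.\<close>
  have T0: "fsh (g \<zeta>) (embed k (W (\<alpha> \<zeta>))) (g.f' \<zeta>) = 0" if \<zeta>: "\<zeta> \<in> B" for \<zeta>
  proof -
    have \<zeta>U: "\<zeta> \<in> U'" "\<zeta> \<in> U" "\<alpha> \<zeta> \<in> N" using \<zeta> by (auto simp: B_def U'_def)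
    have c: "chart k (\<alpha> \<zeta>) = \<gamma> \<zeta>" by (simp add: chart_def hp \<zeta>U g.lift)
    have "D (chart k) (\<alpha> \<zeta>) (W (\<alpha> \<zeta>)) \<in> normal_space S (\<gamma> \<zeta>)"
      using normal \<zeta>U image_in_S by (metis c)
    from normal_orthogonal[OF \<zeta>U(2) this]
    have "Re (cnj u * fsh (g \<zeta>) (embed k (W (\<alpha> \<zeta>))) (g.f' \<zeta>)) = 0" for u
      by (simp add: D_chart hp \<zeta>U g.D_\<gamma> fs_D_line_of g.nonzero fsh_simps)
    from this[of 1] this[of \<i>] show ?thesis by (simp add: complex_eq_iff)
  qed
  have D1: "((\<lambda>\<zeta>. embed k (W (\<alpha> \<zeta>))) has_derivative (\<lambda>u. embed k (D W a (omit k (u *s g.f' z))))) (at z)"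
    using diff_chain_at[OF \<alpha>'[OF zU'], of W "D W a"] W'
    by (intro bounded_linear.has_derivative[OF bounded_linear_embed]) (simp add: o_def a\<alpha>)
  \<comment> \<open>The derivative of the product in \<open>T0\<close>, written with metric
    compatibility; uniqueness of derivatives makes it zero.\<close>
  have "((\<lambda>_. 0) has_derivative (\<lambda>u. fsh (g z) (embed k (D W a (omit k (u *s g.f' z))) + conn (g z) (u *s g.f' z) (embed k (W (\<alpha> z)))) (g.f' z)
        + fsh (g z) (embed k (W (\<alpha> z))) (u *s g.f'' z + conn (g z) (u *s g.f' z) (g.f' z)))) (at z)"
    by (rule has_derivative_transform_within_open[OF
          fsh_has_derivative[OF g.f_deriv[OF zU'] D1 g.f'_deriv[OF zU'] g.nonzero[OF zU']] B])
      (simp add: T0)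
  from fun_cong[OF has_derivative_unique[OF this has_derivative_const], of u']
  have e: "fsh (g z) (embed k (D W a \<xi>) + conn (g z) (u' *s g.f' z) (embed k (W a))) (g.f' z)
        + fsh (g z) (embed k (W a)) (u' *s g.f'' z + conn (g z) (u' *s g.f' z) (g.f' z)) = 0"
    by (simp add: \<xi>' a\<alpha>)
  \<comment> \<open>The connection term of the acceleration is a multiple of the velocity, hence
    orthogonal to the field.\<close>
  have "conn (g z) (u' *s g.f' z) (g.f' z) = (- 2 * u' * hprod (g.f' z) (g z) / hprod (g z) (g z)) *s g.f' z"
    by (simp add: conn_def hprod_simps vec_eq_iff field_simps)
  then have c0: "fsh (g z) (embed k (W a)) (conn (g z) (u' *s g.f' z) (g.f' z)) = 0"
    using T0[OF B(2)] by (simp add: fsh_simps a\<alpha>)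
  have cov: "embed k (cov_deriv (pullback (chart k)) W a \<xi>)
     = embed k (D W a \<xi>) + conn (g z) (u' *s g.f' z) (embed k (W a))"
    by (simp add: cov_deriv_def embed_simps christoffel_chart \<xi>' emb a\<alpha> hp[OF zU'])
  have main: "fsh (g z) (embed k (cov_deriv (pullback (chart k)) W a \<xi>)) (g.f' z)
      = - (cnj u' * fsh (g z) (embed k (W a)) (g.f'' z))"
    using e c0 unfolding cov by (simp add: fsh_simps add_eq_0_iff2)
  have v: "D (chart k) a (W a) = D line_of (g z) (embed k (W a))"
    by (simp add: D_chart a\<alpha> hp[OF zU'])
  have "D (chart k) a (W a) \<in> normal_space S (\<gamma> z)"
    using normal N image_in_S[OF z] a by metis
  note o = normal_orthogonal[OF z this]
  have "fs (D (chart k) a (cov_deriv (pullback (chart k)) W a \<xi>)) (D \<gamma> z u)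
     = Re (cnj u * fsh (g z) (embed k (cov_deriv (pullback (chart k)) W a \<xi>)) (g.f' z))"
    by (simp add: D_chart a\<alpha> hp[OF zU'] g.D_\<gamma>[OF zU'] fs_D_line_of g.nonzero[OF zU'] fsh_simps)
  also have "\<dots> = - Re (fsh (g z) (embed k (W a)) ((u' * u) *s g.f'' z))"
    unfolding main fsh_simps by (simp add: mult_ac)
  also have "\<dots> = - fs (D (chart k) a (W a)) (D line_of (g z) ((u' * u) *s g.f'' z))"
    unfolding v by (simp add: fs_D_line_of g.nonzero[OF zU'])
  also have "\<dots> = - fs (D (chart k) a (W a)) (D line_of (f z) ((u' * u) *s f'' z))"
    by (simp only: nl4[OF zU' o])
  finally show ?thesis .
qed

end

section \<open>Orthonormal bases and the determinant of the shape operator\<close>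

lemma leibniz_det_2:
  assumes "a \<noteq> b"
  shows "leibniz_det {a, b} m = m a a * m b b - m a b * m b a"
proof -
  have "leibniz_det {a, b} m =
      (\<Sum>\<pi> | \<pi> permutes {b}. of_int (sign \<pi>) * (\<Prod>c\<in>{a, b}. m c (\<pi> c)))
    + (\<Sum>\<pi> | \<pi> permutes {b}. of_int (sign (Transposition.transpose a b \<circ> \<pi>)) *
        (\<Prod>c\<in>{a, b}. m c ((Transposition.transpose a b \<circ> \<pi>) c)))"
    unfolding leibniz_det_def using assms by (subst sum_over_permutations_insert) (auto simp: transpose_same)
  also have "{\<pi>. \<pi> permutes {b}} = {id}" by (auto simp: permutes_sing)
  finally show ?thesis using assms by (simp add: sign_swap_id)
qed

text \<open>\<open>orthonormal_basis\<close> is a \<open>SOME\<close>; every possible choice has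
  this form, and it is all that determinants and fibre measures need to know about it.\<close>

lemma orthonormal_basis_conformal:
  fixes L :: "complex \<Rightarrow> cmat"
  assumes L: "linear L" and r: "r > 0" and fs: "\<And>u v. fs (L u) (L v) = r * Re (u * cnj v)"
  obtains u1 u2 where "orthonormal_basis (range L) = {L u1, L u2}" "L u1 \<noteq> L u2"
    "r * (cmod u1)\<^sup>2 = 1" "u2 = \<i> * u1 \<or> u2 = - \<i> * u1"
proof -
  let ?T = "range L"
  define P where "P B \<longleftrightarrow> span B = ?T \<and> (\<forall>b\<in>B. \<forall>c\<in>B. fs b c = (if b = c then 1 else 0))" for B
  have T: "subspace ?T" by (rule linear_subspace_image[OF L subspace_UNIV])
  have two: "finite B \<and> card B = dim ?T" if "P B" for B
  proof -
    have "pairwise orthogonal B"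
      using that by (auto simp: P_def pairwise_def orthogonal_def fs_def)
    moreover have "0 \<notin> B" using that by (force simp: P_def fs_def)
    ultimately have i: "independent B" by (rule pairwise_orthogonal_independent)
    have "finite B" using i by (rule independent_imp_finite)
    moreover have "span B = ?T" using that by (simp add: P_def)
    ultimately show ?thesis using dim_span_eq_card_independent[OF i] by simp
  qed
  \<comment> \<open>Normalized so that L a has length 1; with \<i> a it shows that an orthonormal
    basis exists and that the dimension is 2.\<close>
  define a where "a = complex_of_real (1 / sqrt r)"
  have a: "r * (cmod a)\<^sup>2 = 1" using r by (simp add: a_def norm_divide power_divide)
  have ra: "r * Re (a * cnj a) = 1" "r * Re (\<i> * a * cnj (\<i> * a)) = 1" "Re (a * cnj (\<i> * a)) = 0" "Re (\<i> * a * cnj a) = 0"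
    using a unfolding cmod_power2 by (simp_all add: a_def power2_eq_square)
  have ne: "L a \<noteq> L (\<i> * a)" using fs[of a a] fs[of a "\<i> * a"] ra by auto
  have "P {L a, L (\<i> * a)}"
  proof -
    have "span {L a, L (\<i> * a)} = ?T"
    proof
      show "span {L a, L (\<i> * a)} \<subseteq> ?T" by (rule span_minimal[OF _ T]) auto
      show "?T \<subseteq> span {L a, L (\<i> * a)}"
      proof
        fix x assume "x \<in> ?T"
        then obtain u where u: "x = L u" by blast
        have "u = (Re u * sqrt r) *\<^sub>R a + (Im u * sqrt r) *\<^sub>R (\<i> * a)"
          using r by (simp add: a_def complex_eq_iff)
        then have "x = (Re u * sqrt r) *\<^sub>R L a + (Im u * sqrt r) *\<^sub>R L (\<i> * a)"
          unfolding u by (metis linear_add[OF L] linear_scale[OF L])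
        then show "x \<in> span {L a, L (\<i> * a)}"
          by (simp add: span_add span_scale span_base)
      qed
    qed
    moreover have "fs (L a) (L a) = 1" "fs (L (\<i> * a)) (L (\<i> * a)) = 1"
      "fs (L a) (L (\<i> * a)) = 0" "fs (L (\<i> * a)) (L a) = 0"
      by (simp_all only: fs ra mult_zero_right)
    ultimately show ?thesis unfolding P_def using ne ne[symmetric] by simp
  qed
  then have dim: "dim ?T = 2" using two ne by fastforce
  have B: "P (orthonormal_basis ?T)"
    unfolding orthonormal_basis_def P_def[symmetric] using \<open>P {L a, L (\<i> * a)}\<close> by (rule someI)
  then obtain b1 b2 where b: "orthonormal_basis ?T = {b1, b2}" "b1 \<noteq> b2"
    using two[OF B] dim by (auto simp: card_2_iff)
  have "b1 \<in> ?T" "b2 \<in> ?T"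
    using B b span_superset[of "{b1, b2}"] by (auto simp: P_def)
  then obtain u1 u2 where u: "b1 = L u1" "b2 = L u2" by blast
  have f: "fs b1 b1 = 1" "fs b2 b2 = 1" "fs b2 b1 = 0" using B b by (auto simp: P_def)
  have n: "r * (cmod u1)\<^sup>2 = 1" "r * (cmod u2)\<^sup>2 = 1"
    using f(1,2) unfolding u fs cmod_power2 by (simp_all add: power2_eq_square)
  have u1: "u1 \<noteq> 0" using n by auto
  \<comment> \<open>Both vectors have the same length, so w has modulus 1; orthogonality makes its
    real part 0.\<close>
  define w where "w = u2 / u1"
  have w: "u2 = w * u1" using u1 by (simp add: w_def)
  have "cmod w = 1"
  proof -
    have "(cmod u1)\<^sup>2 = (cmod u2)\<^sup>2" using n r by (metis mult_cancel_left less_irrefl)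
    then have "cmod w = cmod u1 / cmod u1" by (simp add: w_def norm_divide)
    then show ?thesis using u1 by simp
  qed
  moreover have "Re w = 0"
  proof -
    have "u2 * cnj u1 = w * of_real ((cmod u1)\<^sup>2)" by (simp only: w complex_norm_square mult.assoc)
    then have "Re (u2 * cnj u1) = Re w * (cmod u1)\<^sup>2" by (simp only: Re_complex_of_real times_complex.sel Im_complex_of_real mult_zero_right diff_0_right)
    then show ?thesis using f(3) r u1 unfolding u fs by simp
  qed
  ultimately have "Im w = 1 \<or> Im w = - 1" by (simp add: cmod_def abs_if split: if_splits)
  then have "w = \<i> \<or> w = - \<i>" using \<open>Re w = 0\<close> by (auto simp: complex_eq_iff)
  then show thesis using that[of u1 u2] b u n w by auto
qed

context curve_piece
begin

abbreviation "\<kappa> z \<equiv> norm (f z) ^ 6 * (cmod (d z))\<^sup>2 / norm (F z) ^ 6"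

text \<open>Without an admissible field the \<open>THE\<close> in \<open>shape_operator\<close>
  would describe nothing. The normal field c n along the piece is extended off it by making it
  depend on the single chart coordinate that parametrizes the piece.\<close>

lemma normal_extension:
  assumes z: "z \<in> U" and v: "v \<in> normal_space S (\<gamma> z)"
  shows "\<exists>k N a W. open N \<and> a \<in> N \<and> chart k a = \<gamma> z \<and> W differentiable_on N \<and>
     (\<forall>b\<in>N. chart k b \<in> S \<longrightarrow> D (chart k) b (W b) \<in> normal_space S (chart k b)) \<and>
     D (chart k) a (W a) = v"
proof -
  obtain c where c: "v = normal z c" using v unfolding normal_space_curve[OF z] by blast
  obtain k j B \<tau> where B: "open B" "z \<in> B" "B \<subseteq> U" "\<And>z. z \<in> B \<Longrightarrow> f z $ k \<noteq> 0"
    "open ((\<lambda>z. f z $ j / f z $ k) ` B)" "\<tau> holomorphic_on (\<lambda>z. f z $ j / f z $ k) ` B"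
    "\<And>z. z \<in> B \<Longrightarrow> \<tau> (f z $ j / f z $ k) = z" "openin (top_of_set S) (\<gamma> ` B)" "j \<noteq> k"
    by (rule local_inverse[OF z]) (rule that; assumption)
  obtain T where T: "open T" "\<gamma> ` B = S \<inter> T" using B(8) by (auto simp: openin_open)
  let ?\<phi> = "\<lambda>z. f z $ j / f z $ k"
  define g where "g \<zeta> = (1 / f \<zeta> $ k) *s f \<zeta>" for \<zeta>
  \<comment> \<open>The multiple of g makes coordinate k vanish, so that the vector lies in the
    chart, and projects to 0; the division by f_k matches the passage from the lift f to g.\<close>
  define X where "X \<zeta> = omit k ((c / f \<zeta> $ k) *s (n \<zeta> - (n \<zeta> $ k) *s g \<zeta>))" for \<zeta>
  define W where "W b = X (\<tau> (hpoint k b $ j))" for b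
  \<comment> \<open>The factor T ensures that every point of S in this chart domain lies on the
    piece, where W is normal by construction.\<close>
  define N where "N = (\<lambda>b. hpoint k b $ j) -` (?\<phi> ` B) \<inter> chart k -` T"
  have gk: "g \<zeta> $ k = 1" if "\<zeta> \<in> B" for \<zeta> using B(4)[OF that] by (simp add: g_def)
  have g_lift: "line_of (g \<zeta>) = \<gamma> \<zeta>" if "\<zeta> \<in> B" for \<zeta>
    using B(4)[OF that] B(3) that by (auto simp: g_def line_of_smult lift)
  have eq: "hpoint k b = g \<zeta>" if "chart k b = \<gamma> \<zeta>" "\<zeta> \<in> B" for b \<zeta>
    using that by (intro line_of_inj_normalized[of _ _ k]) (simp_all add: g_lift chart_def hpoint_nth gk)
  have emb: "embed k (X \<zeta>) = (c / f \<zeta> $ k) *s (n \<zeta> - (n \<zeta> $ k) *s g \<zeta>)" if "\<zeta> \<in> B" for \<zeta>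
    unfolding X_def by (rule embed_omit) (simp add: gk[OF that])
  have DW: "D (chart k) b (W b) = normal \<zeta> c" if b: "chart k b = \<gamma> \<zeta>" and \<zeta>: "\<zeta> \<in> B" for b \<zeta>
  proof -
    have \<zeta>U: "\<zeta> \<in> U" and nk: "f \<zeta> $ k \<noteq> 0" using B(3,4) \<zeta> by auto
    have "\<tau> (hpoint k b $ j) = \<zeta>"
      using B(7)[OF \<zeta>] by (simp add: eq[OF b \<zeta>] g_def)
    then have "D (chart k) b (W b) = D line_of (g \<zeta>) (embed k (X \<zeta>))"
      by (simp add: D_chart W_def eq[OF b \<zeta>])
    also have "embed k (X \<zeta>) = (1 / f \<zeta> $ k) *s (c *s n \<zeta> - (c * (n \<zeta> $ k) / f \<zeta> $ k) *s f \<zeta>)"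
      using nk unfolding emb[OF \<zeta>] by (simp add: g_def vec_eq_iff field_simps)
    also have "D line_of (g \<zeta>) \<dots> = D line_of (f \<zeta>) (c *s n \<zeta> - (c * (n \<zeta> $ k) / f \<zeta> $ k) *s f \<zeta>)"
      unfolding g_def using nk nonzero[OF \<zeta>U] by (intro D_line_of_smult) auto
    also have "\<dots> = normal \<zeta> c"
      using nonzero[OF \<zeta>U] by (simp add: D_line_of_diff D_line_of_point)
    finally show ?thesis .
  qed
  have "open N"
    unfolding N_def
    by (intro open_Int open_vimage B(5) T(1) continuous_at_imp_continuous_on ballI
        has_derivative_continuous[OF bounded_linear.has_derivative[OF bounded_linear_vec_nth hpoint_has_derivative]]
        has_derivative_continuous[OF chart_has_derivative])
  moreover define a where "a = omit k (g z)"
  have a: "hpoint k a = g z" unfolding a_def by (rule hpoint_omit[OF gk[OF B(2)]])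
  then have ca: "chart k a = \<gamma> z" by (simp add: chart_def g_lift[OF B(2)])
  have "a \<in> N"
    using B(2) T by (auto simp: N_def a ca g_def)
  moreover have "D (chart k) b (W b) \<in> normal_space S (chart k b)" if "b \<in> N" "chart k b \<in> S" for b
  proof -
    have "chart k b \<in> \<gamma> ` B" using that T by (auto simp: N_def)
    then obtain \<zeta> where \<zeta>: "\<zeta> \<in> B" "chart k b = \<gamma> \<zeta>" by blast
    then show ?thesis
      using B(3) by (auto simp: DW[OF \<zeta>(2,1)] normal_space_curve)
  qed
  moreover have "D (chart k) a (W a) = v" by (simp add: DW[OF ca B(2)] c)
  moreover have "W differentiable_on N"
  proof (rule differentiable_at_imp_differentiable_on)
    fix b assume "b \<in> N"
    then obtain \<zeta> where \<zeta>: "hpoint k b $ j = ?\<phi> \<zeta>" "\<zeta> \<in> B" by (auto simp: N_def)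
    have \<zeta>U: "\<zeta> \<in> U" and nk: "f \<zeta> $ k \<noteq> 0" using B(3,4) \<zeta> by auto
    have fdiff: "f differentiable at \<zeta>" using f_deriv[OF \<zeta>U] by (rule differentiableI)
    have ndiff: "n differentiable at \<zeta>"
      using differentiableI[OF vderiv_has_derivative[OF F_holo open_U \<zeta>U]]
      by (rule bounded_linear_differentiable[OF bounded_linear_vcnj])
    have inv: "(\<lambda>\<zeta>. c' / f \<zeta> $ k) differentiable at \<zeta>" for c'
      by (intro differentiable_divide bounded_linear_differentiable[OF bounded_linear_vec_nth] fdiff differentiable_const nk)
    have "X differentiable at \<zeta>"
      unfolding X_def[abs_def] g_def[abs_def]
      by (intro bounded_linear_differentiable[OF bounded_linear_omit] smult_differentiable differentiable_diff
          inv ndiff fdiff bounded_linear_differentiable[OF bounded_linear_vec_nth])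
    moreover have "\<tau> differentiable at (hpoint k b $ j)"
      using holomorphic_on_imp_differentiable_at[OF B(6,5)] \<zeta>
      by (auto simp: field_differentiable_def has_field_derivative_def intro: differentiableI)
    moreover have "(\<lambda>b. hpoint k b $ j) differentiable at b"
      by (intro bounded_linear_differentiable[OF bounded_linear_vec_nth] differentiableI[OF hpoint_has_derivative])
    ultimately show "W differentiable at b"
      using differentiable_chain_at[of "\<lambda>b. \<tau> (hpoint k b $ j)" b X]
        differentiable_chain_at[of "\<lambda>b. hpoint k b $ j" b \<tau>] B(7)[OF \<zeta>(2)]
      by (simp add: o_def W_def[abs_def] \<zeta>(1))
  qed
  ultimately show ?thesis using ca by blast
qed

text \<open>The pairing depends on u' and u only through their product. It is therefore symmetric
  and changes sign when both are multiplied by \<i>: the operator is self-adjoint and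
  trace-free.\<close>

lemma shape_operator:
  assumes z: "z \<in> U" and v: "v \<in> normal_space S (\<gamma> z)"
  shows "shape_operator S (\<gamma> z) v (D \<gamma> z u') \<in> range (D \<gamma> z)"
    and "fs (shape_operator S (\<gamma> z) v (D \<gamma> z u')) (D \<gamma> z u) = fs v (D line_of (f z) ((u' * u) *s f'' z))"
proof -
  define Q where "Q y \<longleftrightarrow> (\<exists>\<psi>\<in>affine_charts. \<exists>N a W \<xi>.
        open N \<and> a \<in> N \<and> \<psi> a = \<gamma> z \<and> W differentiable_on N \<and>
        (\<forall>b\<in>N. \<psi> b \<in> S \<longrightarrow> D \<psi> b (W b) \<in> normal_space S (\<psi> b)) \<and>
        D \<psi> a (W a) = v \<and> D \<psi> a \<xi> = D \<gamma> z u' \<and>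
        y = - tangential_part S (\<gamma> z) (D \<psi> a (cov_deriv (pullback \<psi>) W a \<xi>)))" for y
  have Q: "y \<in> range (D \<gamma> z)" "fs y (D \<gamma> z u) = fs v (D line_of (f z) ((u' * u) *s f'' z))" if Qy: "Q y" for y u
  proof -
    obtain k N a W \<xi> where w: "open N" "a \<in> N" "chart k a = \<gamma> z" "W differentiable_on N"
        "\<forall>b\<in>N. chart k b \<in> S \<longrightarrow> D (chart k) b (W b) \<in> normal_space S (chart k b)"
        and vW: "D (chart k) a (W a) = v" and \<xi>: "D (chart k) a \<xi> = D \<gamma> z u'"
        and y: "y = - tangential_part S (\<gamma> z) (D (chart k) a (cov_deriv (pullback (chart k)) W a \<xi>))"
      using Qy unfolding Q_def affine_charts_eq by blast
    obtain s where s: "tangential_part S (\<gamma> z) (D (chart k) a (cov_deriv (pullback (chart k)) W a \<xi>)) = D \<gamma> z s"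
      using tangential_part(1)[OF z] by blast
    have "y = D \<gamma> z (- s)" by (simp add: y s linear_neg[OF linear_D[OF z]])
    then show "y \<in> range (D \<gamma> z)" by blast
    show "fs y (D \<gamma> z u) = fs v (D line_of (f z) ((u' * u) *s f'' z))"
      unfolding y fs_simps tangential_part(2)[OF z] shape_witness[OF z w \<xi>] vW by simp
  qed
  have "\<exists>y. Q y"
  proof -
    obtain k N a W where w: "open N" "a \<in> N" "chart k a = \<gamma> z" "W differentiable_on N"
        "\<forall>b\<in>N. chart k b \<in> S \<longrightarrow> D (chart k) b (W b) \<in> normal_space S (chart k b)"
        "D (chart k) a (W a) = v"
      using normal_extension[OF z v] by blast
    define U' where "U' = {\<zeta> \<in> U. f \<zeta> $ k \<noteq> 0}"
    define g where "g = (\<lambda>\<zeta>. (1 / f \<zeta> $ k) *s f \<zeta>)"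
    interpret g: lifted_curve U' g \<gamma> unfolding U'_def g_def by (rule normalized_lift)
    have "\<gamma> z $ k $ k \<noteq> 0"
      unfolding w(3)[symmetric] chart_def by (simp add: line_of_nth_eq_0_iff hpoint_nonzero hpoint_nth)
    then have zU': "z \<in> U'"
      using z nonzero[OF z] by (simp add: U'_def lift line_of_nth_eq_0_iff)
    have g2: "g z $ k = 1" "g.f' z $ k = 0"
      using normalized_lift(2,3)[of z k] zU' unfolding U'_def g_def by blast+
    have hp: "hpoint k a = g z"
      using w(3)[symmetric] by (intro line_of_inj_normalized[of _ _ k])
        (simp_all add: chart_def g.lift[OF zU'] hpoint_nth g2)
    have "embed k (omit k (u' *s g.f' z)) = u' *s g.f' z"
      by (rule embed_omit) (simp add: g2)
    then have "D (chart k) a (omit k (u' *s g.f' z)) = D \<gamma> z u'"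
      by (simp add: D_chart hp g.D_\<gamma>[OF zU'])
    then show ?thesis unfolding Q_def affine_charts_eq using w by blast
  qed
  then obtain y where y: "Q y" by blast
  have "shape_operator S (\<gamma> z) v (D \<gamma> z u') = y"
    unfolding shape_operator_def Q_def[symmetric]
  proof (rule the_equality)
    show "Q y" by (rule y)
    show "y' = y" if "Q y'" for y'
      by (rule tangent_eqI[OF z Q(1)[OF that] Q(1)[OF y]]) (simp only: Q(2)[OF that] Q(2)[OF y])
  qed
  then show "shape_operator S (\<gamma> z) v (D \<gamma> z u') \<in> range (D \<gamma> z)"
    "fs (shape_operator S (\<gamma> z) v (D \<gamma> z u')) (D \<gamma> z u) = fs v (D line_of (f z) ((u' * u) *s f'' z))"
    using Q[OF y] by auto
qed

text \<open>In a basis u, \<plusminus>\<i> u the operator has the matrix with diagonal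
  \<open>Q q\<close>, \<open>- Q q\<close> and off-diagonal entries
  \<plusminus>\<open>Q (\<i> * q)\<close>. Only the sum of squares of these two numbers
  enters.\<close>

lemma det_shape_operator:
  assumes z: "z \<in> U" and v: "v \<in> normal_space S (\<gamma> z)"
  shows "det_on (tangent_space S (\<gamma> z)) (\<lambda>x. C *\<^sub>R x - s *\<^sub>R shape_operator S (\<gamma> z) v x)
     = C\<^sup>2 - s\<^sup>2 * fs v v * \<kappa> z"
proof -
  obtain c where c: "v = normal z c" using v unfolding normal_space_curve[OF z] by blast
  obtain u1 u2 where u: "orthonormal_basis (range (D \<gamma> z)) = {D \<gamma> z u1, D \<gamma> z u2}"
    "D \<gamma> z u1 \<noteq> D \<gamma> z u2" "\<rho> z * (cmod u1)\<^sup>2 = 1" "u2 = \<i> * u1 \<or> u2 = - \<i> * u1"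
    by (rule orthonormal_basis_conformal[OF linear_D[OF z] \<rho>_pos[OF z] fs_D[OF z]])
  define q where "q = u1\<^sup>2 * d z"
  define Q where "Q w = Re (c * cnj w) / (norm (f z))\<^sup>2" for w
  have B: "fs (shape_operator S (\<gamma> z) v (D \<gamma> z a)) (D \<gamma> z b) = Q (a * b * d z)" for a b
  proof -
    have "cdet x y (w *s w') = w * cdet x y w'" for x y w w'
      by (simp add: cdet_def vcnj_def hprod_def sum_3 algebra_simps)
    then show ?thesis
      unfolding shape_operator(2)[OF z v] unfolding c fs_normal[OF z] Q_def by simp
  qed
  have e: "fs (C *\<^sub>R D \<gamma> z a - s *\<^sub>R shape_operator S (\<gamma> z) v (D \<gamma> z a)) (D \<gamma> z b)
      = C * (\<rho> z * Re (a * cnj b)) - s * Q (a * b * d z)" for a b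
    by (simp only: fs_simps B fs_D[OF z])
  have n1: "\<rho> z * Re (u1 * cnj u1) = 1"
    using u(3) by (simp only: complex_norm_square[symmetric] Re_complex_of_real)
  have n2: "\<rho> z * Re (u2 * cnj u2) = 1" "\<rho> z * Re (u1 * cnj u2) = 0" "\<rho> z * Re (u2 * cnj u1) = 0"
    using u(4) n1 by (auto simp: algebra_simps)
  have Qs: "Q (u1 * u1 * d z) = Q q" "Q (u2 * u2 * d z) = - Q q"
    "Q (u1 * u2 * d z) = Q (\<i> * q) \<or> Q (u1 * u2 * d z) = - Q (\<i> * q)"
    "Q (u2 * u1 * d z) = Q (u1 * u2 * d z)"
  proof -
    have Q_minus: "Q (- w) = - Q w" for w
      unfolding Q_def minus_divide_left by simp
    have "\<i> * u1 * (\<i> * u1) * d z = \<i> * \<i> * (u1 * u1 * d z)" by (simp only: mult_ac)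
    then have ii: "\<i> * u1 * (\<i> * u1) * d z = - (u1 * u1 * d z)" by simp
    have "u1 * u1 * d z = q" "u2 * u2 * d z = - q" "u2 * u1 * d z = u1 * u2 * d z"
      "u1 * u2 * d z = \<i> * q \<or> u1 * u2 * d z = - (\<i> * q)"
      using u(4) by (auto simp: q_def power2_eq_square ii)
    then show "Q (u1 * u1 * d z) = Q q" "Q (u2 * u2 * d z) = - Q q"
      "Q (u1 * u2 * d z) = Q (\<i> * q) \<or> Q (u1 * u2 * d z) = - Q (\<i> * q)"
      "Q (u2 * u1 * d z) = Q (u1 * u2 * d z)"
      by (auto simp only: Q_minus)
  qed
  have "det_on (tangent_space S (\<gamma> z)) (\<lambda>x. C *\<^sub>R x - s *\<^sub>R shape_operator S (\<gamma> z) v x)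
     = (C - s * Q q) * (C + s * Q q) - (s * Q (u1 * u2 * d z))\<^sup>2"
    unfolding det_on_def tangent_space_curve[OF z] u(1) leibniz_det_2[OF u(2)] e n1 n2 Qs
    by (simp add: power2_eq_square)
  also have "\<dots> = C\<^sup>2 - s\<^sup>2 * ((Q q)\<^sup>2 + (Q (\<i> * q))\<^sup>2)"
    using Qs(3) by (auto simp: power2_eq_square algebra_simps)
  \<comment> \<open>Up to the factor in \<open>Q\<close> and a sign, the two values are the real and
    imaginary parts of c times the conjugate of q.\<close>
  also have "(Q q)\<^sup>2 + (Q (\<i> * q))\<^sup>2 = (cmod c)\<^sup>2 * (cmod q)\<^sup>2 / norm (f z) ^ 4"
  proof -
    have "norm (f z) ^ 4 = ((norm (f z))\<^sup>2)\<^sup>2" by (simp flip: power_mult)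
    then show ?thesis unfolding cmod_power2 Q_def
      by (simp add: power_divide add_divide_distrib[symmetric]) (simp add: power2_eq_square algebra_simps)
  qed
  also have "\<dots> = fs v v * \<kappa> z"
  proof -
    have m: "(cmod q)\<^sup>2 = ((cmod u1)\<^sup>2)\<^sup>2 * (cmod (d z))\<^sup>2"
      by (simp add: q_def norm_mult norm_power power_mult_distrib)
    have nz: "norm (F z) \<noteq> 0" "norm (f z) \<noteq> 0" using F_nonzero[OF z] nonzero[OF z] by auto
    have u1: "(cmod u1)\<^sup>2 = norm (f z) ^ 4 / (norm (F z))\<^sup>2"
      using u(3) nz by (simp add: field_simps)
    have vv: "fs v v = (cmod c)\<^sup>2 * ((norm (F z))\<^sup>2 / (norm (f z))\<^sup>2)"
      unfolding c fs_normal_normal[OF z] cmod_power2 by (simp add: power2_eq_square)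
    have "C * ((Y ^ 4 / X\<^sup>2)\<^sup>2 * K) / Y ^ 4 = C * (X\<^sup>2 / Y\<^sup>2) * (Y ^ 6 * K / X ^ 6)"
      if "X \<noteq> 0" "Y \<noteq> 0" for C X Y K :: real
      using that by (simp add: divide_simps power2_eq_square eval_nat_numeral)
    from this[OF nz] show ?thesis unfolding m u1 vv .
  qed
  finally show ?thesis by (simp add: mult.assoc)
qed

end

text \<open>The determinant with C = 0 and s = 1, at a nonzero normal vector, refers to S and the
  point only. Comparing its values in two parametrizations replaces a transformation rule for the
  curvature.\<close>

lemma (in curve_piece) \<kappa>_unique:
  assumes z: "z \<in> U" and c: "curve_piece U2 f2 \<gamma>2 S" and z2: "z2 \<in> U2" "\<gamma>2 z2 = \<gamma> z"
  shows "sectional_curvature (pullback \<gamma>2) z2 1 \<i> = 4 - 2 * \<kappa> z"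
proof -
  interpret c: curve_piece U2 f2 \<gamma>2 S by (rule c)
  let ?v = "normal z 1"
  have v: "?v \<in> normal_space S (\<gamma> z)" unfolding normal_space_curve[OF z] by blast
  have "fs ?v ?v > 0"
    unfolding fs_normal_normal[OF z] using F_nonzero[OF z] nonzero[OF z] by simp
  moreover have "0\<^sup>2 - 1\<^sup>2 * fs ?v ?v * c.\<kappa> z2 = 0\<^sup>2 - 1\<^sup>2 * fs ?v ?v * \<kappa> z"
    by (rule trans[OF sym[OF c.det_shape_operator[OF z2(1), unfolded z2(2), OF v]]
          det_shape_operator[OF z v]])
  moreover have "b = c" if "0 < a" "0\<^sup>2 - 1\<^sup>2 * a * b = 0\<^sup>2 - 1\<^sup>2 * a * c" for a b c :: real
    using that by simp
  ultimately have "c.\<kappa> z2 = \<kappa> z" by blast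
  then show ?thesis using c.curvature[OF z2(1)] by simp
qed

lemma (in curve_piece) gauss_curvature:
  assumes z: "z \<in> U" and h: "holo_param S U \<gamma>"
  shows "gauss_curvature S (\<gamma> z) = 4 - 2 * \<kappa> z"
  unfolding gauss_curvature_def
proof (rule the_equality)
  show "\<exists>U' \<gamma>' z'. holo_param S U' \<gamma>' \<and> z' \<in> U' \<and> \<gamma>' z' = \<gamma> z \<and>
      4 - 2 * \<kappa> z = sectional_curvature (pullback \<gamma>') z' 1 \<i>"
    using h z curvature[OF z] by metis
next
  fix K assume "\<exists>U' \<gamma>' z'. holo_param S U' \<gamma>' \<and> z' \<in> U' \<and> \<gamma>' z' = \<gamma> z \<and>
      K = sectional_curvature (pullback \<gamma>') z' 1 \<i>"
  then show "K = 4 - 2 * \<kappa> z"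
    using \<kappa>_unique[OF z] holo_param_imp_curve_piece by metis
qed

section \<open>Lebesgue measure on the complex plane\<close>

text \<open>Such a map only permutes coordinates, so preimages of boxes are boxes with the same side
  lengths. It identifies complex spaces with products of smaller ones.\<close>

lemma lborel_distr_basis:
  fixes \<phi> :: "'a::euclidean_space \<Rightarrow> 'b::euclidean_space"
  assumes lin: "linear \<phi>" and bas: "\<phi> ` Basis = Basis" and dim: "DIM('a) = DIM('b)"
  shows "distr lborel borel \<phi> = lborel"
proof -
  have inj: "inj_on \<phi> Basis"
    by (rule eq_card_imp_inj_on) (simp_all add: bas dim)
  have \<phi>_inner: "\<phi> x \<bullet> \<phi> b = x \<bullet> b" if b: "b \<in> Basis" for x b
  proof -
    have "\<phi> x = (\<Sum>b\<in>Basis. (x \<bullet> b) *\<^sub>R \<phi> b)"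
      by (subst euclidean_representation[of x, symmetric])
        (simp only: linear_sum[OF lin] linear_scale[OF lin])
    then have "\<phi> x \<bullet> \<phi> b = (\<Sum>c\<in>Basis. (x \<bullet> c) * (\<phi> c \<bullet> \<phi> b))"
      by (simp add: inner_sum_left)
    also have "(\<Sum>c\<in>Basis. (x \<bullet> c) * (\<phi> c \<bullet> \<phi> b)) = (\<Sum>c\<in>Basis. if c = b then x \<bullet> c else 0)"
    proof (intro sum.cong refl)
      fix c :: 'a assume c: "c \<in> Basis"
      have "\<phi> c \<bullet> \<phi> b = (if c = b then 1 else 0)"
        using c b bas inj_on_eq_iff[OF inj c b] by (subst inner_Basis) auto
      then show "(x \<bullet> c) * (\<phi> c \<bullet> \<phi> b) = (if c = b then x \<bullet> c else 0)" by simp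
    qed
    finally show ?thesis using b by simp
  qed
  have meas: "\<phi> \<in> borel_measurable borel"
    using linear_continuous_on lin linear_conv_bounded_linear by (blast intro: borel_measurable_continuous_onI)
  show ?thesis
  proof (rule lborel_eqI[symmetric])
    fix l u :: 'b assume lu: "\<And>b. b \<in> Basis \<Longrightarrow> l \<bullet> b \<le> u \<bullet> b"
    \<comment> \<open>The transpose of \<phi>, giving the corners of the preimage box.\<close>
    let ?\<psi> = "\<lambda>y. \<Sum>b\<in>Basis. (y \<bullet> \<phi> b) *\<^sub>R b"
    have \<psi>: "?\<psi> y \<bullet> b = y \<bullet> \<phi> b" if "b \<in> Basis" for y b
      using that by (simp add: inner_sum_left inner_Basis if_distrib cong: if_cong)
    have "\<phi> -` box l u = box (?\<psi> l) (?\<psi> u)"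
    proof (intro set_eqI)
      fix x
      have "x \<in> \<phi> -` box l u \<longleftrightarrow> (\<forall>b\<in>\<phi> ` Basis. l \<bullet> b < \<phi> x \<bullet> b \<and> \<phi> x \<bullet> b < u \<bullet> b)"
        by (simp only: vimage_eq mem_box bas)
      also have "\<dots> \<longleftrightarrow> x \<in> box (?\<psi> l) (?\<psi> u)"
        by (simp add: mem_box \<psi> \<phi>_inner)
      finally show "x \<in> \<phi> -` box l u \<longleftrightarrow> x \<in> box (?\<psi> l) (?\<psi> u)" .
    qed
    then have "emeasure (distr lborel borel \<phi>) (box l u) = emeasure lborel (box (?\<psi> l) (?\<psi> u))"
      using meas by (simp add: emeasure_distr)
    also have "\<dots> = ennreal (\<Prod>b\<in>Basis. (?\<psi> u - ?\<psi> l) \<bullet> b)"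
      by (rule emeasure_lborel_box) (use lu bas \<psi> in auto)
    also have "(\<Prod>b\<in>Basis. (?\<psi> u - ?\<psi> l) \<bullet> b) = (\<Prod>b\<in>Basis. (u - l) \<bullet> \<phi> b)"
      by (intro prod.cong refl) (simp only: inner_diff_left \<psi>)
    also have "\<dots> = prod ((\<bullet>) (u - l)) (\<phi> ` Basis)"
      by (simp add: prod.reindex[OF inj])
    finally show "emeasure (distr lborel borel \<phi>) (box l u) = ennreal (prod ((\<bullet>) (u - l)) Basis)"
      by (simp only: bas)
  qed simp
qed

lemma nn_integral_lborel_basis:
  fixes \<phi> :: "'a::euclidean_space \<Rightarrow> 'b::euclidean_space"
  assumes lin: "linear \<phi>" and bas: "\<phi> ` Basis = Basis" and dim: "DIM('a) = DIM('b)"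
    and g: "g \<in> borel_measurable borel"
  shows "(\<integral>\<^sup>+ x. g (\<phi> x) \<partial>lborel) = (\<integral>\<^sup>+ y. g y \<partial>lborel)"
proof -
  have meas: "\<phi> \<in> borel_measurable borel"
    using linear_continuous_on lin linear_conv_bounded_linear by (blast intro: borel_measurable_continuous_onI)
  have "(\<integral>\<^sup>+ y. g y \<partial>lborel) = (\<integral>\<^sup>+ y. g y \<partial>distr lborel borel \<phi>)"
    by (simp only: lborel_distr_basis[OF lin bas dim])
  also have "\<dots> = (\<integral>\<^sup>+ x. g (\<phi> x) \<partial>lborel)"
    by (rule nn_integral_distr) (use meas g in auto)
  finally show ?thesis by simp
qed

lemma nn_integral_lborel_pair:
  fixes g :: "'a::euclidean_space \<times> 'b::euclidean_space \<Rightarrow> ennreal"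
  assumes "g \<in> borel_measurable borel"
  shows "(\<integral>\<^sup>+ p. g p \<partial>lborel) = (\<integral>\<^sup>+ x. \<integral>\<^sup>+ y. g (x, y) \<partial>lborel \<partial>lborel)"
  by (subst lborel_prod[symmetric], rule lborel.nn_integral_fst[symmetric]) (simp add: lborel_prod assms)

lemma nn_integral_lborel_swap:
  fixes g :: "'a::euclidean_space \<times> 'b::euclidean_space \<Rightarrow> ennreal"
  assumes "g \<in> borel_measurable borel"
  shows "(\<integral>\<^sup>+ x. \<integral>\<^sup>+ y. g (x, y) \<partial>lborel \<partial>lborel) = (\<integral>\<^sup>+ y. \<integral>\<^sup>+ x. g (x, y) \<partial>lborel \<partial>lborel)"
  using lborel_pair.Fubini[of g] assms by (simp add: lborel_prod)

lemma nn_integral_lborel_complex: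
  fixes g :: "complex \<Rightarrow> ennreal"
  assumes g: "g \<in> borel_measurable borel"
  shows "(\<integral>\<^sup>+ z. g z \<partial>lborel) = (\<integral>\<^sup>+ x. \<integral>\<^sup>+ y. g (of_real x + \<i> * of_real y) \<partial>lborel \<partial>lborel)"
proof -
  let ?\<phi> = "\<lambda>p :: real \<times> real. complex_of_real (fst p) + \<i> * of_real (snd p)"
  have c: "?\<phi> \<in> borel_measurable borel"
    by (intro borel_measurable_continuous_onI continuous_intros)
  have "(\<integral>\<^sup>+ z. g z \<partial>lborel) = (\<integral>\<^sup>+ p. g (?\<phi> p) \<partial>lborel)"
  proof (rule nn_integral_lborel_basis[symmetric, OF _ _ _ g])
    show "linear ?\<phi>" by (rule linearI) (simp_all add: algebra_simps scaleR_conv_of_real)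
    show "?\<phi> ` Basis = Basis" by (auto simp: Basis_prod_def Basis_complex_def image_Un)
  qed simp
  also have "\<dots> = (\<integral>\<^sup>+ x. \<integral>\<^sup>+ y. g (?\<phi> (x, y)) \<partial>lborel \<partial>lborel)"
    by (rule nn_integral_lborel_pair[OF measurable_compose[OF c g]])
  finally show ?thesis by simp
qed

text \<open>Multiplication by s = a + \<i> b is factored into one-dimensional affine substitutions,
  one for each real coordinate.\<close>

lemma nn_integral_complex_mult:
  fixes g :: "complex \<Rightarrow> ennreal"
  assumes g: "g \<in> borel_measurable borel" and s: "s \<noteq> 0"
  shows "(\<integral>\<^sup>+ z. g z \<partial>lborel) = ennreal ((cmod s)\<^sup>2) * (\<integral>\<^sup>+ z. g (s * z) \<partial>lborel)"
proof -
  let ?\<phi> = "\<lambda>x y. complex_of_real x + \<i> * of_real y"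
  define a b where "a = Re s" and "b = Im s"
  have [measurable]: "g \<in> borel_measurable borel" by (rule g)
  have c: "(\<lambda>p. g (?\<phi> (h p) (k p))) \<in> borel_measurable borel"
    if "continuous_on UNIV h" "continuous_on UNIV k" for h k :: "'c::euclidean_space \<Rightarrow> real"
    by (rule measurable_compose[OF borel_measurable_continuous_onI g]) (intro continuous_intros that)
  have sz: "s * ?\<phi> x y = ?\<phi> (a * x - b * y) (b * x + a * y)" for x y
    by (simp add: a_def b_def complex_eq_iff algebra_simps)
  have R: "(\<integral>\<^sup>+ z. g (s * z) \<partial>lborel) = (\<integral>\<^sup>+ x. \<integral>\<^sup>+ y. g (?\<phi> (a * x - b * y) (b * x + a * y)) \<partial>lborel \<partial>lborel)"
    unfolding sz[symmetric] by (rule nn_integral_lborel_complex) measurable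
  have ab: "(cmod s)\<^sup>2 = a\<^sup>2 + b\<^sup>2" by (simp add: a_def b_def cmod_power2)
  have "(\<integral>\<^sup>+ x. \<integral>\<^sup>+ y. g (?\<phi> x y) \<partial>lborel \<partial>lborel) = ennreal ((cmod s)\<^sup>2) *
     (\<integral>\<^sup>+ x. \<integral>\<^sup>+ y. g (?\<phi> (a * x - b * y) (b * x + a * y)) \<partial>lborel \<partial>lborel)"
  proof (cases "a = 0")
    case False
    \<comment> \<open>First y becomes k x + e y, then x becomes a x - b y. The new y must be b x + a
      y, which forces both constants; e is the Schur complement of a.\<close>
    define e k where "e = (a\<^sup>2 + b\<^sup>2) / a" and "k = b / a"
    have e: "e \<noteq> 0" "\<bar>e\<bar> * \<bar>a\<bar> = a\<^sup>2 + b\<^sup>2"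
      using False by (auto simp: e_def abs_mult[symmetric] add_nonneg_eq_0_iff)
    have 1: "(\<integral>\<^sup>+ y. g (?\<phi> x y) \<partial>lborel) = ennreal \<bar>e\<bar> * (\<integral>\<^sup>+ y. g (?\<phi> x (k * x + e * y)) \<partial>lborel)" for x
      by (rule nn_integral_real_affine[OF c]) (use e in \<open>auto intro!: continuous_intros\<close>)
    have 2: "(\<integral>\<^sup>+ x. g (?\<phi> x (k * x + e * y)) \<partial>lborel) =
        ennreal \<bar>a\<bar> * (\<integral>\<^sup>+ x. g (?\<phi> (a * x - b * y) (b * x + a * y)) \<partial>lborel)" for y
    proof -
      have "k * (- (b * y) + a * x) + e * y = b * x + a * y" for x
        using False by (simp add: e_def k_def field_simps power2_eq_square)
      then show ?thesis
        by (subst nn_integral_real_affine[OF c, of _ _ a "- (b * y)"])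
          (use False in \<open>auto intro!: continuous_intros simp: algebra_simps\<close>)
    qed
    have "(\<integral>\<^sup>+ x. \<integral>\<^sup>+ y. g (?\<phi> x y) \<partial>lborel \<partial>lborel)
        = (\<integral>\<^sup>+ x. \<integral>\<^sup>+ y. ennreal \<bar>e\<bar> * g (?\<phi> x (k * x + e * y)) \<partial>lborel \<partial>lborel)"
      unfolding 1 by (intro nn_integral_cong nn_integral_cmult[symmetric]) measurable
    also have "\<dots> = (\<integral>\<^sup>+ y. \<integral>\<^sup>+ x. ennreal \<bar>e\<bar> * g (?\<phi> x (k * x + e * y)) \<partial>lborel \<partial>lborel)"
      using nn_integral_lborel_swap[of "\<lambda>p. ennreal \<bar>e\<bar> * g (?\<phi> (fst p) (k * fst p + e * snd p))",
          OF borel_measurable_times_ennreal[OF borel_measurable_const c]]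
      by (simp add: continuous_intros)
    also have "\<dots> = (\<integral>\<^sup>+ y. ennreal \<bar>e\<bar> * (ennreal \<bar>a\<bar> * (\<integral>\<^sup>+ x. g (?\<phi> (a * x - b * y) (b * x + a * y)) \<partial>lborel)) \<partial>lborel)"
      unfolding 2[symmetric] by (intro nn_integral_cong nn_integral_cmult) measurable
    also have "\<dots> = (\<integral>\<^sup>+ y. ennreal ((cmod s)\<^sup>2) * (\<integral>\<^sup>+ x. g (?\<phi> (a * x - b * y) (b * x + a * y)) \<partial>lborel) \<partial>lborel)"
      unfolding ab e(2)[symmetric] by (simp add: ennreal_mult mult.assoc)
    also have "\<dots> = ennreal ((cmod s)\<^sup>2) * (\<integral>\<^sup>+ y. \<integral>\<^sup>+ x. g (?\<phi> (a * x - b * y) (b * x + a * y)) \<partial>lborel \<partial>lborel)"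
      by (intro nn_integral_cmult) measurable
    also have "(\<integral>\<^sup>+ y. \<integral>\<^sup>+ x. g (?\<phi> (a * x - b * y) (b * x + a * y)) \<partial>lborel \<partial>lborel)
       = (\<integral>\<^sup>+ x. \<integral>\<^sup>+ y. g (?\<phi> (a * x - b * y) (b * x + a * y)) \<partial>lborel \<partial>lborel)"
      using nn_integral_lborel_swap[of "\<lambda>p. g (?\<phi> (a * fst p - b * snd p) (b * fst p + a * snd p))", OF c]
      by (simp add: continuous_intros)
    finally show ?thesis .
  next
    case True
    \<comment> \<open>For purely imaginary s the two coordinates are exchanged, so Tonelli alone
      replaces the shear.\<close>
    then have b: "b \<noteq> 0" using s by (auto simp: a_def b_def complex_eq_iff)
    have 1: "(\<integral>\<^sup>+ y. g (?\<phi> x y) \<partial>lborel) = ennreal \<bar>b\<bar> * (\<integral>\<^sup>+ y. g (?\<phi> x (0 + b * y)) \<partial>lborel)" for x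
      by (rule nn_integral_real_affine[OF c]) (use b in \<open>auto intro!: continuous_intros\<close>)
    have 2: "(\<integral>\<^sup>+ x. g (?\<phi> x (b * y)) \<partial>lborel) = ennreal \<bar>- b\<bar> * (\<integral>\<^sup>+ x. g (?\<phi> (0 + - b * x) (b * y)) \<partial>lborel)" for y
      by (rule nn_integral_real_affine[OF c]) (use b in \<open>auto intro!: continuous_intros\<close>)
    have "(\<integral>\<^sup>+ x. \<integral>\<^sup>+ y. g (?\<phi> x y) \<partial>lborel \<partial>lborel)
        = (\<integral>\<^sup>+ x. \<integral>\<^sup>+ y. ennreal \<bar>b\<bar> * g (?\<phi> x (b * y)) \<partial>lborel \<partial>lborel)"
      unfolding 1 by (simp, intro nn_integral_cong nn_integral_cmult[symmetric]) measurable
    also have "\<dots> = (\<integral>\<^sup>+ y. \<integral>\<^sup>+ x. ennreal \<bar>b\<bar> * g (?\<phi> x (b * y)) \<partial>lborel \<partial>lborel)"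
      using nn_integral_lborel_swap[of "\<lambda>p. ennreal \<bar>b\<bar> * g (?\<phi> (fst p) (b * snd p))",
          OF borel_measurable_times_ennreal[OF borel_measurable_const c]]
      by (simp add: continuous_intros)
    also have "\<dots> = (\<integral>\<^sup>+ y. ennreal \<bar>b\<bar> * (ennreal \<bar>- b\<bar> * (\<integral>\<^sup>+ x. g (?\<phi> (0 + - b * x) (b * y)) \<partial>lborel)) \<partial>lborel)"
      unfolding 2[symmetric] by (intro nn_integral_cong nn_integral_cmult) measurable
    also have "\<dots> = (\<integral>\<^sup>+ y. ennreal ((cmod s)\<^sup>2) * (\<integral>\<^sup>+ x. g (?\<phi> (- (b * x)) (b * y)) \<partial>lborel) \<partial>lborel)"
    proof -
      have "ennreal \<bar>b\<bar> * (ennreal \<bar>- b\<bar> * x) = ennreal ((cmod s)\<^sup>2) * x" for x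
        unfolding ab True by (simp add: ennreal_mult[symmetric] mult.assoc[symmetric] power2_eq_square)
      then show ?thesis by simp
    qed
    also have "\<dots> = ennreal ((cmod s)\<^sup>2) * (\<integral>\<^sup>+ y. \<integral>\<^sup>+ x. g (?\<phi> (- (b * x)) (b * y)) \<partial>lborel \<partial>lborel)"
      by (intro nn_integral_cmult) measurable
    finally show ?thesis by (simp add: True)
  qed
  then show ?thesis unfolding R nn_integral_lborel_complex[OF g] .
qed

section \<open>Integration over the normal spaces\<close>

text \<open>The disc of radius sqrt a has area pi a, and half-lines generate the Borel sets. This
  takes the place of polar coordinates.\<close>

lemma distr_cmod_square:
  "distr lborel borel (\<lambda>z::complex. (cmod z)\<^sup>2) = density lborel (\<lambda>s. ennreal (pi * indicator {0..} s))"
  (is "?M = ?N")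
proof (rule measure_eqI_generator_eq[where E = "range (\<lambda>a::real. {..a})" and \<Omega> = UNIV and A = "\<lambda>i. {..real i}"])
  have m: "(\<lambda>z::complex. (cmod z)\<^sup>2) \<in> borel_measurable borel" by measurable
  have M: "emeasure ?M {..a} = ennreal (pi * max 0 a)" for a
  proof (cases "a < 0")
    case True
    then have "(\<lambda>z::complex. (cmod z)\<^sup>2) -` {..a} = {}"
      by (auto dest: order_trans[OF zero_le_power2])
    then show ?thesis using True m by (simp add: emeasure_distr)
  next
    case False
    then have "(\<lambda>z::complex. (cmod z)\<^sup>2) -` {..a} = cball 0 (sqrt a)"
      using power_mono[of "cmod _" "sqrt a" 2] by (fastforce simp: real_le_rsqrt)
    then show ?thesis using False m
      by (simp add: emeasure_distr emeasure_cball unit_ball_vol_2 max_def)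
  qed
  have N: "emeasure ?N {..a} = ennreal (pi * max 0 a)" for a
  proof -
    have "emeasure ?N {..a} = (\<integral>\<^sup>+ s. ennreal pi * indicator {0..a} s \<partial>lborel)"
      by (subst emeasure_density) (auto intro!: nn_integral_cong simp: indicator_def)
    also have "\<dots> = ennreal (pi * max 0 a)"
      by (cases "0 \<le> a") (auto simp: nn_integral_cmult ennreal_mult[symmetric] max_def)
    finally show ?thesis .
  qed
  show "emeasure ?M X = emeasure ?N X" if "X \<in> range (\<lambda>a::real. {..a})" for X
    using that M N by auto
  show "emeasure ?M {..real i} \<noteq> \<infinity>" for i by (simp add: M)
  show "Int_stable (range (\<lambda>a::real. {..a}))"
    by (auto simp: Int_stable_def)
  show "(\<Union>i. {..real i}) = UNIV" using real_arch_simple by auto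
  show "sets ?M = sigma_sets UNIV (range (\<lambda>a::real. {..a}))"
    "sets ?N = sigma_sets UNIV (range (\<lambda>a::real. {..a}))"
    by (simp_all add: borel_eq_atMost)
qed auto

lemma nn_integral_radial:
  fixes g :: "real \<Rightarrow> ennreal"
  assumes g: "g \<in> borel_measurable borel"
  shows "(\<integral>\<^sup>+ z. g ((cmod z)\<^sup>2) \<partial>lborel) = ennreal pi * (\<integral>\<^sup>+ s. g s * indicator {0..} s \<partial>lborel)"
proof -
  have "(\<integral>\<^sup>+ z. g ((cmod z)\<^sup>2) \<partial>lborel) = (\<integral>\<^sup>+ s. g s \<partial>distr lborel borel (\<lambda>z::complex. (cmod z)\<^sup>2))"
    by (rule nn_integral_distr[symmetric]) (use g in auto)
  also have "\<dots> = (\<integral>\<^sup>+ s. ennreal (pi * indicator {0..} s) * g s \<partial>lborel)"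
    unfolding distr_cmod_square by (rule nn_integral_density) (use g in auto)
  also have "\<dots> = (\<integral>\<^sup>+ s. ennreal pi * (g s * indicator {0..} s) \<partial>lborel)"
    by (intro nn_integral_cong) (auto simp: indicator_def)
  also have "\<dots> = ennreal pi * (\<integral>\<^sup>+ s. g s * indicator {0..} s \<partial>lborel)"
    by (rule nn_integral_cmult) (use g in auto)
  finally show ?thesis .
qed

lemma sinc_mult: "sinc r * r = sin r"
  by simp

text \<open>The factor \<open>(sinc r)\<^sup>2 * r\<^sup>2\<close> is left uncombined so as to match
  the determinant, where the square of \<open>sinc r\<close> meets \<open>fs v v\<close>.\<close>

definition tube_weight :: "real \<Rightarrow> real \<Rightarrow> real" where
  "tube_weight \<kappa> r = indicator {..<pi / 2} r * (\<bar>(cos r)\<^sup>2 - (sinc r)\<^sup>2 * r\<^sup>2 * \<kappa>\<bar> * cos r * sinc r)"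

text \<open>With \<open>a = 1 + \<kappa>\<close> and \<open>u = sin\<^sup>2 r\<close>, \<open>r = \<surd>s\<close>, the weight becomes \<open>\<bar>1 - a u\<bar> du/ds\<close>.\<close>

lemma nn_integral_tube_weight:
  assumes \<kappa>: "\<kappa> \<ge> 0"
  shows "(\<integral>\<^sup>+ z. ennreal (tube_weight \<kappa> (cmod z)) \<partial>lborel) = ennreal (pi * (1 + \<kappa>\<^sup>2) / (2 * (1 + \<kappa>)))"
proof -
  define a where "a = 1 + \<kappa>"
  have a: "a > 0" using \<kappa> by (simp add: a_def)
  \<comment> \<open>The end r = pi/2 in terms of s, the square of r.\<close>
  define b where "b = (pi / 2)\<^sup>2"
  have b: "0 \<le> b" "sqrt b = pi / 2" by (simp_all add: b_def)
  \<comment> \<open>An antiderivative of \<bar>1 - a u\<bar> that vanishes at 0. At u = 1 the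
    quantity 1 - a u is - \<kappa>, and the absolute value turns its signed square into 1 +
    \<kappa>^2 in the numerator.\<close>
  define \<Phi> where "\<Phi> u = (1 - (1 - a * u) * \<bar>1 - a * u\<bar>) / (2 * a)" for u
  define h where "h s = \<bar>1 - a * (sin (sqrt s))\<^sup>2\<bar> * cos (sqrt s) * sinc (sqrt s)" for s
  have h_eq: "tube_weight \<kappa> (sqrt s) = (if s \<in> {0..b} then h s else 0)" if "0 \<le> s" for s
  proof -
    have "(cos (sqrt s))\<^sup>2 - (sinc (sqrt s))\<^sup>2 * (sqrt s)\<^sup>2 * \<kappa> = 1 - a * (sin (sqrt s))\<^sup>2"
      by (simp only: power_mult_distrib[symmetric] sinc_mult cos_squared_eq a_def) (simp add: algebra_simps)
    moreover have "sqrt s < pi / 2 \<longleftrightarrow> s < b"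
      unfolding b(2)[symmetric] by simp
    \<comment> \<open>The cosine vanishes at pi/2, which reconciles the open tube with the closed
      interval.\<close>
    moreover have "h b = 0" by (simp add: h_def b)
    ultimately show ?thesis using that by (auto simp: tube_weight_def h_def indicator_def)
  qed
  have abs_deriv: "((\<lambda>x. x * \<bar>x\<bar>) has_real_derivative 2 * \<bar>x\<bar>) (at x)" for x :: real
  proof (cases "x = 0")
    case False
    then consider "x > 0" | "x < 0" by linarith
    then show ?thesis
    proof cases
      case 1
      have "((\<lambda>x. x * x) has_real_derivative 2 * \<bar>x\<bar>) (at x)"
        using 1 by (auto intro!: derivative_eq_intros)
      then show ?thesis
        by (rule has_field_derivative_transform_within_open[of _ _ _ "{0<..}"]) (use 1 in auto)
    next
      case 2
      have "((\<lambda>x. - (x * x)) has_real_derivative 2 * \<bar>x\<bar>) (at x)"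
        using 2 by (auto intro!: derivative_eq_intros)
      then show ?thesis
        by (rule has_field_derivative_transform_within_open[of _ _ _ "{..<0}"]) (use 2 in auto)
    qed
  next
    case True
    have "((\<lambda>y::real. \<bar>y\<bar>) \<longlongrightarrow> \<bar>0\<bar>) (at 0)" by (intro tendsto_intros)
    then have "((\<lambda>y::real. y * \<bar>y\<bar> / y) \<longlongrightarrow> 0) (at 0)"
      by (subst tendsto_cong[of _ "\<lambda>y. \<bar>y\<bar>"]) (auto simp: eventually_at_filter)
    then show ?thesis using True by (simp add: has_field_derivative_iff)
  qed
  have \<Phi>': "(\<Phi> has_real_derivative \<bar>1 - a * u\<bar>) (at u)" for u
  proof -
    have "((\<lambda>u. (1 - a * u) * \<bar>1 - a * u\<bar>) has_real_derivative (2 * \<bar>1 - a * u\<bar>) * (- a)) (at u)"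
      by (rule DERIV_chain2[OF abs_deriv]) (auto intro!: derivative_eq_intros)
    from DERIV_cdivide[OF DERIV_diff[OF DERIV_const this], of 1 "2 * a"] show ?thesis
      unfolding \<Phi>_def[abs_def] using a by (simp add: field_simps)
  qed
  have "(h has_integral \<Phi> ((sin (sqrt b))\<^sup>2) - \<Phi> ((sin (sqrt 0))\<^sup>2)) {0..b}"
  \<comment> \<open>The interior version, since the square root has no derivative at 0.\<close>
  proof (rule fundamental_theorem_of_calculus_interior[OF b(1)])
    have "continuous_on UNIV \<Phi>"
      using \<Phi>' DERIV_isCont by (blast intro: continuous_at_imp_continuous_on)
    then show "continuous_on {0..b} (\<lambda>s. \<Phi> ((sin (sqrt s))\<^sup>2))"
      by (rule continuous_on_compose2) (auto intro!: continuous_intros)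
    fix s assume "s \<in> {0<..<b}"
    then have s: "s > 0" by simp
    have "((\<lambda>s. (sin (sqrt s))\<^sup>2) has_real_derivative cos (sqrt s) * sinc (sqrt s)) (at s)"
      using s by (auto intro!: derivative_eq_intros simp: field_simps)
    from DERIV_chain2[OF \<Phi>' this]
    show "((\<lambda>s. \<Phi> ((sin (sqrt s))\<^sup>2)) has_vector_derivative h s) (at s)"
      unfolding h_def has_real_derivative_iff_has_vector_derivative[symmetric] by (simp add: mult.assoc)
  qed
  also have "\<Phi> ((sin (sqrt b))\<^sup>2) - \<Phi> ((sin (sqrt 0))\<^sup>2) = (1 + \<kappa>\<^sup>2) / (2 * (1 + \<kappa>))"
    using \<kappa> by (simp add: b(2) \<Phi>_def a_def power2_eq_square)
  finally have int: "((\<lambda>s. if s \<in> {0..b} then h s else 0) has_integral (1 + \<kappa>\<^sup>2) / (2 * (1 + \<kappa>))) UNIV"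
    by (simp only: has_integral_restrict_UNIV)
  have sinc_nonneg: "0 \<le> sinc r" if "0 \<le> r" "r \<le> pi / 2" for r
    using that by (auto intro!: divide_nonneg_nonneg sin_ge_zero)
  have nonneg: "0 \<le> (if s \<in> {0..b} then h s else 0)" for s
  proof (cases "s \<in> {0..b}")
    case True
    then have "0 \<le> sqrt s" "sqrt s \<le> pi / 2" unfolding b(2)[symmetric] by auto
    then have "0 \<le> cos (sqrt s)" "0 \<le> sinc (sqrt s)"
      using sinc_nonneg[of "sqrt s"] cos_ge_zero[of "sqrt s"] pi_gt_zero by linarith+
    then have "0 \<le> h s" unfolding h_def by (intro mult_nonneg_nonneg abs_ge_zero)
    then show ?thesis by simp
  qed auto
  have "(\<integral>\<^sup>+ s. ennreal (tube_weight \<kappa> (sqrt s)) * indicator {0..} s \<partial>lborel)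
      = (\<integral>\<^sup>+ s. ennreal (if s \<in> {0..b} then h s else 0) \<partial>lborel)"
    by (intro nn_integral_cong) (use h_eq in \<open>auto simp: indicator_def\<close>)
  also have "\<dots> = ennreal ((1 + \<kappa>\<^sup>2) / (2 * (1 + \<kappa>)))"
    by (rule nn_integral_has_integral_lborel[OF _ nonneg int])
      (unfold h_def, measurable)
  finally have I: "(\<integral>\<^sup>+ s. ennreal (tube_weight \<kappa> (sqrt s)) * indicator {0..} s \<partial>lborel) = ennreal ((1 + \<kappa>\<^sup>2) / (2 * (1 + \<kappa>)))" .
  have "(\<integral>\<^sup>+ z. ennreal (tube_weight \<kappa> (sqrt ((cmod z)\<^sup>2))) \<partial>lborel) = ennreal pi * ennreal ((1 + \<kappa>\<^sup>2) / (2 * (1 + \<kappa>)))"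
    unfolding I[symmetric] by (rule nn_integral_radial) (unfold tube_weight_def, measurable)
  then show ?thesis using \<kappa> by (simp add: ennreal_mult[symmetric])
qed

text \<open>The chosen basis is the image of u1 and \<plusminus>\<i> u1 with u1 of modulus 1, and
  planar Lebesgue measure is invariant under rotation by u1 and under reflection.\<close>

lemma lebesgue_of_subspace_isometry:
  fixes L :: "complex \<Rightarrow> cmat"
  assumes L: "linear L" and fs: "\<And>u v. fs (L u) (L v) = Re (u * cnj v)"
  shows "lebesgue_of_subspace (range L) = distr lborel borel L"
proof -
  obtain u1 u2 where u: "orthonormal_basis (range L) = {L u1, L u2}" "L u1 \<noteq> L u2"
    "1 * (cmod u1)\<^sup>2 = 1" "u2 = \<i> * u1 \<or> u2 = - \<i> * u1"
    by (rule orthonormal_basis_conformal[OF L zero_less_one]) (simp_all add: fs)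
  have u1: "u1 \<noteq> 0" "(cmod u1)\<^sup>2 = 1" using u(3) by auto
  have Lm [measurable]: "L \<in> borel_measurable borel"
    using L linear_continuous_on linear_conv_bounded_linear by (blast intro: borel_measurable_continuous_onI)
  interpret P: product_sigma_finite "\<lambda>_ :: cmat. lborel :: real measure" ..
  show ?thesis
  proof (rule measure_eqI)
    show "sets (lebesgue_of_subspace (range L)) = sets (distr lborel borel L)"
      by (simp add: lebesgue_of_subspace_def)
    fix A assume "A \<in> sets (lebesgue_of_subspace (range L))"
    then have A [measurable]: "A \<in> sets borel" by (simp add: lebesgue_of_subspace_def)
    let ?g = "\<lambda>z. indicator A (L z) :: ennreal"
    have g [measurable]: "?g \<in> borel_measurable borel" by measurable
    let ?s = "\<lambda>f. f (L u1) *\<^sub>R L u1 + f (L u2) *\<^sub>R L u2"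
    have sm [measurable]: "?s \<in> PiM {L u1, L u2} (\<lambda>_. lborel) \<rightarrow>\<^sub>M borel"
      by measurable
    have "emeasure (lebesgue_of_subspace (range L)) A
        = (\<integral>\<^sup>+ w. indicator A w \<partial>distr (PiM {L u1, L u2} (\<lambda>_. lborel)) borel ?s)"
      unfolding lebesgue_of_subspace_def u(1) using u(2) by simp
    also have "\<dots> = (\<integral>\<^sup>+ f. indicator A (?s f) \<partial>PiM {L u1, L u2} (\<lambda>_. lborel))"
      by (rule nn_integral_distr) auto
    also have "\<dots> = (\<integral>\<^sup>+ x. \<integral>\<^sup>+ f. indicator A (?s (f(L u1 := x))) \<partial>PiM {L u2} (\<lambda>_. lborel) \<partial>lborel)"
      by (rule P.product_nn_integral_insert_rev) (use u(2) in auto)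
    also have "\<dots> = (\<integral>\<^sup>+ x. \<integral>\<^sup>+ f. (\<lambda>y. ?g (of_real x * u1 + of_real y * u2)) (f (L u2)) \<partial>PiM {L u2} (\<lambda>_. lborel) \<partial>lborel)"
      using u(2) by (simp add: linear_add[OF L] linear_scale[OF L] flip: scaleR_conv_of_real)
    also have "\<dots> = (\<integral>\<^sup>+ x. \<integral>\<^sup>+ y. ?g (of_real x * u1 + of_real y * u2) \<partial>lborel \<partial>lborel)"
      by (intro nn_integral_cong P.product_nn_integral_singleton) measurable
    also have "\<dots> = (\<integral>\<^sup>+ x. \<integral>\<^sup>+ y. ?g (u1 * (of_real x + \<i> * of_real y)) \<partial>lborel \<partial>lborel)"
      using u(4)
    proof
      \<comment> \<open>The opposite orientation is undone by the substitution of -y for y.\<close>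
      assume "u2 = - \<i> * u1"
      then have "(\<integral>\<^sup>+ y. ?g (of_real x * u1 + of_real y * u2) \<partial>lborel)
         = (\<integral>\<^sup>+ y. ?g (u1 * (of_real x + \<i> * of_real y)) \<partial>lborel)" for x
        by (subst nn_integral_real_affine[where c = "-1" and t = 0]) (auto simp: algebra_simps)
      then show ?thesis by simp
    qed (simp add: algebra_simps)
    also have "\<dots> = (\<integral>\<^sup>+ z. ?g (u1 * z) \<partial>lborel)"
      by (rule nn_integral_lborel_complex[symmetric]) measurable
    also have "\<dots> = (\<integral>\<^sup>+ z. ?g z \<partial>lborel)"
      using nn_integral_complex_mult[OF g u1(1)] u1(2) by simp
    also have "\<dots> = emeasure (distr lborel borel L) A"
      by (subst nn_integral_distr[of L lborel borel "indicator A", symmetric]) auto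
    finally show "emeasure (lebesgue_of_subspace (range L)) A = emeasure (distr lborel borel L) A" .
  qed
qed

section \<open>The volume of the projective plane\<close>

lemma leibniz_det_4:
  assumes "distinct [a, b, c, e]"
  shows "leibniz_det {a, b, c, e} m =
    m a a * (m b b * (m c c * m e e - m c e * m e c) - m b c * (m c b * m e e - m c e * m e b)
      + m b e * (m c b * m e c - m c c * m e b))
  - m a b * (m b a * (m c c * m e e - m c e * m e c) - m b c * (m c a * m e e - m c e * m e a)
      + m b e * (m c a * m e c - m c c * m e a))
  + m a c * (m b a * (m c b * m e e - m c e * m e b) - m b b * (m c a * m e e - m c e * m e a)
      + m b e * (m c a * m e b - m c b * m e a))
  - m a e * (m b a * (m c b * m e c - m c c * m e b) - m b b * (m c a * m e c - m c c * m e a)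
      + m b c * (m c a * m e b - m c b * m e a))"
proof -
  have d: "a \<noteq> b" "a \<noteq> c" "a \<noteq> e" "b \<noteq> c" "b \<noteq> e" "c \<noteq> e"
    "b \<noteq> a" "c \<noteq> a" "e \<noteq> a" "c \<noteq> b" "e \<noteq> b" "e \<noteq> c" using assms by auto
  have s1: "finite {b, c, e}" "a \<notin> {b, c, e}" "finite {c, e}" "b \<notin> {c, e}" "finite {e}" "c \<notin> {e}"
    using d by auto
  show ?thesis
    unfolding leibniz_det_def
    unfolding sum_over_permutations_insert[OF s1(1,2)] sum_over_permutations_insert[OF s1(3,4)]
      sum_over_permutations_insert[OF s1(5,6)] permutes_sing
    by (simp add: d sign_swap_id permutation_swap_id permutation_compose sign_compose sign_id transpose_def)
      (simp add: algebra_simps)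
qed

lemma hprod_embed_hpoint:
  "hprod (embed k u) (hpoint k a) = hprod u a" "hprod (hpoint k a) (embed k u) = hprod a u"
  "hprod (hpoint k a) (hpoint k a) = of_real (1 + (norm a)\<^sup>2)"
proof -
  have e: "hprod (embed k u) (axis k 1) = 0" "hprod (axis k 1) (embed k u) = 0" for u
    using three_cases[of k] by (auto simp: hprod_def axis_def sum_3 embed_def)
  have f: "hprod (axis k 1) (axis k 1 :: complex ^ 3) = 1"
    using three_cases[of k] by (auto simp: hprod_def axis_def sum_3)
  show "hprod (embed k u) (hpoint k a) = hprod u a" "hprod (hpoint k a) (embed k u) = hprod a u"
    "hprod (hpoint k a) (hpoint k a) = of_real (1 + (norm a)\<^sup>2)"
    by (simp_all only: hpoint_def hprod_add_left hprod_add_right hprod_embed hprod_self[of a] e f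
        add_0_left add_0_right of_real_add of_real_1)
qed

lemma volume_density_chart:
  "volume_density (pullback (chart k)) a = 1 / (1 + (norm a)\<^sup>2) ^ 3"
proof -
  define h where "h = 1 + (norm a)\<^sup>2"
  have h: "h > 0" by (simp add: h_def add_pos_nonneg)
  have norm_a: "(norm a)\<^sup>2 = (cmod (a $ 1))\<^sup>2 + (cmod (a $ 2))\<^sup>2"
    by (simp add: norm_vec_def L2_set_def sum_2)
  define A E where "A = (1 + (cmod (a $ 2))\<^sup>2) / h\<^sup>2" and "E = (1 + (cmod (a $ 1))\<^sup>2) / h\<^sup>2"
  define B where "B = - cnj (a $ 1) * (a $ 2) / of_real (h\<^sup>2)"
  have g: "pullback (chart k) a u v = Re (hprod u v / of_real h - hprod u a * hprod a v / of_real (h\<^sup>2))" for u v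
    unfolding pullback_chart fsh_def hprod_embed hprod_embed_hpoint h_def of_real_power ..
  have diag: "complex_of_real (1 / h) - cnj (a $ 1) * a $ 1 / of_real (h\<^sup>2) = of_real A"
    "complex_of_real (1 / h) - cnj (a $ 2) * a $ 2 / of_real (h\<^sup>2) = of_real E"
  proof -
    have c: "cnj z * z = of_real ((cmod z)\<^sup>2)" for z
      by (simp only: complex_norm_square mult.commute)
    have "1 / h - (cmod (a $ 1))\<^sup>2 / h\<^sup>2 = A" "1 / h - (cmod (a $ 2))\<^sup>2 / h\<^sup>2 = E"
    proof -
      have 1: "1 / h = h / h\<^sup>2" using h by (simp add: power2_eq_square)
      have 2: "h - (cmod (a $ 1))\<^sup>2 = 1 + (cmod (a $ 2))\<^sup>2" "h - (cmod (a $ 2))\<^sup>2 = 1 + (cmod (a $ 1))\<^sup>2"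
        using norm_a by (simp_all add: h_def)
      show "1 / h - (cmod (a $ 1))\<^sup>2 / h\<^sup>2 = A" "1 / h - (cmod (a $ 2))\<^sup>2 / h\<^sup>2 = E"
        unfolding A_def E_def 1 diff_divide_distrib[symmetric] 2 by (rule refl)+
    qed
    then show "complex_of_real (1 / h) - cnj (a $ 1) * a $ 1 / of_real (h\<^sup>2) = of_real A"
      "complex_of_real (1 / h) - cnj (a $ 2) * a $ 2 / of_real (h\<^sup>2) = of_real E"
      unfolding c of_real_divide[symmetric] of_real_diff[symmetric] by auto
  qed
  have ax: "hprod (axis i x) (w :: complex ^ 2) = x * cnj (w $ i)" "hprod w (axis i x) = w $ i * cnj x" for i x w
    by (simp_all add: hprod_def axis_def if_distrib[of cnj] if_distrib[of "\<lambda>x. _ * x"] if_distrib[of "\<lambda>y. y * _"] cong: if_cong)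
  have m11: "pullback (chart k) a (axis 1 x) (axis 1 y) = Re (x * cnj y * of_real A)" for x y
    unfolding g ax diag(1)[symmetric] by (simp add: axis_def algebra_simps diff_divide_distrib)
  have m22: "pullback (chart k) a (axis 2 x) (axis 2 y) = Re (x * cnj y * of_real E)" for x y
    unfolding g ax diag(2)[symmetric] by (simp add: axis_def algebra_simps diff_divide_distrib)
  have m12: "pullback (chart k) a (axis 1 x) (axis 2 y) = Re (x * cnj y * B)" for x y
    unfolding g ax by (simp add: axis_def B_def mult_ac)
  have m21: "pullback (chart k) a (axis 2 x) (axis 1 y) = Re (x * cnj y * cnj B)" for x y
    unfolding g ax by (simp add: axis_def B_def mult_ac)
  have bas: "(Basis :: (complex ^ 2) set) = {axis 1 1, axis 1 \<i>, axis 2 1, axis 2 \<i>}"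
    by (auto simp: Basis_vec_def UNIV_2 Basis_complex_def)
  have dist: "distinct [axis 1 1, axis 1 \<i>, axis 2 1, axis 2 \<i> :: complex ^ 2]"
    by (auto simp: axis_eq_axis complex_eq_iff)
  \<comment> \<open>The real 4x4 matrix is the real form of the Hermitian 2x2 matrix with entries A,
    B, cnj B, E, so its determinant is the square of the complex one.\<close>
  have "leibniz_det Basis (pullback (chart k) a) = (A * E - (cmod B)\<^sup>2)\<^sup>2"
    unfolding bas leibniz_det_4[OF dist] m11 m12 m21 m22 cmod_power2
    by (simp add: power2_eq_square algebra_simps)
  also have "A * E - (cmod B)\<^sup>2 = 1 / h ^ 3"
  proof -
    have "(cmod B)\<^sup>2 = (cmod (a $ 1))\<^sup>2 * (cmod (a $ 2))\<^sup>2 / (h\<^sup>2)\<^sup>2"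
      by (simp add: B_def norm_mult norm_divide norm_power power_mult_distrib power_divide)
    moreover have "(1 + y) / q * ((1 + x) / q) - x * y / q\<^sup>2 = (1 + x + y) / q\<^sup>2" for x y q :: real
      by (simp add: power2_eq_square flip: diff_divide_distrib) (simp add: algebra_simps)
    moreover have "1 + (cmod (a $ 1))\<^sup>2 + (cmod (a $ 2))\<^sup>2 = h" using norm_a by (simp add: h_def)
    ultimately have "A * E - (cmod B)\<^sup>2 = h / (h\<^sup>2)\<^sup>2"
      unfolding A_def E_def by (simp only:)
    also have "\<dots> = 1 / h ^ 3" using h by (simp add: field_simps eval_nat_numeral)
    finally show ?thesis .
  qed
  finally show ?thesis using h by (simp add: volume_density_def h_def real_sqrt_divide)
qed

lemma line_of_measurable [measurable]: "line_of \<in> borel_measurable borel"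
proof (rule borel_measurable_continuous_countable_exceptions[of "{0}"])
  show "continuous_on (- {0}) line_of"
    by (auto intro!: continuous_at_imp_continuous_on has_derivative_continuous[OF line_of_has_derivative])
qed simp

lemma embed_axis:
  "embed k (axis 1 x) = axis (if k = 1 then 2 else 1) x"
  "embed k (axis 2 x) = axis (if k = 3 then 2 else 3) x"
  using three_cases[of k] by (auto simp: embed_def axis_def intro!: vec3_eqI)

lemma nn_integral_complex3:
  fixes g :: "complex ^ 3 \<Rightarrow> ennreal"
  assumes g: "g \<in> borel_measurable borel"
  shows "(\<integral>\<^sup>+ w. g w \<partial>lborel) = (\<integral>\<^sup>+ s. \<integral>\<^sup>+ b. g (axis k s + embed k b) \<partial>lborel \<partial>lborel)"
proof -
  let ?\<phi> = "\<lambda>p. axis k (fst p) + embed k (snd p)"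
  have ax: "axis k (x + y) = axis k x + axis k y" "axis k (r *\<^sub>R x) = r *\<^sub>R axis k x" for x y :: complex and r
    by (simp_all add: axis_def vec_eq_iff)
  have lin: "linear ?\<phi>" by (rule linearI) (simp_all add: embed_simps ax algebra_simps)
  have c: "?\<phi> \<in> borel_measurable borel"
    using linear_continuous_on lin linear_conv_bounded_linear by (blast intro: borel_measurable_continuous_onI)
  have "(\<integral>\<^sup>+ w. g w \<partial>lborel) = (\<integral>\<^sup>+ p. g (?\<phi> p) \<partial>lborel)"
  proof (rule nn_integral_lborel_basis[symmetric, OF lin _ _ g])
    have z: "axis k 0 = 0" "embed k 0 = 0"
      using embed_simps(3)[of k 0] by (simp_all add: axis_def vec_eq_iff)
    show "?\<phi> ` Basis = Basis"
    proof -
      have b1: "(Basis :: (complex \<times> (complex ^ 2)) set) =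
          {(1, 0), (\<i>, 0), (0, axis 1 1), (0, axis 1 \<i>), (0, axis 2 1), (0, axis 2 \<i>)}"
        by (auto simp: Basis_prod_def Basis_vec_def UNIV_2 Basis_complex_def)
      have b2: "(Basis :: (complex ^ 3) set) =
          {axis 1 1, axis 1 \<i>, axis 2 1, axis 2 \<i>, axis 3 1, axis 3 \<i>}"
        unfolding Basis_vec_def UNIV_3 Basis_complex_def by blast
      show ?thesis
        unfolding b1 b2 image_insert image_empty fst_conv snd_conv z embed_axis
        using three_cases[of k] by (elim disjE) (simp_all add: insert_commute)
    qed
  qed simp
  also have "\<dots> = (\<integral>\<^sup>+ s. \<integral>\<^sup>+ b. g (?\<phi> (s, b)) \<partial>lborel \<partial>lborel)"
    by (rule nn_integral_lborel_pair[OF measurable_compose[OF c g]])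
  finally show ?thesis by simp
qed

lemma nn_integral_complex2_mult:
  fixes g :: "complex ^ 2 \<Rightarrow> ennreal"
  assumes g: "g \<in> borel_measurable borel" and s: "s \<noteq> 0"
  shows "(\<integral>\<^sup>+ b. g b \<partial>lborel) = ennreal (cmod s ^ 4) * (\<integral>\<^sup>+ a. g (s *s a) \<partial>lborel)"
proof -
  let ?\<phi> = "\<lambda>p. axis 1 (fst p) + axis 2 (snd p) :: complex ^ 2"
  have ax: "axis k (x + y) = axis k x + axis k y" "axis k (r *\<^sub>R x) = r *\<^sub>R axis k x" "axis k 0 = 0"
    "s *s axis k x = axis k (s * x)" for x y :: complex and r and k :: 2
    by (simp_all add: axis_def vec_eq_iff)
  have lin: "linear ?\<phi>" by (rule linearI) (simp_all add: ax algebra_simps)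
  have c [measurable]: "?\<phi> \<in> borel_measurable borel"
    using linear_continuous_on lin linear_conv_bounded_linear by (blast intro: borel_measurable_continuous_onI)
  have split: "(\<integral>\<^sup>+ b. g b \<partial>lborel) = (\<integral>\<^sup>+ x. \<integral>\<^sup>+ y. g (axis 1 x + axis 2 y) \<partial>lborel \<partial>lborel)"
    if g: "g \<in> borel_measurable borel" for g :: "complex ^ 2 \<Rightarrow> ennreal"
  proof -
    have "(\<integral>\<^sup>+ b. g b \<partial>lborel) = (\<integral>\<^sup>+ p. g (?\<phi> p) \<partial>lborel)"
    proof (rule nn_integral_lborel_basis[symmetric, OF lin _ _ g])
      show "?\<phi> ` Basis = Basis"
        unfolding Basis_prod_def image_Un image_image
        by (auto simp: Basis_vec_def UNIV_2 Basis_complex_def ax)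
    qed simp
    also have "\<dots> = (\<integral>\<^sup>+ x. \<integral>\<^sup>+ y. g (?\<phi> (x, y)) \<partial>lborel \<partial>lborel)"
      by (rule nn_integral_lborel_pair[OF measurable_compose[OF c g]])
    finally show ?thesis by simp
  qed
  have sm: "(\<lambda>a. s *s a) \<in> borel_measurable (borel :: (complex ^ 2) measure)"
  proof -
    have "linear (\<lambda>a :: complex ^ 2. s *s a)" by (rule linearI) (simp_all add: vec_eq_iff algebra_simps)
    then show ?thesis
      using linear_continuous_on linear_conv_bounded_linear by (blast intro: borel_measurable_continuous_onI)
  qed
  have m: "(\<lambda>p. g (?\<phi> p)) \<in> borel_measurable borel" by (rule measurable_compose[OF c g])
  have axm: "(\<lambda>x. axis k x) \<in> borel_measurable (borel :: complex measure)" for k :: 2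
  proof -
    have "linear (\<lambda>x :: complex. axis k x)" by (rule linearI) (simp_all add: ax)
    then show ?thesis
      using linear_continuous_on linear_conv_bounded_linear by (blast intro: borel_measurable_continuous_onI)
  qed
  note [measurable] = g axm
  have "(\<integral>\<^sup>+ b. g b \<partial>lborel) = (\<integral>\<^sup>+ x. \<integral>\<^sup>+ y. g (axis 1 x + axis 2 y) \<partial>lborel \<partial>lborel)"
    by (rule split[OF g])
  also have "\<dots> = (\<integral>\<^sup>+ x. ennreal ((cmod s)\<^sup>2) * (\<integral>\<^sup>+ y. g (axis 1 x + axis 2 (s * y)) \<partial>lborel) \<partial>lborel)"
    by (intro nn_integral_cong nn_integral_complex_mult[OF _ s]) measurable
  also have "\<dots> = ennreal ((cmod s)\<^sup>2) * (\<integral>\<^sup>+ x. \<integral>\<^sup>+ y. g (axis 1 x + axis 2 (s * y)) \<partial>lborel \<partial>lborel)"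
    by (intro nn_integral_cmult) measurable
  also have "(\<integral>\<^sup>+ x. \<integral>\<^sup>+ y. g (axis 1 x + axis 2 (s * y)) \<partial>lborel \<partial>lborel)
     = ennreal ((cmod s)\<^sup>2) * (\<integral>\<^sup>+ x. \<integral>\<^sup>+ y. g (axis 1 (s * x) + axis 2 (s * y)) \<partial>lborel \<partial>lborel)"
    by (intro nn_integral_complex_mult[OF _ s]) measurable
  also have "(\<integral>\<^sup>+ x. \<integral>\<^sup>+ y. g (axis 1 (s * x) + axis 2 (s * y)) \<partial>lborel \<partial>lborel) = (\<integral>\<^sup>+ a. g (s *s a) \<partial>lborel)"
    by (subst split[OF measurable_compose[OF sm g]]) (simp add: vector_add_ldistrib ax)
  finally show ?thesis
    by (simp add: mult.assoc[symmetric] ennreal_mult[symmetric] power_add[symmetric])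
qed

text \<open>The integrand is the Jacobian of scaling two complex coordinates by s, over the s for
  which s (1, a) lies in the unit ball. The result is pi/3 times the volume density of a
  chart.\<close>

lemma nn_integral_cmod_power_4:
  assumes h: "h > 0"
  shows "(\<integral>\<^sup>+ s. ennreal (cmod s ^ 4) * indicator {s. (cmod s)\<^sup>2 * h \<le> 1} s \<partial>lborel) = ennreal (pi / 3 * (1 / h ^ 3))"
proof -
  let ?g = "\<lambda>x :: real. ennreal (x\<^sup>2) * indicator {..1 / h} x"
  have "(\<integral>\<^sup>+ s. ennreal (cmod s ^ 4) * indicator {s. (cmod s)\<^sup>2 * h \<le> 1} s \<partial>lborel) = (\<integral>\<^sup>+ s. ?g ((cmod s)\<^sup>2) \<partial>lborel)"
    using h by (intro nn_integral_cong) (simp add: indicator_def field_simps flip: power_mult)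
  also have "\<dots> = ennreal pi * (\<integral>\<^sup>+ x. ?g x * indicator {0..} x \<partial>lborel)"
    by (rule nn_integral_radial) measurable
  also have "(\<integral>\<^sup>+ x. ?g x * indicator {0..} x \<partial>lborel) = (\<integral>\<^sup>+ x. ennreal (x\<^sup>2) * indicator {0..1 / h} x \<partial>lborel)"
    by (intro nn_integral_cong) (auto split: split_indicator)
  also have "\<dots> = ennreal ((1 / h) ^ 3 / 3 - 0 ^ 3 / 3)"
    by (rule nn_integral_FTC_Icc) (use h in \<open>auto intro!: derivative_eq_intros simp flip: has_real_derivative_iff_has_vector_derivative\<close>)
  finally show ?thesis using h by (simp add: ennreal_mult[symmetric] power_divide)
qed

definition chart_measure :: "3 \<Rightarrow> cmat measure" where
  "chart_measure k = distr (density (restrict_space lborel UNIV)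
     (\<lambda>x. ennreal (volume_density (pullback (chart k)) x))) (restrict_space borel CP2) (chart k)"

lemma hpoint_measurable [measurable]: "hpoint k \<in> borel_measurable borel"
  by (intro borel_measurable_continuous_onI continuous_at_imp_continuous_on ballI
      has_derivative_continuous[OF hpoint_has_derivative])

lemma restrict_lborel_UNIV: "restrict_space lborel UNIV = lborel"
  by (rule measure_eqI) (auto simp: sets_restrict_space emeasure_restrict_space)

text \<open>In the coordinates \<open>w = s (1, a)\<close> the integral over \<open>s\<close> is explicit. Each chart measure is thus a
  multiple of the image of the Lebesgue measure of the unit ball of \<open>\<complex>\<^sup>3\<close>: the three charts agree
  without a change of variables between them, and the total volume is read off.\<close>

lemma emeasure_chart_measure:
  assumes B: "B \<in> sets borel"
  shows "ennreal (pi / 3) * emeasure (chart_measure k) (B \<inter> CP2)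
     = (\<integral>\<^sup>+ w. indicator (cball 0 1) w * indicator B (line_of w) \<partial>lborel)"
proof -
  note [measurable] = B
  have cm [measurable]: "chart k \<in> borel_measurable borel" unfolding chart_def[abs_def] by measurable
  have CP2: "chart k a \<in> CP2" for a using hpoint_nonzero by (auto simp: chart_def CP2_def)
  have cm': "chart k \<in> borel \<rightarrow>\<^sub>M restrict_space borel CP2"
    by (rule measurable_restrict_space2) (use CP2 in auto)
  let ?h = "\<lambda>a :: complex ^ 2. 1 + (norm a)\<^sup>2"
  have h: "?h a > 0" for a by (simp add: add_pos_nonneg)
  have BC: "B \<inter> CP2 \<in> sets (restrict_space borel CP2)"
    using B by (auto simp: sets_restrict_space)
  have "chart k -` (B \<inter> CP2) = chart k -` B" using CP2 by auto
  moreover have "(\<lambda>a. ennreal (1 / ?h a ^ 3)) \<in> borel_measurable borel" by measurable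
  moreover have "chart k -` B \<in> sets borel" using measurable_sets[OF cm B] by simp
  ultimately have E: "emeasure (chart_measure k) (B \<inter> CP2) = (\<integral>\<^sup>+ a. ennreal (1 / ?h a ^ 3) * indicator B (chart k a) \<partial>lborel)"
    unfolding chart_measure_def volume_density_chart restrict_lborel_UNIV
    using cm' BC by (simp add: emeasure_distr emeasure_density indicator_vimage[symmetric] cong: if_cong)
  let ?F = "\<lambda>w. indicator (cball 0 1) w * indicator B (line_of w) :: ennreal"
  have Fm [measurable]: "?F \<in> borel_measurable borel"
    by (intro borel_measurable_times_ennreal borel_measurable_indicator
        measurable_compose[OF line_of_measurable borel_measurable_indicator] B) simp
  have Z: "?F (axis k s + embed k (s *s a)) = indicator {s. (cmod s)\<^sup>2 * ?h a \<le> 1} s * indicator B (chart k a)"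
    if s: "s \<noteq> 0" for s a
  proof -
    have e: "axis k s + embed k (s *s a) = s *s hpoint k a"
      by (simp add: hpoint_def embed_simps vec_eq_iff axis_def algebra_simps)
    have "complex_of_real ((norm (s *s hpoint k a))\<^sup>2) = of_real ((cmod s)\<^sup>2 * ?h a)"
      unfolding hprod_self[symmetric] hprod_simps hprod_embed_hpoint of_real_mult complex_norm_square
      by (simp only: mult.assoc mult.left_commute)
    then have n: "(norm (s *s hpoint k a))\<^sup>2 = (cmod s)\<^sup>2 * ?h a" unfolding of_real_eq_iff .
    have "norm (s *s hpoint k a) \<le> 1 \<longleftrightarrow> (cmod s)\<^sup>2 * ?h a \<le> 1"
      unfolding n[symmetric] by (simp add: power_le_one_iff)
    then show ?thesis
      unfolding e by (simp add: line_of_smult[OF s] chart_def indicator_def)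
  qed
  have em: "(\<lambda>b. ?F (axis k s + embed k b)) \<in> borel_measurable borel" for s
  proof -
    have "continuous_on UNIV (\<lambda>b. axis k s + embed k b)"
      by (intro continuous_intros linear_continuous_on bounded_linear_embed)
    from measurable_compose[OF borel_measurable_continuous_onI[OF this] Fm] show ?thesis .
  qed
  have "(\<integral>\<^sup>+ w. ?F w \<partial>lborel) = (\<integral>\<^sup>+ s. \<integral>\<^sup>+ b. ?F (axis k s + embed k b) \<partial>lborel \<partial>lborel)"
    by (rule nn_integral_complex3[OF Fm])
  also have "\<dots> = (\<integral>\<^sup>+ s. \<integral>\<^sup>+ a. ennreal (cmod s ^ 4) *
      (indicator {s. (cmod s)\<^sup>2 * ?h a \<le> 1} s * indicator B (chart k a)) \<partial>lborel \<partial>lborel)"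
  \<comment> \<open>The coordinates degenerate at s = 0, which is a null set.\<close>
  proof (rule nn_integral_cong_AE)
    have "(\<integral>\<^sup>+ b. ?F (axis k s + embed k b) \<partial>lborel) = (\<integral>\<^sup>+ a. ennreal (cmod s ^ 4) *
      (indicator {s. (cmod s)\<^sup>2 * ?h a \<le> 1} s * indicator B (chart k a)) \<partial>lborel)" if s: "s \<noteq> 0" for s
      unfolding nn_integral_complex2_mult[OF em s] Z[OF s]
      by (rule nn_integral_cmult[symmetric]) measurable
    then show "AE s in lborel. (\<integral>\<^sup>+ b. ?F (axis k s + embed k b) \<partial>lborel) = (\<integral>\<^sup>+ a. ennreal (cmod s ^ 4) *
      (indicator {s. (cmod s)\<^sup>2 * ?h a \<le> 1} s * indicator B (chart k a)) \<partial>lborel)"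
      using AE_lborel_singleton[of 0] by (auto elim!: eventually_mono)
  qed
  also have "\<dots> = (\<integral>\<^sup>+ a. \<integral>\<^sup>+ s. ennreal (cmod s ^ 4) *
      (indicator {s. (cmod s)\<^sup>2 * ?h a \<le> 1} s * indicator B (chart k a)) \<partial>lborel \<partial>lborel)"
  proof -
    have "(\<lambda>p. ennreal (cmod (fst p) ^ 4) * (indicator {s. (cmod s)\<^sup>2 * ?h (snd p) \<le> 1} (fst p) * indicator B (chart k (snd p))))
      = (\<lambda>p. ennreal (cmod (fst p) ^ 4) * (indicator {p. (cmod (fst p))\<^sup>2 * ?h (snd p) \<le> 1} p * indicator B (chart k (snd p))))"
      by (simp add: fun_eq_iff indicator_def)
    moreover have "\<dots> \<in> borel_measurable borel"
      unfolding borel_prod[symmetric] by measurable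
    ultimately show ?thesis
      using nn_integral_lborel_swap[of "\<lambda>p. ennreal (cmod (fst p) ^ 4) * (indicator {s. (cmod s)\<^sup>2 * ?h (snd p) \<le> 1} (fst p) * indicator B (chart k (snd p)))"]
      by simp
  qed
  also have "\<dots> = (\<integral>\<^sup>+ a. (\<integral>\<^sup>+ s. ennreal (cmod s ^ 4) * indicator {s. (cmod s)\<^sup>2 * ?h a \<le> 1} s \<partial>lborel) * indicator B (chart k a) \<partial>lborel)"
    unfolding mult.assoc[symmetric] by (intro nn_integral_cong nn_integral_multc) measurable
  also have "\<dots> = (\<integral>\<^sup>+ a. ennreal (pi / 3) * (ennreal (1 / ?h a ^ 3) * indicator B (chart k a)) \<partial>lborel)"
  proof -
    have "ennreal (pi / 3 * (1 / ?h a ^ 3)) = ennreal (pi / 3) * ennreal (1 / ?h a ^ 3)" for a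
      by (rule ennreal_mult) (use h[of a] in auto)
    then show ?thesis unfolding nn_integral_cmod_power_4[OF h] mult.assoc[symmetric] by simp
  qed
  also have "\<dots> = ennreal (pi / 3) * (\<integral>\<^sup>+ a. ennreal (1 / ?h a ^ 3) * indicator B (chart k a) \<partial>lborel)"
    by (rule nn_integral_cmult) measurable
  finally show ?thesis unfolding E by simp
qed

lemma vol_CP2_eq: "vol_CP2 = pi\<^sup>2 / 2"
proof -
  have sets: "sets (chart_measure k) = sets (restrict_space borel CP2)" for k
    by (simp add: chart_measure_def)
  have eq: "chart_measure k = chart_measure 1" for k
  proof (rule measure_eqI)
    show "sets (chart_measure k) = sets (chart_measure 1)" by (simp add: sets)
    fix A assume "A \<in> sets (chart_measure k)"
    then obtain B where B: "B \<in> sets borel" "A = B \<inter> CP2" by (auto simp: sets sets_restrict_space)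
    have "ennreal (pi / 3) * emeasure (chart_measure k) A = ennreal (pi / 3) * emeasure (chart_measure 1) A"
      unfolding B(2) emeasure_chart_measure[OF B(1)] ..
    then show "emeasure (chart_measure k) A = emeasure (chart_measure 1) A"
      by (subst (asm) ennreal_mult_cancel_left) auto
  qed
  have "riemannian_measure CP2 ((\<lambda>\<psi>. (UNIV, \<psi>)) ` affine_charts) = (SUP k. chart_measure k)"
    unfolding riemannian_measure_def affine_charts_eq image_image case_prod_conv chart_measure_def ..
  \<comment> \<open>The three chart measures coincide, so their supremum is any one of them.\<close>
  also have "\<dots> = chart_measure 1" by (subst eq) simp
  finally have v: "vol_CP2 = measure (chart_measure 1) CP2" by (simp add: vol_CP2_def)
  have "ennreal (pi / 3) * emeasure (chart_measure 1) CP2 = (\<integral>\<^sup>+ w. indicator (cball (0 :: complex ^ 3) 1) w \<partial>lborel)"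
    using emeasure_chart_measure[of UNIV 1] by simp
  also have "\<dots> = ennreal (unit_ball_vol 6)"
    by (simp add: emeasure_cball)
  \<comment> \<open>The ball volume pi^3/6, split so that the factor pi/3 cancels.\<close>
  also have "unit_ball_vol 6 = pi / 3 * (pi\<^sup>2 / 2)"
    using unit_ball_vol_even[of 3] by (simp add: eval_nat_numeral)
  also have "ennreal \<dots> = ennreal (pi / 3) * ennreal (pi\<^sup>2 / 2)" by (rule ennreal_mult) auto
  finally have "emeasure (chart_measure 1) CP2 = ennreal (pi\<^sup>2 / 2)"
    by (subst (asm) ennreal_mult_cancel_left) auto
  then show ?thesis unfolding v measure_def by simp
qed

section \<open>The normal bundle\<close>

lemma continuous_on_hprod [continuous_intros]:
  "continuous_on A f \<Longrightarrow> continuous_on A g \<Longrightarrow> continuous_on A (\<lambda>x. hprod (f x) (g x))"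
  unfolding hprod_def by (intro continuous_intros)

lemma continuous_on_smult [continuous_intros]:
  fixes g :: "'a::topological_space \<Rightarrow> complex ^ 'n"
  shows "continuous_on A f \<Longrightarrow> continuous_on A g \<Longrightarrow> continuous_on A (\<lambda>x. f x *s g x)"
  unfolding vector_scalar_mult_def by (intro continuous_intros)

lemma continuous_on_D_line_of:
  assumes f: "continuous_on A f" and w: "continuous_on A w" and nz: "\<And>x. x \<in> A \<Longrightarrow> f x \<noteq> 0"
  shows "continuous_on A (\<lambda>x. D line_of (f x) (w x))"
proof -
  have "continuous_on A (\<lambda>x. herm ((1 / hprod (f x) (f x)) *s
      (w x - (hprod (w x) (f x) / hprod (f x) (f x)) *s f x)) (f x))"
    unfolding herm_def
    by (intro continuous_intros f w) (use nz in \<open>auto simp: hprod_self_eq_0\<close>)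
  then show ?thesis
    by (rule continuous_on_eq) (simp add: D_line_of nz)
qed

text \<open>An isometric coordinate on the fibre, which turns an integral over the normal space into
  one over the complex plane.\<close>

definition normal_frame :: "cmat set \<Rightarrow> cmat \<Rightarrow> (complex \<Rightarrow> cmat) \<Rightarrow> bool" where
  "normal_frame S p L \<longleftrightarrow> linear L \<and> range L = normal_space S p \<and> (\<forall>u v. fs (L u) (L v) = Re (u * cnj v))"

text \<open>The squared principal curvature in any unit normal direction, by the Gauss equation.\<close>

definition half_defect :: "cmat set \<Rightarrow> cmat \<Rightarrow> real" where
  "half_defect S p = (4 - gauss_curvature S p) / 2"

context curve_piece
begin

lemma f_cont: "continuous_on U f" "continuous_on U f'" "continuous_on U f''"
  using f_deriv f'_deriv vderiv_has_derivative[OF vderiv_holomorphic[OF vderiv_holomorphic[OF holo open_U] open_U] open_U]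
  by (auto intro!: continuous_at_imp_continuous_on has_derivative_continuous)

lemma F_cont: "continuous_on U F"
  using vderiv_has_derivative[OF F_holo open_U]
  by (auto intro!: continuous_at_imp_continuous_on has_derivative_continuous)

lemma continuous_on_vcnj: "continuous_on A g \<Longrightarrow> continuous_on A (\<lambda>x. vcnj (g x))"
  by (rule bounded_linear.continuous_on[OF bounded_linear_vcnj])

text \<open>By \<open>fs_normal_normal\<close> the map c to c n is conformal; rescaling by r makes
  it isometric, and continuity in the point comes from the inverse of \<gamma>.\<close>

lemma local_frame:
  "\<exists>E. continuous_on (\<gamma> ` U \<times> UNIV) E \<and> (\<forall>p\<in>\<gamma> ` U. normal_frame S p (\<lambda>c. E (p, c)))"
proof -
  obtain \<delta> where \<delta>: "homeomorphism U (\<gamma> ` U) \<gamma> \<delta>" using homeo by blast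
  define r where "r z = norm (f z) / norm (F z)" for z
  define E where "E = (\<lambda>(p, c). normal (\<delta> p) (of_real (r (\<delta> p)) * c))"
  have \<delta>c: "continuous_on (\<gamma> ` U \<times> UNIV) (\<lambda>x. \<delta> (fst x))" for UNIV :: "complex set"
    by (rule continuous_on_compose2[OF homeomorphism_cont2[OF \<delta>] continuous_on_fst[OF continuous_on_id]]) auto
  have \<delta>U: "\<delta> p \<in> U" if "p \<in> \<gamma> ` U" for p using \<delta> that by (metis homeomorphism_image2 imageI)
  have comp: "continuous_on (\<gamma> ` U \<times> (UNIV :: complex set)) (\<lambda>x. g (\<delta> (fst x)))" if "continuous_on U g" for g :: "complex \<Rightarrow> complex ^ 3"
    by (rule continuous_on_compose2[OF that \<delta>c]) (use \<delta>U in auto)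
  have "continuous_on (\<gamma> ` U \<times> UNIV) E"
    unfolding E_def r_def case_prod_beta
    by (intro continuous_on_D_line_of continuous_intros comp[OF f_cont(1)] continuous_on_vcnj comp[OF F_cont])
      (use \<delta>U nonzero F_nonzero in auto)
  moreover have "normal_frame S p (\<lambda>c. E (p, c))" if p: "p \<in> \<gamma> ` U" for p
  proof -
    obtain z where z: "z \<in> U" "p = \<gamma> z" using p by blast
    have dz: "\<delta> p = z" using \<delta> z by (simp add: homeomorphism_apply1)
    have rz: "r z \<noteq> 0" using nonzero[OF z(1)] F_nonzero[OF z(1)] by (simp add: r_def)
    have E: "E (p, c) = normal z (of_real (r z) * c)" for c by (simp add: E_def dz)
    have "linear (\<lambda>c. E (p, c))"
    proof (rule linearI)
      show "E (p, b1 + b2) = E (p, b1) + E (p, b2)" for b1 b2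
        unfolding E D_line_of_add[OF nonzero[OF z(1)], symmetric]
        by (intro arg_cong[of _ _ "D line_of (f z)"]) (simp add: vec_eq_iff algebra_simps)
      show "E (p, s *\<^sub>R b) = s *\<^sub>R E (p, b)" for s b
        unfolding E D_line_of_scaleR[OF nonzero[OF z(1)], symmetric]
        by (intro arg_cong[of _ _ "D line_of (f z)"]) (simp add: vec_eq_iff algebra_simps)
    qed
    moreover have "range (\<lambda>c. E (p, c)) = range (normal z)"
    proof -
      have "normal z c = E (p, c / of_real (r z))" for c using rz by (simp add: E)
      then show ?thesis
        using rangeI[of "\<lambda>c. E (p, c)" "c / of_real (r z)" for c] by (auto simp: E)
    qed
    moreover have "fs (E (p, u)) (E (p, v)) = Re (u * cnj v)" for u v
    proof -
      have A: "Re (of_real s * u * cnj (of_real s * v)) * t = Re (u * cnj v) * (s\<^sup>2 * t)" for s t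
        by (simp add: power2_eq_square algebra_simps)
      have B: "(r z)\<^sup>2 * ((norm (F z))\<^sup>2 / (norm (f z))\<^sup>2) = 1"
        using nonzero[OF z(1)] F_nonzero[OF z(1)] by (simp add: r_def power_divide)
      show ?thesis unfolding E fs_normal_normal[OF z(1)] A B by simp
    qed
    ultimately show ?thesis unfolding normal_frame_def z(2) normal_space_curve[OF z(1)] by simp
  qed
  ultimately show ?thesis by blast
qed

lemma half_defect_eq:
  assumes "z \<in> U" "holo_param S U \<gamma>"
  shows "half_defect S (\<gamma> z) = \<kappa> z"
  by (simp add: half_defect_def gauss_curvature[OF assms])

lemma continuous_half_defect:
  assumes "holo_param S U \<gamma>"
  shows "continuous_on (\<gamma> ` U) (half_defect S)"
proof -
  obtain \<delta> where \<delta>: "homeomorphism U (\<gamma> ` U) \<gamma> \<delta>" using homeo by blast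
  have "continuous_on U \<kappa>"
    unfolding cdet_def
    by (intro continuous_intros f_cont F_cont continuous_on_vcnj) (use F_nonzero in auto)
  then have "continuous_on (\<gamma> ` U) (\<lambda>p. \<kappa> (\<delta> p))"
    by (rule continuous_on_compose2[OF _ homeomorphism_cont2[OF \<delta>]])
      (use \<delta> in \<open>simp add: homeomorphism_image2\<close>)
  then show ?thesis
    by (rule continuous_on_eq) (use half_defect_eq[OF _ assms] \<delta> in \<open>auto simp: homeomorphism_apply1\<close>)
qed

end

section \<open>The whole curve: measurable frame, bundle measure and fibre integration\<close>

context
  fixes S :: "cmat set"
  assumes S: "smooth_curve S"
begin

lemma S_compact: "compact S" and S_nonempty: "S \<noteq> {}"
  using S by (auto simp: smooth_curve_def)

lemma S_point:
  assumes "p \<in> S"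
  obtains U \<gamma> f z where "holo_param S U \<gamma>" "curve_piece U f \<gamma> S" "z \<in> U" "\<gamma> z = p"
  using S assms holo_param_imp_curve_piece by (fastforce simp: smooth_curve_def)

lemma half_defect_nonneg: "p \<in> S \<Longrightarrow> half_defect S p \<ge> 0"
  by (rule S_point[of p]) (auto simp: curve_piece.half_defect_eq)

lemma half_defect_measurable: "half_defect S \<in> borel_measurable (restrict_space borel S)"
proof (rule borel_measurable_continuous_on_restrict)
  show "continuous_on S (half_defect S)"
    unfolding continuous_on_eq_continuous_within
  proof
    fix p assume p: "p \<in> S"
    then obtain U \<gamma> f z where c: "holo_param S U \<gamma>" "curve_piece U f \<gamma> S" "z \<in> U" "\<gamma> z = p"
      by (rule S_point)
    interpret curve_piece U f \<gamma> S by (rule c)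
    obtain T where T: "open T" "\<gamma> ` U = S \<inter> T" using image_open by (auto simp: openin_open)
    have "continuous (at p within S \<inter> T) (half_defect S)"
      using continuous_half_defect[OF c(1)] c(3,4) p unfolding T(2)[symmetric] continuous_on_eq_continuous_within
      by blast
    moreover have "at p within S \<inter> T = at p within S"
      by (rule at_within_nhd[of p T]) (use T c(3,4) in auto)
    ultimately show "continuous (at p within S) (half_defect S)" by simp
  qed
qed

text \<open>A continuous frame may not exist globally, but a Borel one suffices. By compactness
  finitely many pieces cover S; their images are Borel, so the local frames are glued by case
  distinction, with induction on the cover.\<close>

lemma global_frame:
  obtains E where "E \<in> borel_measurable borel" "\<And>p. p \<in> S \<Longrightarrow> normal_frame S p (\<lambda>c. E (p, c))"
proof -
  define I where "I = {(U, \<gamma>). holo_param S U \<gamma>}"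
  have ex: "\<exists>T. open T \<and> snd i ` fst i = S \<inter> T" if "i \<in> I" for i
    using that by (auto simp: I_def holo_param_def openin_open)
  then obtain T where T: "\<And>i. i \<in> I \<Longrightarrow> open (T i)" "\<And>i. i \<in> I \<Longrightarrow> snd i ` fst i = S \<inter> T i"
    by metis
  have "S \<subseteq> (\<Union>i\<in>I. T i)"
  proof
    fix p assume "p \<in> S"
    then obtain U \<gamma> f z where "holo_param S U \<gamma>" "z \<in> U" "\<gamma> z = p" by (rule S_point)
    then show "p \<in> (\<Union>i\<in>I. T i)" using T(2)[of "(U, \<gamma>)"] by (force simp: I_def)
  qed
  then obtain C where C: "C \<subseteq> I" "finite C" "S \<subseteq> (\<Union>i\<in>C. T i)"
    using compactE_image[OF S_compact, of I T] T(1) by blast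
  have "\<exists>E\<in>borel_measurable borel. \<forall>p\<in>S \<inter> (\<Union>i\<in>C. T i). normal_frame S p (\<lambda>c. E (p, c))"
    using C(2,1)
  proof (induction C)
    case empty
    show ?case by (intro bexI[of _ "\<lambda>_. 0"]) auto
  next
    case (insert i C)
    then obtain E where E: "E \<in> borel_measurable borel" "\<forall>p\<in>S \<inter> (\<Union>i\<in>C. T i). normal_frame S p (\<lambda>c. E (p, c))"
      by auto
    obtain U \<gamma> where i: "i = (U, \<gamma>)" "holo_param S U \<gamma>" using insert by (auto simp: I_def)
    obtain f where "curve_piece U f \<gamma> S" using holo_param_imp_curve_piece[OF i(2)] by blast
    then interpret curve_piece U f \<gamma> S .
    obtain E' where E': "continuous_on (\<gamma> ` U \<times> UNIV) E'" "\<forall>p\<in>\<gamma> ` U. normal_frame S p (\<lambda>c. E' (p, c))"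
      using local_frame by blast
    have \<gamma>U: "\<gamma> ` U = S \<inter> T i" using T(2)[of i] insert.prems by (auto simp: i(1))
    let ?A = "\<gamma> ` U \<times> (UNIV :: complex set)"
    have A: "?A \<in> sets borel"
      unfolding borel_prod[symmetric] \<gamma>U
      by (intro pair_measureI sets.Int borel_compact[OF S_compact] borel_open[OF T(1)])
        (use insert.prems in auto)
    have m: "(\<lambda>x. indicator ?A x *\<^sub>R E' x) \<in> borel_measurable borel"
      by (rule borel_measurable_continuous_on_indicator[OF A E'(1)])
    let ?E = "\<lambda>x. if x \<in> ?A then indicator ?A x *\<^sub>R E' x else E x"
    have EM: "?E \<in> borel_measurable borel"
      by (rule measurable_If_set[OF m E(1)]) (use A in simp)
    have EN: "normal_frame S p (\<lambda>c. ?E (p, c))" if "p \<in> S \<inter> (\<Union>i\<in>insert i C. T i)" for p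
    proof (cases "p \<in> \<gamma> ` U")
      case True
      then show ?thesis using bspec[OF E'(2) True] by simp
    next
      case False
      then show ?thesis using E(2) that \<gamma>U by (auto split: if_splits)
    qed
    show ?case
    proof (rule bexI[of _ ?E])
      show "\<forall>p\<in>S \<inter> (\<Union>i\<in>insert i C. T i). normal_frame S p (\<lambda>c. ?E (p, c))"
        by (rule ballI) (rule EN)
    qed (rule EM)
  qed
  then show thesis using that C(3) by blast
qed

text \<open>All members of the supremum live on the Borel sets of S; since S is nonempty there is at
  least one, so the supremum has the same sigma-algebra.\<close>

lemma sets_area_measure: "sets (area_measure S) = sets (restrict_space borel S)"
proof -
  obtain p where "p \<in> S" using S_nonempty by blast
  then obtain U \<gamma> f z where h: "holo_param S U \<gamma>" by (rule S_point)
  show ?thesis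
    unfolding area_measure_def riemannian_measure_def
    by (rule sets_SUP) (use h in auto)
qed

lemma space_area_measure: "space (area_measure S) = S"
  using sets_eq_imp_space_eq[OF sets_area_measure] by (simp add: space_restrict_space)

text \<open>\<open>measure_of\<close> is meaningful only for a countably additive set function.
  Agreement with the values of an image measure supplies this, and at the same time identifies the
  measure.\<close>

lemma normal_bundle_measure_eq:
  assumes E: "E \<in> borel_measurable borel" "\<And>p. p \<in> S \<Longrightarrow> normal_frame S p (\<lambda>c. E (p, c))"
  defines "\<Theta> \<equiv> \<lambda>x. (fst x, E x)"
  shows "\<Theta> \<in> area_measure S \<Otimes>\<^sub>M lborel \<rightarrow>\<^sub>M restrict_space borel (normal_bundle S)"
    and "normal_bundle_measure S = distr (area_measure S \<Otimes>\<^sub>M lborel) (restrict_space borel (normal_bundle S)) \<Theta>"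
proof -
  let ?P = "area_measure S \<Otimes>\<^sub>M (lborel :: complex measure)"
  let ?R = "restrict_space borel (normal_bundle S)"
  have id: "(\<lambda>p. p) \<in> area_measure S \<rightarrow>\<^sub>M borel"
    unfolding measurable_cong_sets[OF sets_area_measure refl] by (rule measurable_restrict_space1) simp
  have fst: "fst \<in> ?P \<rightarrow>\<^sub>M borel"
    using measurable_compose[OF measurable_fst id] .
  have "(\<lambda>x. (fst x, snd x)) \<in> ?P \<rightarrow>\<^sub>M borel"
    unfolding borel_prod[symmetric] by (intro measurable_Pair fst) simp
  then have idP: "(\<lambda>x. x) \<in> ?P \<rightarrow>\<^sub>M borel" by simp
  have \<Theta>b: "\<Theta> \<in> ?P \<rightarrow>\<^sub>M borel"
    unfolding \<Theta>_def borel_prod[symmetric] by (intro measurable_Pair fst measurable_compose[OF idP E(1)])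
  have range: "E (p, c) \<in> normal_space S p" if "p \<in> S" for p c
    using E(2)[OF that] by (auto simp: normal_frame_def)
  show \<Theta>: "\<Theta> \<in> ?P \<rightarrow>\<^sub>M ?R"
    by (rule measurable_restrict_space2[OF _ \<Theta>b])
      (use range in \<open>auto simp: \<Theta>_def space_pair_measure space_area_measure normal_bundle_def\<close>)
  have spR: "space ?R = normal_bundle S" by (simp add: space_restrict_space)
  have eq: "(\<integral>\<^sup>+ p. emeasure (lebesgue_of_subspace (normal_space S p)) {v. (p, v) \<in> A} \<partial>area_measure S)
      = emeasure (distr ?P ?R \<Theta>) A" if A: "A \<in> sets ?R" for A
  proof -
    have mA: "\<Theta> -` A \<inter> space ?P \<in> sets ?P" by (rule measurable_sets[OF \<Theta> A])
    have "emeasure (distr ?P ?R \<Theta>) A = (\<integral>\<^sup>+ p. emeasure lborel (Pair p -` (\<Theta> -` A \<inter> space ?P)) \<partial>area_measure S)"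
      by (simp add: emeasure_distr[OF \<Theta> A] lborel.emeasure_pair_measure_alt[OF mA])
    also have "\<dots> = (\<integral>\<^sup>+ p. emeasure (lebesgue_of_subspace (normal_space S p)) {v. (p, v) \<in> A} \<partial>area_measure S)"
    proof (rule nn_integral_cong)
      fix p assume "p \<in> space (area_measure S)"
      then have p: "p \<in> S" by (simp add: space_area_measure)
      obtain B where B: "B \<in> sets borel" "A = B \<inter> normal_bundle S" using A by (auto simp: sets_restrict_space)
      note fr = E(2)[OF p, unfolded normal_frame_def]
      have N: "normal_space S p = range (\<lambda>c. E (p, c))" using fr by simp
      \<comment> \<open>The fibre measure is defined on Borel sets of the space of matrices; a
        closed fibre makes the slice of A such a set.\<close>
      have "closed (normal_space S p)"
        unfolding N by (intro closed_subspace linear_subspace_image subspace_UNIV) (use fr in simp)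
      moreover have "{v. (p, v) \<in> B} \<in> sets borel"
      proof -
        have "Pair p \<in> borel \<rightarrow>\<^sub>M (borel :: (cmat \<times> cmat) measure)"
          unfolding borel_prod[symmetric] by measurable
        from measurable_sets[OF this B(1)] show ?thesis by (simp add: vimage_def)
      qed
      moreover have Av: "{v. (p, v) \<in> A} = {v. (p, v) \<in> B} \<inter> normal_space S p"
        using p by (auto simp: B normal_bundle_def)
      ultimately have Ab: "{v. (p, v) \<in> A} \<in> sets borel" by auto
      have "(\<lambda>c. E (p, c)) \<in> borel_measurable borel"
        using fr linear_continuous_on linear_conv_bounded_linear by (blast intro: borel_measurable_continuous_onI)
      then have "emeasure (lebesgue_of_subspace (normal_space S p)) {v. (p, v) \<in> A}
          = emeasure lborel ((\<lambda>c. E (p, c)) -` {v. (p, v) \<in> A})"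
        unfolding N using fr Ab by (subst lebesgue_of_subspace_isometry) (auto simp: emeasure_distr)
      also have "(\<lambda>c. E (p, c)) -` {v. (p, v) \<in> A} = Pair p -` (\<Theta> -` A \<inter> space ?P)"
        using p by (auto simp: \<Theta>_def space_pair_measure space_area_measure)
      finally show "emeasure lborel (Pair p -` (\<Theta> -` A \<inter> space ?P))
          = emeasure (lebesgue_of_subspace (normal_space S p)) {v. (p, v) \<in> A}" ..
    qed
    finally show ?thesis ..
  qed
  have "normal_bundle_measure S = measure_of (normal_bundle S) (sets ?R) (emeasure (distr ?P ?R \<Theta>))"
    unfolding normal_bundle_measure_def
  proof (rule measure_of_eq)
    show "sets ?R \<subseteq> Pow (normal_bundle S)" using sets.space_closed[of ?R] by (simp only: spR)
    fix A assume "A \<in> sigma_sets (normal_bundle S) (sets ?R)"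
    then have "A \<in> sets ?R" using sets.sigma_sets_eq[of ?R] by (simp only: spR)
    then show "(\<integral>\<^sup>+ p. emeasure (lebesgue_of_subspace (normal_space S p)) {v. (p, v) \<in> A} \<partial>area_measure S)
      = emeasure (distr ?P ?R \<Theta>) A" by (rule eq)
  qed
  also have "\<dots> = distr ?P ?R \<Theta>"
    using measure_of_of_measure[of "distr ?P ?R \<Theta>"] by (simp add: spR)
  finally show "normal_bundle_measure S = distr ?P ?R \<Theta>" .
qed

lemma det_shape_operator_S:
  assumes p: "p \<in> S" and v: "v \<in> normal_space S p"
  shows "det_on (tangent_space S p) (\<lambda>x. C *\<^sub>R x - s *\<^sub>R shape_operator S p v x) = C\<^sup>2 - s\<^sup>2 * fs v v * half_defect S p"
proof -
  obtain U \<gamma> f z where c: "holo_param S U \<gamma>" "curve_piece U f \<gamma> S" "z \<in> U" "\<gamma> z = p"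
    using p by (rule S_point)
  interpret curve_piece U f \<gamma> S by (rule c)
  show ?thesis
    using det_shape_operator[OF c(3), of v C s] v half_defect_eq[OF c(3,1)] by (simp add: c(4))
qed

lemma fs_norm_square: "(fs_norm v)\<^sup>2 = fs v v"
  by (simp add: fs_norm_def fs_def)

lemma tube_weight_nonneg: "0 \<le> r \<Longrightarrow> 0 \<le> tube_weight \<kappa> r"
  unfolding tube_weight_def
  by (auto simp: indicator_def intro!: mult_nonneg_nonneg divide_nonneg_nonneg cos_ge_zero sin_ge_zero)

text \<open>The integrand is a function of the base point and the length of v alone, and the frame
  preserves lengths, so after Tonelli each fibre carries the integral of \<open>tube_weight\<close>
  over the complex plane.\<close>

lemma total_absolute_curvature_eq_nn_integral:
  "total_absolute_curvature S = 2 / vol_CP2 *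
     enn2real (\<integral>\<^sup>+ p. ennreal (pi * (1 + (half_defect S p)\<^sup>2) / (2 * (1 + half_defect S p))) \<partial>area_measure S)"
proof -
  obtain E where E: "E \<in> borel_measurable borel" "\<And>p. p \<in> S \<Longrightarrow> normal_frame S p (\<lambda>c. E (p, c))"
    by (rule global_frame) (rule that; assumption)
  let ?P = "area_measure S \<Otimes>\<^sub>M (lborel :: complex measure)"
  let ?R = "restrict_space borel (normal_bundle S)"
  define \<Theta> where "\<Theta> x = (fst x, E x)" for x
  have \<Theta>: "\<Theta> \<in> ?P \<rightarrow>\<^sub>M ?R" and nb: "normal_bundle_measure S = distr ?P ?R \<Theta>"
    using normal_bundle_measure_eq[OF E] unfolding \<Theta>_def by auto
  define G where "G q = tube_weight (half_defect S (fst q)) (fs_norm (snd q))" for q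
  have Gm: "G \<in> borel_measurable ?R"
  proof -
    have id: "(\<lambda>q. q) \<in> ?R \<rightarrow>\<^sub>M borel" by (rule measurable_restrict_space1) simp
    have fst: "fst \<in> ?R \<rightarrow>\<^sub>M restrict_space borel S"
    proof (rule measurable_restrict_space2)
      have "(fst :: cmat \<times> cmat \<Rightarrow> cmat) \<in> borel_measurable borel"
        by (intro borel_measurable_continuous_onI continuous_intros)
      from measurable_compose[OF id this] show "fst \<in> borel_measurable ?R" .
    qed (auto simp: space_restrict_space normal_bundle_def)
    have 1: "(\<lambda>q. half_defect S (fst q)) \<in> borel_measurable ?R"
      by (rule measurable_compose[OF fst half_defect_measurable])
    have "(\<lambda>q :: cmat \<times> cmat. fs_norm (snd q)) \<in> borel_measurable borel"
      unfolding fs_norm_def fs_def by (intro borel_measurable_continuous_onI continuous_intros) simp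
    then have 2: "(\<lambda>q. fs_norm (snd q)) \<in> borel_measurable ?R" by (rule measurable_compose[OF id])
    show ?thesis unfolding G_def tube_weight_def using 1 2 by measurable
  qed
  have G0: "0 \<le> G q" for q unfolding G_def by (rule tube_weight_nonneg) (simp add: fs_norm_def fs_def)
  have "(LINT q : {(p, v) \<in> normal_bundle S. fs_norm v < pi / 2} | normal_bundle_measure S.
        (case q of (p, v) \<Rightarrow>
           (let r = fs_norm v in
              \<bar>det_on (tangent_space S p)
                 (\<lambda>x. cos r *\<^sub>R x - sinc r *\<^sub>R shape_operator S p v x)\<bar>
              * cos r * sinc r ^ (2 * 2 - 2 * 1 - 1)))) = (LINT q | normal_bundle_measure S. G q)"
    unfolding set_lebesgue_integral_def
  proof (rule Bochner_Integration.integral_cong[OF refl])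
    fix q assume "q \<in> space (normal_bundle_measure S)"
    then have "q \<in> normal_bundle S" by (simp add: nb space_restrict_space)
    then obtain p v where q: "q = (p, v)" "p \<in> S" "v \<in> normal_space S p" by (auto simp: normal_bundle_def)
    have "2 * 2 - 2 * 1 - 1 = (1::nat)" by simp
    then show "indicator {(p, v) \<in> normal_bundle S. fs_norm v < pi / 2} q *\<^sub>R (case q of (p, v) \<Rightarrow>
           (let r = fs_norm v in
              \<bar>det_on (tangent_space S p)
                 (\<lambda>x. cos r *\<^sub>R x - sinc r *\<^sub>R shape_operator S p v x)\<bar>
              * cos r * sinc r ^ (2 * 2 - 2 * 1 - 1))) = G q"
      unfolding q(1) G_def tube_weight_def Let_def prod.case fst_conv snd_conv det_shape_operator_S[OF q(2,3)]
        fs_norm_square power_one_right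
      using q(2,3) by (simp add: indicator_def normal_bundle_def)
  qed
  also have "\<dots> = enn2real (\<integral>\<^sup>+ q. ennreal (G q) \<partial>normal_bundle_measure S)"
    by (rule integral_eq_nn_integral) (use Gm G0 in \<open>simp_all add: nb\<close>)
  also have "(\<integral>\<^sup>+ q. ennreal (G q) \<partial>normal_bundle_measure S) = (\<integral>\<^sup>+ x. ennreal (G (\<Theta> x)) \<partial>?P)"
    unfolding nb by (rule nn_integral_distr[OF \<Theta>]) (use Gm in simp)
  also have "\<dots> = (\<integral>\<^sup>+ p. \<integral>\<^sup>+ c. ennreal (G (\<Theta> (p, c))) \<partial>lborel \<partial>area_measure S)"
    by (rule lborel.nn_integral_fst[symmetric]) (use measurable_compose[OF \<Theta> Gm] in simp)
  also have "\<dots> = (\<integral>\<^sup>+ p. ennreal (pi * (1 + (half_defect S p)\<^sup>2) / (2 * (1 + half_defect S p))) \<partial>area_measure S)"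
  proof (rule nn_integral_cong)
    fix p assume "p \<in> space (area_measure S)"
    then have p: "p \<in> S" by (simp add: space_area_measure)
    have "fs_norm (E (p, c)) = cmod c" for c
      using E(2)[OF p] by (simp add: normal_frame_def fs_norm_def cmod_def power2_eq_square)
    then show "(\<integral>\<^sup>+ c. ennreal (G (\<Theta> (p, c))) \<partial>lborel) =
        ennreal (pi * (1 + (half_defect S p)\<^sup>2) / (2 * (1 + half_defect S p)))"
      unfolding nn_integral_tube_weight[OF half_defect_nonneg[OF p], symmetric] by (simp add: G_def \<Theta>_def)
  qed
  finally show ?thesis unfolding total_absolute_curvature_def by simp
qed

end

theorem theorem1p5:
  fixes S :: "cmat set"
  assumes "smooth_curve S"
  shows "total_absolute_curvature S =
    1 / pi * (LINT p | area_measure S.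
      ((gauss_curvature S p - 4)\<^sup>2 + 4) / (6 - gauss_curvature S p))"
proof -
  let ?k = "half_defect S" and ?q = "\<lambda>p. ((gauss_curvature S p - 4)\<^sup>2 + 4) / (6 - gauss_curvature S p)"
  have q: "?q p = 2 * (1 + (?k p)\<^sup>2) / (1 + ?k p)" for p
  proof -
    have K: "gauss_curvature S p = 4 - 2 * ?k p" unfolding half_defect_def by (simp add: field_simps)
    have e: "(4 - 2 * k - 4)\<^sup>2 + 4 = 2 * (2 * (1 + k\<^sup>2))" "6 - (4 - 2 * k) = 2 * (1 + k)" for k :: real
      by (simp_all add: power2_eq_square algebra_simps)
    show ?thesis unfolding K e by (rule mult_divide_mult_cancel_left) simp
  qed
  have nonneg: "0 \<le> ?q p" if "p \<in> S" for p
    unfolding q using half_defect_nonneg[OF assms that] by simp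
  have "?q \<in> borel_measurable (area_measure S)"
    unfolding q measurable_cong_sets[OF sets_area_measure[OF assms] refl]
    using half_defect_measurable[OF assms] by measurable
  then have I: "(LINT p | area_measure S. ?q p) = enn2real (\<integral>\<^sup>+ p. ennreal (?q p) \<partial>area_measure S)"
    by (rule integral_eq_nn_integral) (use nonneg space_area_measure[OF assms] in auto)
  have "(\<integral>\<^sup>+ p. ennreal (pi * (1 + (?k p)\<^sup>2) / (2 * (1 + ?k p))) \<partial>area_measure S)
      = (\<integral>\<^sup>+ p. ennreal (pi / 4) * ennreal (?q p) \<partial>area_measure S)"
  proof (rule nn_integral_cong)
    fix p assume "p \<in> space (area_measure S)"
    then have p: "p \<in> S" by (simp add: space_area_measure[OF assms])
    \<comment> \<open>The fibre integral is pi/4 times the integrand of the theorem.\<close>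
    have "pi * a / (2 * b) = pi / 4 * (2 * a / b)" for a b :: real by simp
    then have e: "pi * (1 + (?k p)\<^sup>2) / (2 * (1 + ?k p)) = pi / 4 * ?q p" unfolding q .
    have m: "ennreal (pi / 4 * ?q p) = ennreal (pi / 4) * ennreal (?q p)"
      by (rule ennreal_mult[OF _ nonneg[OF p]]) simp
    show "ennreal (pi * (1 + (?k p)\<^sup>2) / (2 * (1 + ?k p))) = ennreal (pi / 4) * ennreal (?q p)"
      by (simp only: e m)
  qed
  also have "\<dots> = ennreal (pi / 4) * (\<integral>\<^sup>+ p. ennreal (?q p) \<partial>area_measure S)"
    by (rule nn_integral_cmult) (use \<open>?q \<in> borel_measurable (area_measure S)\<close> in simp)
  finally have "total_absolute_curvature S = 2 / vol_CP2 * (pi / 4 * (LINT p | area_measure S. ?q p))"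
    unfolding total_absolute_curvature_eq_nn_integral[OF assms] I by (simp add: enn2real_mult)
  \<comment> \<open>The factors combine as 2 / (pi^2/2) * pi/4 = 1/pi.\<close>
  then show ?thesis by (simp add: vol_CP2_eq power2_eq_square)
qed

end
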